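(* Let $G$ be a second countable almost unimodular group, and let $(\alpha,u)\colon\Delta_G(G)\curvearrowright L(G_1)$ be the cocycle action associated with a normalized section $\sigma\colon\Delta_G(G)\to G$. Then $\Gamma(\alpha,u)=\widehat{\Delta_G(G)}$.
   Context: For a locally compact group $G$ with left Haar measure, $\lambda_\ell^G$ is the left regular representation on $L^2(G)$, $L(G)=\{\lambda_\ell^G(g):g\in G\}''$ is the group von Neumann algebra, $\Delta_G\colon G\to(0,\infty)$ is the modular function and $G_1=\ker\Delta_G$. A locally compact group $G$ is almost unimodular if $G_1$ is open in $G$. The group $\Delta_G(G)\le\mathbb{R}_+=(0,\infty)$ is regarded as a discrete abelian group, with (compact) Pontryagin dual $\widehat{\Delta_G(G)}$ and pairing $\langle k,p\rangle$. Cocycle action associated with a section: let $K=\Delta_G(G)$ and let $\sigma\colon K\to G$ be a section, i.e. $\Delta_G(\sigma(k))=k$ for all $k\in K$, normalized so that $\sigma(1)=e_G$. Define for $k,k_1,k_2\in K$, $h\in G_1$ $$\beta_k(h)=\sigma(k^{-1})^{-1}h\,\sigma(k^{-1}),\qquad c(k_1,k_2)=\sigma(k_1^{-1})^{-1}\sigma(k_2^{-1})^{-1}\sigma(k_2^{-1}k_1^{-1})\in G_1 .$$ Then $\alpha_k\in\mathrm{Aut}(L(G_1))$ is the automorphism determined by $\alpha_k(\lambda_\ell^{G_1}(h))=\lambda_\ell^{G_1}(\beta_k(h))$, and $u(k_1,k_2)=\lambda_\ell^{G_1}(c(k_1,k_2))$. The pair $(\alpha,u)$ is a cocycle action of $K$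 on $L(G_1)$, i.e. $\alpha_{s}\alpha_{t}=\mathrm{Ad}(u(s,t))\alpha_{st}$, $u(s,t)u(st,r)=\alpha_s(u(t,r))u(s,tr)$, $u(s,1)=u(1,s)=1$. Twisted crossed product: $L(G_1)\rtimes_{\alpha,u}^\ell K$ is the von Neumann algebra on $\ell^2(K,L^2(G_1))$ generated by $(I_\ell^\alpha(x)\xi)(k)=\alpha_{k^{-1}}(x)\xi(k)$ for $x\in L(G_1)$ and $(\lambda_\ell^u(l)\xi)(k)=u(k^{-1},l)\xi(l^{-1}k)$ for $l\in K$. Dual action: for $p\in\hat K$ let $(\mu(p)\xi)(k)=\overline{\langle k,p\rangle}\xi(k)$; then $\hat\alpha_p=\mathrm{Ad}\,\mu(p)$ defines an action of $\hat K$ on $L(G_1)\rtimes_{\alpha,u}^\ell K$. Finally $$\Gamma(\alpha,u)=\{p\in\hat K:\hat\alpha_p(n)=n\text{ for all }n\in Z(L(G_1)\rtimes_{\alpha,u}^\ell K)\},$$ where $Z(\cdot)$ denotes the center. *)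

theory Defs
  imports "HOL-Analysis.Analysis" "HOL-Algebra.Coset"
begin

section \<open>Locally compact groups\<close>

definition topological_group :: "('a, 'b) monoid_scheme \<Rightarrow> 'a topology \<Rightarrow> bool" where
  "topological_group G T \<longleftrightarrow> group G \<and> topspace T = carrier G \<and>
     continuous_map (prod_topology T T) T (\<lambda>(x, y). x \<otimes>\<^bsub>G\<^esub> y) \<and>
     continuous_map T T (\<lambda>x. inv\<^bsub>G\<^esub> x)"

definition locally_compact_group :: "('a, 'b) monoid_scheme \<Rightarrow> 'a topology \<Rightarrow> bool" where
  "locally_compact_group G T \<longleftrightarrow>
     topological_group G T \<and> Hausdorff_space T \<and> locally_compact_space T"

text \<open>A left Haar measure is a nonzero left invariant Radon measure on the Borel
  \<open>\<sigma>\<close>-algebra of the group.\<close>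

definition left_haar_measure ::
    "('a, 'b) monoid_scheme \<Rightarrow> 'a topology \<Rightarrow> 'a measure \<Rightarrow> bool" where
  "left_haar_measure G T \<mu> \<longleftrightarrow>
     sets \<mu> = sigma_sets (topspace T) {U. openin T U} \<and>
     emeasure \<mu> (space \<mu>) \<noteq> 0 \<and>
     (\<forall>C. compactin T C \<longrightarrow> emeasure \<mu> C < \<infinity>) \<and>
     (\<forall>E\<in>sets \<mu>. emeasure \<mu> E = (INF U\<in>{U. openin T U \<and> E \<subseteq> U}. emeasure \<mu> U)) \<and>
     (\<forall>U. openin T U \<longrightarrow>
        emeasure \<mu> U = (SUP C\<in>{C. compactin T C \<and> C \<subseteq> U}. emeasure \<mu> C)) \<and>
     (\<forall>g\<in>carrier G. \<forall>E\<in>sets \<mu>. emeasure \<mu> (g <#\<^bsub>G\<^esub> E) = emeasure \<mu> E)"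

text \<open>Convention: \<open>\<mu>(E g) = \<Delta>(g) \<mu>(E)\<close>. For a left Haar measure \<open>\<mu>\<close> such a factor exists and
  is unique, and it does not depend on the choice of \<open>\<mu>\<close>.\<close>

definition modular_function :: "('a, 'b) monoid_scheme \<Rightarrow> 'a measure \<Rightarrow> 'a \<Rightarrow> real" where
  "modular_function G \<mu> g =
     (THE c. 0 < c \<and> (\<forall>E\<in>sets \<mu>. emeasure \<mu> (E #>\<^bsub>G\<^esub> g) = ennreal c * emeasure \<mu> E))"

definition modular_kernel :: "('a, 'b) monoid_scheme \<Rightarrow> 'a measure \<Rightarrow> 'a set" where
  "modular_kernel G \<mu> = {g \<in> carrier G. modular_function G \<mu> g = 1}"

abbreviation modular_kernel_group ::
    "('a, 'b) monoid_scheme \<Rightarrow> 'a measure \<Rightarrow> ('a, 'b) monoid_scheme" where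
  "modular_kernel_group G \<mu> \<equiv> G\<lparr>carrier := modular_kernel G \<mu>\<rparr>"

definition almost_unimodular ::
    "('a, 'b) monoid_scheme \<Rightarrow> 'a topology \<Rightarrow> 'a measure \<Rightarrow> bool" where
  "almost_unimodular G T \<mu> \<longleftrightarrow> openin T (modular_kernel G \<mu>)"

definition modular_range_group :: "('a, 'b) monoid_scheme \<Rightarrow> 'a measure \<Rightarrow> real monoid" where
  "modular_range_group G \<mu> =
     \<lparr>carrier = modular_function G \<mu> ` carrier G, mult = (*), one = 1\<rparr>"

definition circle_group :: "complex monoid" where
  "circle_group = \<lparr>carrier = sphere 0 1, mult = (*), one = 1\<rparr>"

definition pontryagin_dual ::
    "('k, 'b) monoid_scheme \<Rightarrow> 'k topology \<Rightarrow> ('k \<Rightarrow> complex) set" where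
  "pontryagin_dual K X =
     {p \<in> hom K circle_group \<inter> extensional (carrier K). continuous_map X euclidean p}"


section \<open>Hilbert spaces and operators\<close>

text \<open>The Hilbert spaces below depend on a measure, so they are given by an explicit set of
  vectors with operations on it. Inner products are linear in the first argument.\<close>

record 'v hilb =
  vecs :: "'v set"
  vadd :: "'v \<Rightarrow> 'v \<Rightarrow> 'v"
  vscale :: "complex \<Rightarrow> 'v \<Rightarrow> 'v"
  vinner :: "'v \<Rightarrow> 'v \<Rightarrow> complex"

definition vnorm :: "'v hilb \<Rightarrow> 'v \<Rightarrow> real" where
  "vnorm H v = sqrt (Re (vinner H v v))"

definition bounded_ops :: "'v hilb \<Rightarrow> ('v \<Rightarrow> 'v) set" where
  "bounded_ops H = {A \<in> vecs H \<rightarrow>\<^sub>E vecs H.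
     (\<forall>v\<in>vecs H. \<forall>w\<in>vecs H. A (vadd H v w) = vadd H (A v) (A w)) \<and>
     (\<forall>c. \<forall>v\<in>vecs H. A (vscale H c v) = vscale H c (A v)) \<and>
     (\<exists>C. \<forall>v\<in>vecs H. vnorm H (A v) \<le> C * vnorm H v)}"

definition op_add :: "'v hilb \<Rightarrow> ('v \<Rightarrow> 'v) \<Rightarrow> ('v \<Rightarrow> 'v) \<Rightarrow> 'v \<Rightarrow> 'v" where
  "op_add H A B = (\<lambda>v\<in>vecs H. vadd H (A v) (B v))"

definition op_scale :: "'v hilb \<Rightarrow> complex \<Rightarrow> ('v \<Rightarrow> 'v) \<Rightarrow> 'v \<Rightarrow> 'v" where
  "op_scale H c A = (\<lambda>v\<in>vecs H. vscale H c (A v))"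

definition op_mult :: "'v hilb \<Rightarrow> ('v \<Rightarrow> 'v) \<Rightarrow> ('v \<Rightarrow> 'v) \<Rightarrow> 'v \<Rightarrow> 'v" where
  "op_mult H A B = compose (vecs H) A B"

definition op_adjoint :: "'v hilb \<Rightarrow> ('v \<Rightarrow> 'v) \<Rightarrow> 'v \<Rightarrow> 'v" where
  "op_adjoint H A = (THE B. B \<in> bounded_ops H \<and>
     (\<forall>v\<in>vecs H. \<forall>w\<in>vecs H. vinner H (A v) w = vinner H v (B w)))"

definition commutant :: "'v hilb \<Rightarrow> ('v \<Rightarrow> 'v) set \<Rightarrow> ('v \<Rightarrow> 'v) set" where
  "commutant H S = {A \<in> bounded_ops H. \<forall>B\<in>S. op_mult H A B = op_mult H B A}"

definition generated_vna :: "'v hilb \<Rightarrow> ('v \<Rightarrow> 'v) set \<Rightarrow> ('v \<Rightarrow> 'v) set" where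
  "generated_vna H S = commutant H (commutant H (S \<union> op_adjoint H ` S))"

definition vna_center :: "'v hilb \<Rightarrow> ('v \<Rightarrow> 'v) set \<Rightarrow> ('v \<Rightarrow> 'v) set" where
  "vna_center H M = M \<inter> commutant H M"

definition normal_functional ::
    "'v hilb \<Rightarrow> ('v \<Rightarrow> 'v) set \<Rightarrow> (('v \<Rightarrow> 'v) \<Rightarrow> complex) \<Rightarrow> bool" where
  "normal_functional H M \<phi> \<longleftrightarrow>
     (\<exists>\<xi> \<eta> :: nat \<Rightarrow> 'v. range \<xi> \<subseteq> vecs H \<and> range \<eta> \<subseteq> vecs H \<and>
        summable (\<lambda>n. (vnorm H (\<xi> n))\<^sup>2) \<and> summable (\<lambda>n. (vnorm H (\<eta> n))\<^sup>2) \<and>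
        (\<forall>A\<in>M. \<phi> A = (\<Sum>n. vinner H (A (\<xi> n)) (\<eta> n))))"

text \<open>\<open>Aut(M)\<close> consists of the \<open>*\<close>-automorphisms of \<open>M\<close>. The last conjunct (normality, that is,
  \<open>\<sigma>\<close>-weak continuity) holds for every \<open>*\<close>-automorphism of a von Neumann algebra; it is what
  makes an automorphism determined by its values on generators. Elements of \<open>Aut(M)\<close> are
  extensional, so that they are determined as HOL functions by their values on \<open>M\<close>.\<close>

definition vna_aut :: "'v hilb \<Rightarrow> ('v \<Rightarrow> 'v) set \<Rightarrow> (('v \<Rightarrow> 'v) \<Rightarrow> ('v \<Rightarrow> 'v)) set" where
  "vna_aut H M = {a \<in> extensional M. bij_betw a M M \<and>
     (\<forall>A\<in>M. \<forall>B\<in>M. a (op_add H A B) = op_add H (a A) (a B)) \<and>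
     (\<forall>c. \<forall>A\<in>M. a (op_scale H c A) = op_scale H c (a A)) \<and>
     (\<forall>A\<in>M. \<forall>B\<in>M. a (op_mult H A B) = op_mult H (a A) (a B)) \<and>
     (\<forall>A\<in>M. a (op_adjoint H A) = op_adjoint H (a A)) \<and>
     (\<forall>\<phi>. normal_functional H M \<phi> \<longrightarrow> normal_functional H M (\<phi> \<circ> a))}"


section \<open>The Hilbert spaces \<open>L\<^sup>2(\<mu>)\<close> and \<open>\<ell>\<^sup>2(K, H)\<close>\<close>

definition square_integrable :: "'a measure \<Rightarrow> ('a \<Rightarrow> complex) set" where
  "square_integrable \<mu> = {f \<in> borel_measurable \<mu>. integrable \<mu> (\<lambda>x. (cmod (f x))\<^sup>2)}"

definition L2_class :: "'a measure \<Rightarrow> ('a \<Rightarrow> complex) \<Rightarrow> ('a \<Rightarrow> complex) set" where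
  "L2_class \<mu> f = {g \<in> square_integrable \<mu>. AE x in \<mu>. g x = f x}"

definition L2_rep :: "('a \<Rightarrow> complex) set \<Rightarrow> 'a \<Rightarrow> complex" where
  "L2_rep v = (SOME f. f \<in> v)"

definition L2 :: "'a measure \<Rightarrow> ('a \<Rightarrow> complex) set hilb" where
  "L2 \<mu> = \<lparr>vecs = L2_class \<mu> ` square_integrable \<mu>,
     vadd = (\<lambda>v w. L2_class \<mu> (\<lambda>x. L2_rep v x + L2_rep w x)),
     vscale = (\<lambda>c v. L2_class \<mu> (\<lambda>x. c * L2_rep v x)),
     vinner = (\<lambda>v w. \<integral>x. L2_rep v x * cnj (L2_rep w x) \<partial>\<mu>)\<rparr>"

definition l2 :: "'k set \<Rightarrow> 'v hilb \<Rightarrow> ('k \<Rightarrow> 'v) hilb" where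
  "l2 I H = \<lparr>vecs = {\<xi> \<in> I \<rightarrow>\<^sub>E vecs H. (\<lambda>k. (vnorm H (\<xi> k))\<^sup>2) summable_on I},
     vadd = (\<lambda>\<xi> \<eta>. \<lambda>k\<in>I. vadd H (\<xi> k) (\<eta> k)),
     vscale = (\<lambda>c \<xi>. \<lambda>k\<in>I. vscale H c (\<xi> k)),
     vinner = (\<lambda>\<xi> \<eta>. \<Sum>\<^sub>\<infinity>k\<in>I. vinner H (\<xi> k) (\<eta> k))\<rparr>"


section \<open>Group von Neumann algebras\<close>

definition left_regular ::
    "('a, 'b) monoid_scheme \<Rightarrow> 'a measure \<Rightarrow> 'a \<Rightarrow> ('a \<Rightarrow> complex) set \<Rightarrow> ('a \<Rightarrow> complex) set" where
  "left_regular G \<mu> g = (\<lambda>v\<in>vecs (L2 \<mu>). L2_class \<mu> (\<lambda>x. L2_rep v (inv\<^bsub>G\<^esub> g \<otimes>\<^bsub>G\<^esub> x)))"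

definition group_vna ::
    "('a, 'b) monoid_scheme \<Rightarrow> 'a measure \<Rightarrow> (('a \<Rightarrow> complex) set \<Rightarrow> ('a \<Rightarrow> complex) set) set" where
  "group_vna G \<mu> = commutant (L2 \<mu>) (commutant (L2 \<mu>) (left_regular G \<mu> ` carrier G))"


section \<open>Twisted crossed products and the dual action\<close>

context
  fixes H :: "'v hilb"
    and K :: "('k, 'b) monoid_scheme"
begin

definition crossed_embed ::
    "('k \<Rightarrow> ('v \<Rightarrow> 'v) \<Rightarrow> ('v \<Rightarrow> 'v)) \<Rightarrow> ('v \<Rightarrow> 'v) \<Rightarrow> ('k \<Rightarrow> 'v) \<Rightarrow> ('k \<Rightarrow> 'v)" where
  "crossed_embed \<alpha> A =
     (\<lambda>\<xi>\<in>vecs (l2 (carrier K) H). \<lambda>k\<in>carrier K. \<alpha> (inv\<^bsub>K\<^esub> k) A (\<xi> k))"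

definition crossed_shift ::
    "('k \<Rightarrow> 'k \<Rightarrow> 'v \<Rightarrow> 'v) \<Rightarrow> 'k \<Rightarrow> ('k \<Rightarrow> 'v) \<Rightarrow> ('k \<Rightarrow> 'v)" where
  "crossed_shift u l =
     (\<lambda>\<xi>\<in>vecs (l2 (carrier K) H). \<lambda>k\<in>carrier K. u (inv\<^bsub>K\<^esub> k) l (\<xi> (inv\<^bsub>K\<^esub> l \<otimes>\<^bsub>K\<^esub> k)))"

definition twisted_crossed_product ::
    "('v \<Rightarrow> 'v) set \<Rightarrow> ('k \<Rightarrow> ('v \<Rightarrow> 'v) \<Rightarrow> ('v \<Rightarrow> 'v)) \<Rightarrow> ('k \<Rightarrow> 'k \<Rightarrow> 'v \<Rightarrow> 'v) \<Rightarrow>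
      (('k \<Rightarrow> 'v) \<Rightarrow> ('k \<Rightarrow> 'v)) set" where
  "twisted_crossed_product M \<alpha> u =
     generated_vna (l2 (carrier K) H) (crossed_embed \<alpha> ` M \<union> crossed_shift u ` carrier K)"

definition dual_unitary :: "('k \<Rightarrow> complex) \<Rightarrow> ('k \<Rightarrow> 'v) \<Rightarrow> ('k \<Rightarrow> 'v)" where
  "dual_unitary p =
     (\<lambda>\<xi>\<in>vecs (l2 (carrier K) H). \<lambda>k\<in>carrier K. vscale H (cnj (p k)) (\<xi> k))"

definition dual_action ::
    "('k \<Rightarrow> complex) \<Rightarrow> (('k \<Rightarrow> 'v) \<Rightarrow> ('k \<Rightarrow> 'v)) \<Rightarrow> (('k \<Rightarrow> 'v) \<Rightarrow> ('k \<Rightarrow> 'v))" where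
  "dual_action p n = (let L = l2 (carrier K) H in
     op_mult L (op_mult L (dual_unitary p) n) (op_adjoint L (dual_unitary p)))"

text \<open>Here \<open>K\<close> carries the discrete topology.\<close>

definition Gamma_invariant ::
    "('v \<Rightarrow> 'v) set \<Rightarrow> ('k \<Rightarrow> ('v \<Rightarrow> 'v) \<Rightarrow> ('v \<Rightarrow> 'v)) \<Rightarrow> ('k \<Rightarrow> 'k \<Rightarrow> 'v \<Rightarrow> 'v) \<Rightarrow>
      ('k \<Rightarrow> complex) set" where
  "Gamma_invariant M \<alpha> u =
     {p \<in> pontryagin_dual K (discrete_topology (carrier K)).
        \<forall>n\<in>vna_center (l2 (carrier K) H) (twisted_crossed_product M \<alpha> u). dual_action p n = n}"

end


section \<open>The cocycle action associated with a section of the modular function\<close>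

definition normalized_section ::
    "('a, 'b) monoid_scheme \<Rightarrow> 'a measure \<Rightarrow> (real \<Rightarrow> 'a) \<Rightarrow> bool" where
  "normalized_section G \<mu> \<sigma> \<longleftrightarrow>
     (\<forall>k\<in>carrier (modular_range_group G \<mu>).
        \<sigma> k \<in> carrier G \<and> modular_function G \<mu> (\<sigma> k) = k) \<and>
     \<sigma> 1 = \<one>\<^bsub>G\<^esub>"

definition section_conj :: "('a, 'b) monoid_scheme \<Rightarrow> (real \<Rightarrow> 'a) \<Rightarrow> real \<Rightarrow> 'a \<Rightarrow> 'a" where
  "section_conj G \<sigma> k h = inv\<^bsub>G\<^esub> (\<sigma> (inverse k)) \<otimes>\<^bsub>G\<^esub> h \<otimes>\<^bsub>G\<^esub> \<sigma> (inverse k)"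

definition section_cocycle :: "('a, 'b) monoid_scheme \<Rightarrow> (real \<Rightarrow> 'a) \<Rightarrow> real \<Rightarrow> real \<Rightarrow> 'a" where
  "section_cocycle G \<sigma> k\<^sub>1 k\<^sub>2 =
     inv\<^bsub>G\<^esub> (\<sigma> (inverse k\<^sub>1)) \<otimes>\<^bsub>G\<^esub> inv\<^bsub>G\<^esub> (\<sigma> (inverse k\<^sub>2)) \<otimes>\<^bsub>G\<^esub>
       \<sigma> (inverse k\<^sub>2 * inverse k\<^sub>1)"

text \<open>Below, \<open>\<mu>\<close> is a left Haar measure of \<open>G\<close> and \<open>\<nu>\<close> one of \<open>G\<^sub>1 = ker \<Delta>\<close>.\<close>

definition section_action ::
    "('a, 'b) monoid_scheme \<Rightarrow> 'a measure \<Rightarrow> 'a measure \<Rightarrow> (real \<Rightarrow> 'a) \<Rightarrow> real \<Rightarrow>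
      (('a \<Rightarrow> complex) set \<Rightarrow> ('a \<Rightarrow> complex) set) \<Rightarrow> (('a \<Rightarrow> complex) set \<Rightarrow> ('a \<Rightarrow> complex) set)"
  where
  "section_action G \<mu> \<nu> \<sigma> k = (let G\<^sub>1 = modular_kernel_group G \<mu> in
     THE a. a \<in> vna_aut (L2 \<nu>) (group_vna G\<^sub>1 \<nu>) \<and>
       (\<forall>h\<in>carrier G\<^sub>1. a (left_regular G\<^sub>1 \<nu> h) = left_regular G\<^sub>1 \<nu> (section_conj G \<sigma> k h)))"

definition section_unitary ::
    "('a, 'b) monoid_scheme \<Rightarrow> 'a measure \<Rightarrow> 'a measure \<Rightarrow> (real \<Rightarrow> 'a) \<Rightarrow> real \<Rightarrow> real \<Rightarrow>
      ('a \<Rightarrow> complex) set \<Rightarrow> ('a \<Rightarrow> complex) set" where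
  "section_unitary G \<mu> \<nu> \<sigma> k\<^sub>1 k\<^sub>2 =
     left_regular (modular_kernel_group G \<mu>) \<nu> (section_cocycle G \<sigma> k\<^sub>1 k\<^sub>2)"

end

theory Submission
  imports Defs
begin

text \<open>
  Writing the elements of \<open>G\<close> as \<open>\<sigma> k \<otimes> y\<close> with \<open>k\<close> in the range \<open>K\<close> of the modular function \<open>D\<close>
  and \<open>y\<close> in its kernel identifies the space \<open>\<ell>\<^sup>2(K, L\<^sup>2(G\<^sub>1))\<close> of the crossed product with \<open>L\<^sup>2(G)\<close>.
  In this picture the generators that come from group elements are left translations
  (\<open>embed_left_translation\<close>, \<open>shift_eq_B\<close>), right translations commute with the whole crossed
  product (\<open>B_right_embed\<close>), and the unitary implementing the dual action of \<open>p\<close> is multiplication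
  by the conjugate of \<open>p \<circ> D\<close>. A central element \<open>n\<close> therefore commutes with all left and right
  translations (\<open>center_commutes_B\<close>), and it is fixed by the dual action as soon as it maps
  functions supported on a fiber of \<open>D\<close> to functions supported on the same fiber.

  That it does so is the triviality of the modular automorphism group on the center of the group
  von Neumann algebra. On the level of integral kernels the reason is short. Commuting with left
  translations makes the kernel of \<open>n\<close> a function \<open>N(x\<^sup>-\<^sup>1 y)\<close>; commuting with right translations
  means \<open>N(g\<^sup>-\<^sup>1 a g) = D(g)\<^sup>-\<^sup>1 N(a)\<close>; for \<open>g = a\<close> this gives \<open>N(a) = D(a)\<^sup>-\<^sup>1 N(a)\<close>, so \<open>N\<close> vanishes
  where \<open>D \<noteq> 1\<close>. Since \<open>n\<close> need not have a kernel, the argument is carried out for the matrix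
  coefficients \<open>\<langle>n 1\<^sub>X, 1\<^sub>Z\<rangle>\<close> at indicator functions, averaged over translates. The place of the
  substitution \<open>g = a\<close> is taken by a symmetry of order three of a trilinear form (\<open>Q_rotate\<close>), which forces the
  form to vanish off the diagonal (\<open>Q_eq_0\<close>, \<open>bimeasure_diagonal\<close>).

  Two points need preparation because the objects are given by their characterising properties.
  The modular function scales \<open>\<mu>\<close> under right translation, and \<open>\<nu>\<close> is a multiple of the
  restriction of \<open>\<mu>\<close> to the kernel, both by uniqueness of invariant measures on measurable groups
  (\<open>left_invariant_unique\<close>, \<open>haar_modular_kernel\<close>). The automorphism \<open>\<alpha>\<^sub>k\<close> is conjugation by a
  two-sided translation (\<open>section_action_eq\<close>), because a normal automorphism is determined by its
  values on the translations (\<open>vna_aut_unique\<close>); this rests on von Neumann's density argument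
  (\<open>functional_vanishes_on_bicommutant\<close>) and hence on the completeness of \<open>L\<^sup>2\<close> and \<open>\<ell>\<^sup>2\<close>.
\<close>

section \<open>Hilbert spaces given by a carrier\<close>

definition vdiff :: "'v hilb \<Rightarrow> 'v \<Rightarrow> 'v \<Rightarrow> 'v" where
  "vdiff H v w = vadd H v (vscale H (-1) w)"

text \<open>Vectors are separated by their inner products, so all vector space axioms follow from the
  sesquilinearity of the inner product.\<close>

locale hilb_space =
  fixes H :: "'v hilb"
  assumes nonempty: "vecs H \<noteq> {}"
    and add_closed [simp, intro]: "\<lbrakk>v \<in> vecs H; w \<in> vecs H\<rbrakk> \<Longrightarrow> vadd H v w \<in> vecs H"
    and scale_closed [simp, intro]: "v \<in> vecs H \<Longrightarrow> vscale H c v \<in> vecs H"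
    and inner_add_left [simp]: "\<lbrakk>u \<in> vecs H; v \<in> vecs H; w \<in> vecs H\<rbrakk> \<Longrightarrow>
       vinner H (vadd H u v) w = vinner H u w + vinner H v w"
    and inner_scale_left [simp]: "\<lbrakk>v \<in> vecs H; w \<in> vecs H\<rbrakk> \<Longrightarrow>
       vinner H (vscale H c v) w = c * vinner H v w"
    and inner_commute: "\<lbrakk>v \<in> vecs H; w \<in> vecs H\<rbrakk> \<Longrightarrow> vinner H w v = cnj (vinner H v w)"
    and inner_self_nonneg [simp]: "v \<in> vecs H \<Longrightarrow> 0 \<le> Re (vinner H v v)"
    and inner_ext: "\<lbrakk>u \<in> vecs H; v \<in> vecs H; \<And>w. w \<in> vecs H \<Longrightarrow> vinner H u w = vinner H v w\<rbrakk>
       \<Longrightarrow> u = v"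
    and complete: "\<lbrakk>\<And>n. s n \<in> vecs H; 
         \<And>e. e > 0 \<Longrightarrow> \<exists>N. \<forall>m\<ge>N. \<forall>n\<ge>N. vnorm H (vdiff H (s m) (s n)) \<le> e\<rbrakk>
       \<Longrightarrow> \<exists>v\<in>vecs H. (\<lambda>n. vnorm H (vdiff H (s n) v)) \<longlonglongrightarrow> 0"
begin

lemma diff_closed [simp, intro]: "\<lbrakk>v \<in> vecs H; w \<in> vecs H\<rbrakk> \<Longrightarrow> vdiff H v w \<in> vecs H"
  by (simp add: vdiff_def)

lemma inner_diff_left [simp]: "\<lbrakk>u \<in> vecs H; v \<in> vecs H; w \<in> vecs H\<rbrakk> \<Longrightarrow>
       vinner H (vdiff H u v) w = vinner H u w - vinner H v w"
  by (simp add: vdiff_def)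

lemma inner_add_right [simp]: "\<lbrakk>u \<in> vecs H; v \<in> vecs H; w \<in> vecs H\<rbrakk> \<Longrightarrow>
       vinner H w (vadd H u v) = vinner H w u + vinner H w v"
  using inner_commute[of "vadd H u v" w] inner_commute[of u w] inner_commute[of v w] by simp

lemma inner_diff_right [simp]: "\<lbrakk>u \<in> vecs H; v \<in> vecs H; w \<in> vecs H\<rbrakk> \<Longrightarrow>
       vinner H w (vdiff H u v) = vinner H w u - vinner H w v"
  using inner_commute[of "vdiff H u v" w] inner_commute[of u w] inner_commute[of v w] by simp

lemma inner_scale_right [simp]: "\<lbrakk>v \<in> vecs H; w \<in> vecs H\<rbrakk> \<Longrightarrow>
       vinner H w (vscale H c v) = cnj c * vinner H w v"
  using inner_commute[of "vscale H c v" w] inner_commute[of v w] by simp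

lemma inner_ext_right:
  "\<lbrakk>u \<in> vecs H; v \<in> vecs H; \<And>w. w \<in> vecs H \<Longrightarrow> vinner H w u = vinner H w v\<rbrakk> \<Longrightarrow> u = v"
  by (metis inner_commute inner_ext)

lemma inner_self_of_real: "v \<in> vecs H \<Longrightarrow> vinner H v v = of_real (Re (vinner H v v))"
  using inner_commute[of v v] by (metis Reals_cnj_iff of_real_Re)

lemma inner_self: "v \<in> vecs H \<Longrightarrow> vinner H v v = of_real ((vnorm H v)\<^sup>2)"
  using inner_self_of_real[of v] by (simp add: vnorm_def)

lemma norm_nonneg [simp]: "v \<in> vecs H \<Longrightarrow> 0 \<le> vnorm H v"
  by (simp add: vnorm_def)

lemma norm_sq: "v \<in> vecs H \<Longrightarrow> (vnorm H v)\<^sup>2 = Re (vinner H v v)"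
  by (simp add: vnorm_def)

lemma Re_inner_commute: "\<lbrakk>v \<in> vecs H; w \<in> vecs H\<rbrakk> \<Longrightarrow> Re (vinner H w v) = Re (vinner H v w)"
  using inner_commute[of v w] by simp

lemma norm_diff_sq: "\<lbrakk>v \<in> vecs H; w \<in> vecs H\<rbrakk> \<Longrightarrow>
    (vnorm H (vdiff H v w))\<^sup>2 = (vnorm H v)\<^sup>2 + (vnorm H w)\<^sup>2 - 2 * Re (vinner H v w)"
  using Re_inner_commute[of v w] by (simp add: norm_sq)

lemma norm_scale: "v \<in> vecs H \<Longrightarrow> vnorm H (vscale H c v) = cmod c * vnorm H v"
proof -
  assume v: "v \<in> vecs H"
  have c: "c * cnj c = of_real ((cmod c)\<^sup>2)" using complex_norm_square[of c] by simp
  have "vinner H (vscale H c v) (vscale H c v) = (c * cnj c) * vinner H v v"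
    using v by simp
  also have "\<dots> = of_real ((cmod c)\<^sup>2 * (vnorm H v)\<^sup>2)"
    unfolding c inner_self[OF v] by simp
  finally have "(vnorm H (vscale H c v))\<^sup>2 = (cmod c * vnorm H v)\<^sup>2"
    using v by (simp add: norm_sq power_mult_distrib)
  then show ?thesis using v by (metis norm_ge_zero norm_nonneg power2_eq_imp_eq scale_closed zero_le_mult_iff)
qed

text \<open>If \<open>v\<close> is within \<open>e\<close> of being shortest among its translates by multiples of \<open>w\<close>, then it
  is nearly orthogonal to \<open>w\<close>: compare with the translate that minimises the norm.\<close>

lemma almost_orthogonal:
  assumes v: "v \<in> vecs H" and w: "w \<in> vecs H" and e: "0 \<le> e"
    and min: "\<And>c. (vnorm H v)\<^sup>2 \<le> (vnorm H (vdiff H v (vscale H c w)))\<^sup>2 + e"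
  shows "(cmod (vinner H v w))\<^sup>2 \<le> e * (vnorm H w)\<^sup>2"
proof -
  let ?z = "vinner H v w"
  have main: "2 * t * (cmod ?z)\<^sup>2 \<le> t\<^sup>2 * (cmod ?z)\<^sup>2 * (vnorm H w)\<^sup>2 + e" for t :: real
  proof -
    have "(vnorm H (vdiff H v (vscale H (of_real t * ?z) w)))\<^sup>2 =
       (vnorm H v)\<^sup>2 + (cmod (of_real t * ?z) * vnorm H w)\<^sup>2 - 2 * Re (cnj (of_real t * ?z) * ?z)"
      using v w by (simp add: norm_diff_sq norm_scale)
    also have "cnj (of_real t * ?z) * ?z = of_real (t * (cmod ?z)\<^sup>2)"
      using complex_norm_square[of ?z] by (simp add: mult_ac)
    finally show ?thesis using min[of "of_real t * ?z"]
      by (simp add: power_mult_distrib norm_mult)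
  qed
  let ?a = "(cmod ?z)\<^sup>2" and ?b = "(vnorm H w)\<^sup>2"
  show ?thesis
  proof (cases "?b = 0")
    case True
    have "?a \<le> 0"
    proof (rule ccontr)
      assume "\<not> ?a \<le> 0"
      then have a: "?a > 0" by simp
      have "2 * ((e + 1) / ?a) * ?a \<le> e" using main[of "(e + 1) / ?a"] True by simp
      then show False using a e by simp
    qed
    then show ?thesis using True by simp
  next
    case False
    then have b: "?b > 0" by (metis less_eq_real_def zero_le_power2)
    have "a \<le> e * b" if "2 * (1 / b) * a \<le> (1 / b)\<^sup>2 * a * b + e" "b > 0" for a b :: real
      using that by (simp add: power2_eq_square field_simps)
    from this[OF main b] show ?thesis .
  qed
qed

lemma cauchy_schwarz:
  assumes v: "v \<in> vecs H" and w: "w \<in> vecs H"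
  shows "cmod (vinner H v w) \<le> vnorm H v * vnorm H w"
proof -
  have "(cmod (vinner H v w))\<^sup>2 \<le> (vnorm H v)\<^sup>2 * (vnorm H w)\<^sup>2"
    by (rule almost_orthogonal) (use v w in auto)
  then have "(cmod (vinner H v w))\<^sup>2 \<le> (vnorm H v * vnorm H w)\<^sup>2"
    by (simp add: power_mult_distrib)
  then show ?thesis using v w by (meson norm_nonneg power2_le_imp_le mult_nonneg_nonneg)
qed

lemma inner_bound:
  assumes v: "v \<in> vecs H" and w: "w \<in> vecs H"
  shows "cmod (vinner H v w) \<le> (vnorm H v)\<^sup>2 + (vnorm H w)\<^sup>2"
proof -
  have "vnorm H v * vnorm H w \<le> (vnorm H v)\<^sup>2 + (vnorm H w)\<^sup>2"
    using sum_squares_bound[of "vnorm H v" "vnorm H w"]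
      mult_nonneg_nonneg[OF norm_nonneg[OF v] norm_nonneg[OF w]] by linarith
  with cauchy_schwarz[OF v w] show ?thesis by linarith
qed

lemma norm_triangle:
  assumes v: "v \<in> vecs H" and w: "w \<in> vecs H"
  shows "vnorm H (vadd H v w) \<le> vnorm H v + vnorm H w"
proof -
  have "(vnorm H (vadd H v w))\<^sup>2 = (vnorm H v)\<^sup>2 + (vnorm H w)\<^sup>2 + 2 * Re (vinner H v w)"
    using v w Re_inner_commute[of v w] by (simp add: norm_sq)
  also have "\<dots> \<le> (vnorm H v)\<^sup>2 + (vnorm H w)\<^sup>2 + 2 * (vnorm H v * vnorm H w)"
    using cauchy_schwarz[OF v w] complex_Re_le_cmod[of "vinner H v w"] by linarith
  also have "\<dots> = (vnorm H v + vnorm H w)\<^sup>2" by (simp add: power2_sum)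
  finally show ?thesis using v w by (meson add_nonneg_nonneg norm_nonneg power2_le_imp_le)
qed

lemma norm_eq_0: "v \<in> vecs H \<Longrightarrow> w \<in> vecs H \<Longrightarrow> vnorm H v = 0 \<Longrightarrow> vinner H v w = 0"
  using cauchy_schwarz[of v w] by simp


lemma inner_tendsto:
  assumes s: "\<And>n. s n \<in> vecs H" and v: "v \<in> vecs H"
    and lim: "(\<lambda>n. vnorm H (vdiff H (s n) v)) \<longlonglongrightarrow> 0" and w: "w \<in> vecs H"
  shows "(\<lambda>n. vinner H (s n) w) \<longlonglongrightarrow> vinner H v w"
proof -
  have "(\<lambda>n. vnorm H (vdiff H (s n) v) * vnorm H w) \<longlonglongrightarrow> 0"
    using tendsto_mult_right[OF lim, of "vnorm H w"] by simp
  moreover have "norm (vinner H (s n) w - vinner H v w) \<le> vnorm H (vdiff H (s n) v) * vnorm H w"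
    for n using cauchy_schwarz[of "vdiff H (s n) v" w] s v w by simp
  ultimately have "(\<lambda>n. vinner H (s n) w - vinner H v w) \<longlonglongrightarrow> 0"
    by (rule_tac Lim_null_comparison[OF always_eventually]) auto
  then show ?thesis by (simp add: LIM_zero_iff)
qed

definition closed_subspace :: "'v set \<Rightarrow> bool" where
  "closed_subspace Y \<longleftrightarrow> Y \<subseteq> vecs H \<and> Y \<noteq> {} \<and> (\<forall>v\<in>Y. \<forall>w\<in>Y. vadd H v w \<in> Y) \<and>
     (\<forall>c. \<forall>v\<in>Y. vscale H c v \<in> Y) \<and>
     (\<forall>s. \<forall>v\<in>vecs H. (\<forall>n. s n \<in> Y) \<and> (\<lambda>n. vnorm H (vdiff H (s n) v)) \<longlonglongrightarrow> 0 \<longrightarrow> v \<in> Y)"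

text \<open>The orthogonal projection is the limit of a sequence in the subspace whose distances to
  the given vector approach the infimum; the parallelogram law makes it a Cauchy sequence.\<close>

lemma orthogonal_projection:
  assumes Y: "closed_subspace Y" and v: "v \<in> vecs H"
  obtains y where "y \<in> Y" "\<And>z. z \<in> Y \<Longrightarrow> vinner H (vdiff H v y) z = 0"
proof -
  have YV: "\<And>y. y \<in> Y \<Longrightarrow> y \<in> vecs H" and Yne: "Y \<noteq> {}"
    and Yadd: "\<And>u w. u \<in> Y \<Longrightarrow> w \<in> Y \<Longrightarrow> vadd H u w \<in> Y"
    and Ysc: "\<And>c u. u \<in> Y \<Longrightarrow> vscale H c u \<in> Y"
    using Y by (auto simp: closed_subspace_def)
  define d where "d = (INF y\<in>Y. (vnorm H (vdiff H v y))\<^sup>2)"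
  have bdd: "bdd_below ((\<lambda>y. (vnorm H (vdiff H v y))\<^sup>2) ` Y)" by (rule bdd_belowI2[of _ 0]) simp
  have d_le: "d \<le> (vnorm H (vdiff H v y))\<^sup>2" if "y \<in> Y" for y
    unfolding d_def using bdd that by (rule cINF_lower)
  have "\<exists>y\<in>Y. (vnorm H (vdiff H v y))\<^sup>2 < d + 1 / real (Suc n)" for n
    using cINF_less_iff[OF Yne bdd, of "d + 1 / real (Suc n)"] by (simp add: d_def)
  then obtain s where sY: "\<And>n. s n \<in> Y"
    and sd: "\<And>n. (vnorm H (vdiff H v (s n)))\<^sup>2 < d + 1 / real (Suc n)" by metis
  have sV: "\<And>n. s n \<in> vecs H" using sY YV by blast
  have par: "(vnorm H (vdiff H (s m) (s n)))\<^sup>2 \<le> 2 / real (Suc m) + 2 / real (Suc n)" for m n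
  proof -
    let ?mid = "vscale H (1/2) (vadd H (s m) (s n))"
    have "(vnorm H (vdiff H (s m) (s n)))\<^sup>2 = 2 * (vnorm H (vdiff H v (s m)))\<^sup>2
       + 2 * (vnorm H (vdiff H v (s n)))\<^sup>2 - 4 * (vnorm H (vdiff H v ?mid))\<^sup>2"
      using sV v Re_inner_commute[of v "s m"] Re_inner_commute[of v "s n"]
        Re_inner_commute[of "s m" "s n"]
      by (simp add: norm_sq field_simps)
    moreover have "d \<le> (vnorm H (vdiff H v ?mid))\<^sup>2" using sY by (intro d_le Ysc Yadd)
    ultimately show ?thesis using sd[of m] sd[of n] by linarith
  qed
  have "\<exists>N. \<forall>m\<ge>N. \<forall>n\<ge>N. vnorm H (vdiff H (s m) (s n)) \<le> e" if e: "e > 0" for e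
  proof -
    obtain N :: nat where N: "4 / e\<^sup>2 < real N" using reals_Archimedean2 by blast
    have "vnorm H (vdiff H (s m) (s n)) \<le> e" if "m \<ge> N" "n \<ge> N" for m n
    proof (rule power2_le_imp_le)
      have N0: "real N > 0" using N e by (smt (verit) divide_nonneg_nonneg zero_le_power2)
      have "2 / real (Suc m) \<le> 2 / real N" "2 / real (Suc n) \<le> 2 / real N"
        using that N0 by (auto intro!: divide_left_mono)
      then have "(vnorm H (vdiff H (s m) (s n)))\<^sup>2 \<le> 4 / real N" using par[of m n] by linarith
      also have "\<dots> \<le> e\<^sup>2" using N e N0 by (simp add: field_simps)
      finally show "(vnorm H (vdiff H (s m) (s n)))\<^sup>2 \<le> e\<^sup>2" .
    qed (use e in simp)
    then show ?thesis by blast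
  qed
  then have "\<exists>y\<in>vecs H. (\<lambda>n. vnorm H (vdiff H (s n) y)) \<longlonglongrightarrow> 0" by (rule complete[OF sV])
  then obtain y where y: "y \<in> vecs H" and lim: "(\<lambda>n. vnorm H (vdiff H (s n) y)) \<longlonglongrightarrow> 0" by blast
  have yY: "y \<in> Y" using Y y lim sY unfolding closed_subspace_def by blast
  have "vinner H (vdiff H v y) z = 0" if z: "z \<in> Y" for z
  proof -
    have zV: "z \<in> vecs H" using z YV by blast
    have le: "(cmod (vinner H (vdiff H v (s n)) z))\<^sup>2 \<le> 1 / real (Suc n) * (vnorm H z)\<^sup>2" for n
    proof (rule almost_orthogonal)
      fix c
      have "vdiff H (vdiff H v (s n)) (vscale H c z) = vdiff H v (vadd H (s n) (vscale H c z))"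
        using v sV zV by (intro inner_ext) auto
      moreover have "d \<le> (vnorm H (vdiff H v (vadd H (s n) (vscale H c z))))\<^sup>2"
        using sY z by (intro d_le Ysc Yadd)
      ultimately show "(vnorm H (vdiff H v (s n)))\<^sup>2
        \<le> (vnorm H (vdiff H (vdiff H v (s n)) (vscale H c z)))\<^sup>2 + 1 / real (Suc n)"
        using sd[of n] by simp
    qed (use v sV zV in auto)
    have "(\<lambda>n. vinner H v z - vinner H (s n) z) \<longlonglongrightarrow> vinner H v z - vinner H y z"
      using inner_tendsto[OF sV y lim zV] by (intro tendsto_diff tendsto_const)
    then have "(\<lambda>n. (cmod (vinner H (vdiff H v (s n)) z))\<^sup>2) \<longlonglongrightarrow> (cmod (vinner H (vdiff H v y) z))\<^sup>2"
      using v sV zV y by (auto intro!: tendsto_power tendsto_norm)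
    moreover have "(\<lambda>n. 1 / real (Suc n) * (vnorm H z)\<^sup>2) \<longlonglongrightarrow> 0 * (vnorm H z)\<^sup>2"
      by (intro tendsto_mult tendsto_const) (use LIMSEQ_inverse_real_of_nat in \<open>simp add: divide_inverse\<close>)
    ultimately have "(cmod (vinner H (vdiff H v y) z))\<^sup>2 \<le> 0 * (vnorm H z)\<^sup>2"
      using le by (rule_tac LIMSEQ_le) auto
    then show ?thesis by simp
  qed
  with yY show ?thesis using that by blast
qed

text \<open>The representing vector is a multiple of the component orthogonal to the kernel of \<open>f\<close> of any
  vector outside the kernel.\<close>

lemma riesz_representation:
  assumes add: "\<And>v w. v \<in> vecs H \<Longrightarrow> w \<in> vecs H \<Longrightarrow> f (vadd H v w) = f v + f w"
    and scale: "\<And>c v. v \<in> vecs H \<Longrightarrow> f (vscale H c v) = c * f v"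
    and bound: "\<And>v. v \<in> vecs H \<Longrightarrow> cmod (f v) \<le> C * vnorm H v"
  obtains y where "y \<in> vecs H" "\<And>v. v \<in> vecs H \<Longrightarrow> f v = vinner H v y"
proof (cases "\<forall>v\<in>vecs H. f v = 0")
  case True
  obtain v where v: "v \<in> vecs H" using nonempty by blast
  show ?thesis by (rule that[of "vscale H 0 v"]) (use v True in auto)
next
  case False
  then obtain v where v: "v \<in> vecs H" "f v \<noteq> 0" by blast
  have diff: "f (vdiff H u w) = f u - f w" if "u \<in> vecs H" "w \<in> vecs H" for u w
    using that by (simp add: vdiff_def add scale)
  define Y where "Y = {v \<in> vecs H. f v = 0}"
  have Y: "closed_subspace Y"
    unfolding closed_subspace_def
  proof (intro conjI allI ballI impI)
    show "Y \<noteq> {}" using v scale[of v 0] by (auto simp: Y_def intro!: exI[of _ "vscale H 0 v"])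
  next
    fix s u assume u: "u \<in> vecs H" and *: "(\<forall>n. s n \<in> Y) \<and> (\<lambda>n. vnorm H (vdiff H (s n) u)) \<longlonglongrightarrow> 0"
    have "cmod (f u) \<le> C * vnorm H (vdiff H (s n) u)" for n
      using bound[of "vdiff H (s n) u"] diff[of "s n" u] u * by (auto simp: Y_def)
    moreover have "(\<lambda>n. C * vnorm H (vdiff H (s n) u)) \<longlonglongrightarrow> C * 0"
      using * by (intro tendsto_mult tendsto_const) auto
    ultimately have "cmod (f u) \<le> C * 0"
      by (intro LIMSEQ_le_const) auto
    then show "u \<in> Y" using u by (simp add: Y_def)
  qed (auto simp: Y_def add scale)
  obtain y where y: "y \<in> Y" and orth: "\<And>z. z \<in> Y \<Longrightarrow> vinner H (vdiff H v y) z = 0"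
    using orthogonal_projection[OF Y v(1)] by blast
  define z where "z = vdiff H v y"
  have zV: "z \<in> vecs H" and fz: "f z \<noteq> 0" using v y by (auto simp: z_def Y_def diff)
  have zz: "vinner H z z \<noteq> 0"
    using bound[OF zV] fz inner_self[OF zV] by auto
  have "f u = vinner H u (vscale H (cnj (f z / vinner H z z)) z)" if u: "u \<in> vecs H" for u
  proof -
    have "vdiff H (vscale H (f z) u) (vscale H (f u) z) \<in> Y"
      using u zV by (simp add: Y_def diff scale)
    then have "vinner H z (vdiff H (vscale H (f z) u) (vscale H (f u) z)) = 0"
      using orth z_def by simp
    then have "cnj (f z) * vinner H z u = cnj (f u) * vinner H z z" using u zV by simp
    then have "f z * vinner H u z = f u * vinner H z z"
      using arg_cong[of _ _ cnj] inner_commute[OF u zV] inner_commute[OF zV zV]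
      by (metis complex_cnj_cnj complex_cnj_mult)
    then show ?thesis using u zV zz by (simp add: field_simps)
  qed
  then show ?thesis using that[of "vscale H (cnj (f z / vinner H z z)) z"] zV by blast
qed

subsection \<open>Bounded operators and adjoints\<close>

definition adjoint_pair :: "('v \<Rightarrow> 'v) \<Rightarrow> ('v \<Rightarrow> 'v) \<Rightarrow> bool" where
  "adjoint_pair A B \<longleftrightarrow> (\<forall>v\<in>vecs H. \<forall>w\<in>vecs H. vinner H (A v) w = vinner H v (B w))"

lemma adjoint_pairD:
  "adjoint_pair A B \<Longrightarrow> v \<in> vecs H \<Longrightarrow> w \<in> vecs H \<Longrightarrow> vinner H (A v) w = vinner H v (B w)"
  by (simp add: adjoint_pair_def)

lemma bounded_closed [simp]: "A \<in> bounded_ops H \<Longrightarrow> v \<in> vecs H \<Longrightarrow> A v \<in> vecs H"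
  by (auto simp: bounded_ops_def)

lemma bounded_ext: "A \<in> bounded_ops H \<Longrightarrow> B \<in> bounded_ops H \<Longrightarrow>
    (\<And>v. v \<in> vecs H \<Longrightarrow> A v = B v) \<Longrightarrow> A = B"
  unfolding bounded_ops_def by (auto intro: PiE_ext)

lemma bounded_add: "A \<in> bounded_ops H \<Longrightarrow> v \<in> vecs H \<Longrightarrow> w \<in> vecs H \<Longrightarrow>
    A (vadd H v w) = vadd H (A v) (A w)"
  by (simp add: bounded_ops_def)

lemma bounded_scale: "A \<in> bounded_ops H \<Longrightarrow> v \<in> vecs H \<Longrightarrow> A (vscale H c v) = vscale H c (A v)"
  by (simp add: bounded_ops_def)

lemma bounded_bound:
  assumes "A \<in> bounded_ops H"
  obtains C where "C \<ge> 0" "\<And>v. v \<in> vecs H \<Longrightarrow> vnorm H (A v) \<le> C * vnorm H v"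
proof -
  obtain C where C: "\<And>v. v \<in> vecs H \<Longrightarrow> vnorm H (A v) \<le> C * vnorm H v"
    using assms unfolding bounded_ops_def by blast
  have "vnorm H (A v) \<le> \<bar>C\<bar> * vnorm H v" if "v \<in> vecs H" for v
    using C[OF that] that by (smt (verit) mult_right_mono norm_nonneg)
  then show ?thesis using that[of "\<bar>C\<bar>"] by simp
qed

text \<open>A map that has an adjoint is automatically linear.\<close>

lemma bounded_opsI:
  assumes A: "A \<in> extensional (vecs H)" "\<And>v. v \<in> vecs H \<Longrightarrow> A v \<in> vecs H"
    and B: "\<And>v. v \<in> vecs H \<Longrightarrow> B v \<in> vecs H" and AB: "adjoint_pair A B"
    and C: "\<And>v. v \<in> vecs H \<Longrightarrow> vnorm H (A v) \<le> C * vnorm H v"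
  shows "A \<in> bounded_ops H"
  unfolding bounded_ops_def
proof (intro CollectI conjI ballI allI exI[of _ C])
  fix c v w assume vw: "v \<in> vecs H" "w \<in> vecs H"
  show "A (vadd H v w) = vadd H (A v) (A w)"
    using vw A B by (intro inner_ext) (auto simp: adjoint_pairD[OF AB])
next
  fix c v assume v: "v \<in> vecs H"
  show "A (vscale H c v) = vscale H c (A v)"
    using v A B by (intro inner_ext) (auto simp: adjoint_pairD[OF AB])
qed (use A C in \<open>auto simp: PiE_def\<close>)

text \<open>The adjoint at \<open>w\<close> represents the functional \<open>v \<mapsto> \<langle>A v, w\<rangle>\<close>.\<close>

lemma adjoint_exists:
  assumes A: "A \<in> bounded_ops H"
  obtains B where "B \<in> bounded_ops H" "adjoint_pair A B"
proof -
  obtain C where C0: "C \<ge> 0" and C: "\<And>v. v \<in> vecs H \<Longrightarrow> vnorm H (A v) \<le> C * vnorm H v"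
    using bounded_bound[OF A] by blast
  have "\<exists>y\<in>vecs H. \<forall>v\<in>vecs H. vinner H (A v) w = vinner H v y" if w: "w \<in> vecs H" for w
  proof (rule riesz_representation[where f = "\<lambda>v. vinner H (A v) w" and C = "C * vnorm H w"])
    fix v assume v: "v \<in> vecs H"
    have "cmod (vinner H (A v) w) \<le> vnorm H (A v) * vnorm H w"
      using A v w by (simp add: cauchy_schwarz)
    also have "\<dots> \<le> (C * vnorm H v) * vnorm H w" using C[OF v] w by (intro mult_right_mono) auto
    finally show "cmod (vinner H (A v) w) \<le> C * vnorm H w * vnorm H v" by (simp add: mult_ac)
  qed (use A w in \<open>auto simp: bounded_add bounded_scale\<close>)
  then obtain f where f: "\<And>w. w \<in> vecs H \<Longrightarrow> f w \<in> vecs H"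
    "\<And>v w. w \<in> vecs H \<Longrightarrow> v \<in> vecs H \<Longrightarrow> vinner H (A v) w = vinner H v (f w)" by metis
  define B where "B = (\<lambda>w\<in>vecs H. f w)"
  have AB: "adjoint_pair A B" using f by (simp add: adjoint_pair_def B_def)
  have BV: "\<And>w. w \<in> vecs H \<Longrightarrow> B w \<in> vecs H" using f by (simp add: B_def)
  have BA: "adjoint_pair B A"
    unfolding adjoint_pair_def
  proof (intro ballI)
    fix v w assume "v \<in> vecs H" "w \<in> vecs H"
    then show "vinner H (B v) w = vinner H v (A w)"
      using adjoint_pairD[OF AB, of w v] inner_commute[of "B v" w] inner_commute[of v "A w"] BV A
        by auto
  qed
  have "B \<in> bounded_ops H"
  proof (rule bounded_opsI[OF _ BV _ BA])
    fix w assume w: "w \<in> vecs H"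
    have "(vnorm H (B w))\<^sup>2 = Re (vinner H (A (B w)) w)"
      using w BV by (simp add: norm_sq adjoint_pairD[OF AB])
    also have "\<dots> \<le> vnorm H (A (B w)) * vnorm H w"
      using cauchy_schwarz[of "A (B w)" w] complex_Re_le_cmod[of "vinner H (A (B w)) w"] w BV A
      by (auto intro: order_trans)
    also have "\<dots> \<le> C * vnorm H (B w) * vnorm H w" using C[OF BV[OF w]] w
      by (intro mult_right_mono) auto
    finally have "vnorm H (B w) * vnorm H (B w) \<le> vnorm H (B w) * (C * vnorm H w)"
      by (simp add: power2_eq_square mult_ac)
    then have "vnorm H (B w) = 0 \<or> vnorm H (B w) \<le> C * vnorm H w"
      using norm_nonneg[OF BV[OF w]] by (metis mult_left_le_imp_le less_eq_real_def)
    then show "vnorm H (B w) \<le> C * vnorm H w"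
      using mult_nonneg_nonneg[OF C0 norm_nonneg[OF w]] by argo
  qed (use A in \<open>auto simp: B_def\<close>)
  with AB show ?thesis using that by blast
qed

lemma op_adjoint_eq:
  assumes B: "B \<in> bounded_ops H" and AB: "adjoint_pair A B"
  shows "op_adjoint H A = B"
  unfolding op_adjoint_def
proof (rule the_equality)
  show "B \<in> bounded_ops H \<and> (\<forall>v\<in>vecs H. \<forall>w\<in>vecs H. vinner H (A v) w = vinner H v (B w))"
    using assms by (simp add: adjoint_pair_def)
next
  fix B' assume *: "B' \<in> bounded_ops H \<and> (\<forall>v\<in>vecs H. \<forall>w\<in>vecs H. vinner H (A v) w = vinner H v (B' w))"
  show "B' = B"
    using * B AB by (intro bounded_ext inner_ext_right) (auto simp: adjoint_pair_def)
qed

lemma op_adjoint: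
  assumes "A \<in> bounded_ops H"
  shows op_adjoint_bounded: "op_adjoint H A \<in> bounded_ops H"
    and op_adjoint_pair: "adjoint_pair A (op_adjoint H A)"
  using adjoint_exists[OF assms] op_adjoint_eq by metis+

lemma adjoint_pair_sym:
  assumes "adjoint_pair A B" "\<And>v. v \<in> vecs H \<Longrightarrow> A v \<in> vecs H" "\<And>v. v \<in> vecs H \<Longrightarrow> B v \<in> vecs H"
  shows "adjoint_pair B A"
  unfolding adjoint_pair_def
proof (intro ballI)
  fix v w assume "v \<in> vecs H" "w \<in> vecs H"
  then show "vinner H (B v) w = vinner H v (A w)"
    using assms adjoint_pairD[OF assms(1), of w v] inner_commute[of "B v" w] inner_commute[of v "A w"]
    by auto
qed

lemma op_mult_apply: "v \<in> vecs H \<Longrightarrow> op_mult H A B v = A (B v)"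
  by (simp add: op_mult_def compose_def)

lemma op_mult_eq_iff:
  "op_mult H A B = op_mult H C D \<longleftrightarrow> (\<forall>v\<in>vecs H. A (B v) = C (D v))"
  unfolding op_mult_def compose_def by (auto simp: fun_eq_iff restrict_def)

lemma op_mult_bounded:
  assumes A: "A \<in> bounded_ops H" and B: "B \<in> bounded_ops H"
  shows "op_mult H A B \<in> bounded_ops H"
proof -
  obtain C D where C: "C \<ge> 0" "\<And>v. v \<in> vecs H \<Longrightarrow> vnorm H (A v) \<le> C * vnorm H v"
    and D: "\<And>v. v \<in> vecs H \<Longrightarrow> vnorm H (B v) \<le> D * vnorm H v"
    using bounded_bound[OF A] bounded_bound[OF B] by metis
  show ?thesis
  proof (rule bounded_opsI)
    show "adjoint_pair (op_mult H A B) (\<lambda>v. op_adjoint H B (op_adjoint H A v))"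
      using A B op_adjoint_pair[OF A] op_adjoint_pair[OF B] op_adjoint_bounded[OF A]
        op_adjoint_bounded[OF B]
      by (auto simp: adjoint_pair_def op_mult_apply)
    fix v assume v: "v \<in> vecs H"
    show "op_adjoint H B (op_adjoint H A v) \<in> vecs H"
      using v A B by (auto intro: bounded_closed op_adjoint_bounded)
    have "vnorm H (A (B v)) \<le> C * vnorm H (B v)" using v B C by simp
    also have "\<dots> \<le> C * (D * vnorm H v)" using C D[OF v] by (intro mult_left_mono)
    finally show "vnorm H (op_mult H A B v) \<le> C * D * vnorm H v" using v
      by (simp add: op_mult_apply mult.assoc)
  qed (use A B in \<open>auto simp: op_mult_apply, auto simp: op_mult_def\<close>)
qed

lemma commutant_iff: "A \<in> commutant H S \<longleftrightarrow>
    A \<in> bounded_ops H \<and> (\<forall>B\<in>S. \<forall>v\<in>vecs H. A (B v) = B (A v))"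
  by (simp add: commutant_def op_mult_eq_iff)

text \<open>Take adjoints on both sides of \<open>R' A = A R'\<close>.\<close>

lemma commutes_op_adjoint:
  assumes A: "A \<in> bounded_ops H" and R: "\<And>v. v \<in> vecs H \<Longrightarrow> R v \<in> vecs H"
    and R': "\<And>v. v \<in> vecs H \<Longrightarrow> R' v \<in> vecs H" and RR': "adjoint_pair R R'"
    and comm: "\<And>v. v \<in> vecs H \<Longrightarrow> R' (A v) = A (R' v)" and v: "v \<in> vecs H"
  shows "R (op_adjoint H A v) = op_adjoint H A (R v)"
proof (rule inner_ext_right)
  note A' = op_adjoint_bounded[OF A] and AA' = op_adjoint_pair[OF A]
  have R'R: "adjoint_pair R' R" using adjoint_pair_sym[OF RR' R R'] .
  fix w assume w: "w \<in> vecs H"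
  have "vinner H w (R (op_adjoint H A v)) = vinner H (A (R' w)) v"
    using w v A A' R R' adjoint_pairD[OF AA', of "R' w" v] adjoint_pairD[OF R'R, of w "op_adjoint H A v"] by simp
  also have "\<dots> = vinner H w (op_adjoint H A (R v))"
    using w v A A' R R' adjoint_pairD[OF AA', of w "R v"] adjoint_pairD[OF R'R, of "A w" v]
    by (simp flip: comm)
  finally show "vinner H w (R (op_adjoint H A v)) = vinner H w (op_adjoint H A (R v))" .
qed (use v R op_adjoint_bounded[OF A] in auto)

end

section \<open>The Hilbert space of square summable families\<close>

definition l2_single :: "'k set \<Rightarrow> 'v hilb \<Rightarrow> 'k \<Rightarrow> 'v \<Rightarrow> 'k \<Rightarrow> 'v" where
  "l2_single I H k v = (\<lambda>j\<in>I. if j = k then v else vscale H 0 v)"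

context hilb_space
begin

lemma norm_add_sq_le:
  assumes "v \<in> vecs H" "w \<in> vecs H"
  shows "(vnorm H (vadd H v w))\<^sup>2 \<le> 2 * (vnorm H v)\<^sup>2 + 2 * (vnorm H w)\<^sup>2"
proof -
  have "(vnorm H (vadd H v w))\<^sup>2 \<le> (vnorm H v + vnorm H w)\<^sup>2"
    using assms by (intro power_mono norm_triangle) auto
  also have "\<dots> \<le> 2 * (vnorm H v)\<^sup>2 + 2 * (vnorm H w)\<^sup>2"
    using sum_squares_bound[of "vnorm H v" "vnorm H w"] by (simp add: power2_sum)
  finally show ?thesis .
qed

lemma l2_mem_iff: "\<xi> \<in> vecs (l2 I H) \<longleftrightarrow>
    \<xi> \<in> I \<rightarrow>\<^sub>E vecs H \<and> (\<lambda>k. (vnorm H (\<xi> k))\<^sup>2) summable_on I"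
  by (simp add: l2_def)

lemma l2_closed [simp]: "\<xi> \<in> vecs (l2 I H) \<Longrightarrow> k \<in> I \<Longrightarrow> \<xi> k \<in> vecs H"
  by (auto simp: l2_mem_iff)

lemma l2_vinner: "vinner (l2 I H) \<xi> \<eta> = (\<Sum>\<^sub>\<infinity>k\<in>I. vinner H (\<xi> k) (\<eta> k))"
  by (simp add: l2_def)

lemma l2_vadd: "vadd (l2 I H) \<xi> \<eta> = (\<lambda>k\<in>I. vadd H (\<xi> k) (\<eta> k))"
  by (simp add: l2_def)

lemma l2_vscale: "vscale (l2 I H) c \<xi> = (\<lambda>k\<in>I. vscale H c (\<xi> k))"
  by (simp add: l2_def)

lemma l2_memI:
  assumes "\<And>k. k \<in> I \<Longrightarrow> \<xi> k \<in> vecs H" "\<xi> \<in> extensional I"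
    and "g summable_on I" "\<And>k. k \<in> I \<Longrightarrow> (vnorm H (\<xi> k))\<^sup>2 \<le> g k"
  shows "\<xi> \<in> vecs (l2 I H)"
  using assms by (auto simp: l2_mem_iff PiE_def intro: summable_on_comparison_test[of g])

lemma l2_inner_abs_summable:
  assumes "\<xi> \<in> vecs (l2 I H)" "\<eta> \<in> vecs (l2 I H)"
  shows "(\<lambda>k. norm (vinner H (\<xi> k) (\<eta> k))) summable_on I"
proof -
  have "(\<lambda>k. (vnorm H (\<xi> k))\<^sup>2 + (vnorm H (\<eta> k))\<^sup>2) summable_on I"
    using assms by (intro summable_on_add) (auto simp: l2_mem_iff)
  then show ?thesis
    by (rule summable_on_comparison_test) (use assms inner_bound in auto)
qed

lemma l2_inner_summable:
  "\<xi> \<in> vecs (l2 I H) \<Longrightarrow> \<eta> \<in> vecs (l2 I H) \<Longrightarrow> (\<lambda>k. vinner H (\<xi> k) (\<eta> k)) summable_on I"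
  by (rule Infinite_Sum.abs_summable_summable[OF l2_inner_abs_summable])

lemma l2_inner_self:
  assumes "\<xi> \<in> vecs (l2 I H)"
  shows "Re (vinner (l2 I H) \<xi> \<xi>) = (\<Sum>\<^sub>\<infinity>k\<in>I. (vnorm H (\<xi> k))\<^sup>2)"
proof -
  have "Re (vinner (l2 I H) \<xi> \<xi>) = (\<Sum>\<^sub>\<infinity>k\<in>I. Re (vinner H (\<xi> k) (\<xi> k)))"
    unfolding l2_vinner using l2_inner_summable[OF assms assms] by (simp add: infsum_Re)
  also have "\<dots> = (\<Sum>\<^sub>\<infinity>k\<in>I. (vnorm H (\<xi> k))\<^sup>2)"
    using assms by (intro infsum_cong) (simp add: norm_sq)
  finally show ?thesis .
qed

lemma l2_norm_sq:
  assumes "\<xi> \<in> vecs (l2 I H)"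
  shows "(vnorm (l2 I H) \<xi>)\<^sup>2 = (\<Sum>\<^sub>\<infinity>k\<in>I. (vnorm H (\<xi> k))\<^sup>2)"
  unfolding vnorm_def[of "l2 I H"] l2_inner_self[OF assms] by (simp add: infsum_nonneg)

lemma l2_component_norm_le:
  assumes \<xi>: "\<xi> \<in> vecs (l2 I H)" and k: "k \<in> I"
  shows "vnorm H (\<xi> k) \<le> vnorm (l2 I H) \<xi>"
proof (rule power2_le_imp_le)
  have "sum (\<lambda>k. (vnorm H (\<xi> k))\<^sup>2) {k} \<le> (\<Sum>\<^sub>\<infinity>k\<in>I. (vnorm H (\<xi> k))\<^sup>2)"
    using assms by (intro finite_sum_le_infsum) (auto simp: l2_mem_iff)
  then show "(vnorm H (\<xi> k))\<^sup>2 \<le> (vnorm (l2 I H) \<xi>)\<^sup>2" by (simp add: l2_norm_sq[OF \<xi>])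
  show "0 \<le> vnorm (l2 I H) \<xi>" using \<xi> by (simp add: vnorm_def l2_inner_self infsum_nonneg)
qed

lemma norm_zero_vec: "v \<in> vecs H \<Longrightarrow> vnorm H (vscale H 0 v) = 0"
  by (simp add: vnorm_def)

lemma l2_single_mem [simp]: "v \<in> vecs H \<Longrightarrow> l2_single I H k v \<in> vecs (l2 I H)"
  unfolding l2_mem_iff
  by (auto simp: l2_single_def norm_zero_vec intro!: finite_nonzero_values_imp_summable_on 
      intro: finite_subset[of _ "{k}"] split: if_splits)

lemma l2_single_same [simp]: "k \<in> I \<Longrightarrow> l2_single I H k v k = v"
  by (simp add: l2_single_def)

lemma l2_inner_single_left [simp]:
  assumes "\<xi> \<in> vecs (l2 I H)" "v \<in> vecs H" "k \<in> I"
  shows "vinner (l2 I H) (l2_single I H k v) \<xi> = vinner H v (\<xi> k)"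
proof -
  have "(\<Sum>\<^sub>\<infinity>j\<in>I. vinner H (l2_single I H k v j) (\<xi> j)) = (\<Sum>\<^sub>\<infinity>j\<in>{k}. vinner H (l2_single I H k v j) (\<xi> j))"
    using assms by (intro infsum_cong_neutral) (auto simp: l2_single_def)
  then show ?thesis using assms by (simp add: l2_vinner)
qed

lemma l2_inner_single_right [simp]:
  assumes "\<xi> \<in> vecs (l2 I H)" "v \<in> vecs H" "k \<in> I"
  shows "vinner (l2 I H) \<xi> (l2_single I H k v) = vinner H (\<xi> k) v"
proof -
  have "(\<Sum>\<^sub>\<infinity>j\<in>I. vinner H (\<xi> j) (l2_single I H k v j)) = (\<Sum>\<^sub>\<infinity>j\<in>{k}. vinner H (\<xi> j) (l2_single I H k v j))"
    using assms by (intro infsum_cong_neutral) (auto simp: l2_single_def)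
  then show ?thesis using assms by (simp add: l2_vinner)
qed

lemma l2_add_closed:
  assumes "\<xi> \<in> vecs (l2 I H)" "\<eta> \<in> vecs (l2 I H)"
  shows "vadd (l2 I H) \<xi> \<eta> \<in> vecs (l2 I H)"
proof (rule l2_memI[where g = "\<lambda>k. 2 * (vnorm H (\<xi> k))\<^sup>2 + 2 * (vnorm H (\<eta> k))\<^sup>2"])
  show "(\<lambda>k. 2 * (vnorm H (\<xi> k))\<^sup>2 + 2 * (vnorm H (\<eta> k))\<^sup>2) summable_on I"
    using assms by (intro summable_on_add summable_on_cmult_right) (auto simp: l2_mem_iff)
qed (use assms norm_add_sq_le in \<open>auto simp: l2_vadd\<close>)

lemma l2_scale_closed:
  assumes "\<xi> \<in> vecs (l2 I H)"
  shows "vscale (l2 I H) c \<xi> \<in> vecs (l2 I H)"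
proof (rule l2_memI[where g = "\<lambda>k. (cmod c)\<^sup>2 * (vnorm H (\<xi> k))\<^sup>2"])
  show "(\<lambda>k. (cmod c)\<^sup>2 * (vnorm H (\<xi> k))\<^sup>2) summable_on I"
    using assms by (intro summable_on_cmult_right) (auto simp: l2_mem_iff)
qed (use assms in \<open>auto simp: l2_vscale norm_scale power_mult_distrib\<close>)

lemma l2_vdiff: "k \<in> I \<Longrightarrow> vdiff (l2 I H) \<xi> \<eta> k = vdiff H (\<xi> k) (\<eta> k)"
  by (simp add: vdiff_def l2_vadd l2_vscale)

lemma l2_diff_closed:
  "\<xi> \<in> vecs (l2 I H) \<Longrightarrow> \<eta> \<in> vecs (l2 I H) \<Longrightarrow> vdiff (l2 I H) \<xi> \<eta> \<in> vecs (l2 I H)"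
  by (simp add: vdiff_def l2_add_closed l2_scale_closed)

text \<open>A Cauchy sequence of families converges in each component, and the tail estimate passes to
  the limit on every finite set of indices, hence on the whole index set.\<close>

lemma l2_complete:
  assumes s: "\<And>n. s n \<in> vecs (l2 I H)"
    and cauchy: "\<And>e. e > 0 \<Longrightarrow> \<exists>N. \<forall>m\<ge>N. \<forall>n\<ge>N. vnorm (l2 I H) (vdiff (l2 I H) (s m) (s n)) \<le> e"
  shows "\<exists>v\<in>vecs (l2 I H). (\<lambda>n. vnorm (l2 I H) (vdiff (l2 I H) (s n) v)) \<longlonglongrightarrow> 0"
proof -
  let ?L = "l2 I H"
  have sV: "\<And>n k. k \<in> I \<Longrightarrow> s n k \<in> vecs H" by (rule l2_closed[OF s])
  have comp: "vnorm H (vdiff H (s m k) (s n k)) \<le> vnorm ?L (vdiff ?L (s m) (s n))"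
    if "k \<in> I" for m n k
    using l2_component_norm_le[OF l2_diff_closed[OF s s] that] by (simp add: l2_vdiff that)
  have "\<exists>v\<in>vecs H. (\<lambda>n. vnorm H (vdiff H (s n k) v)) \<longlonglongrightarrow> 0" if k: "k \<in> I" for k
  proof (rule complete)
    show "s n k \<in> vecs H" for n using l2_closed[OF s k] .
    show "\<exists>N. \<forall>m\<ge>N. \<forall>n\<ge>N. vnorm H (vdiff H (s m k) (s n k)) \<le> e" if "e > 0" for e
      using cauchy[OF that] comp[OF k] by (meson order_trans)
  qed
  then obtain t0 where t0: "\<And>k. k \<in> I \<Longrightarrow> t0 k \<in> vecs H"
    "\<And>k. k \<in> I \<Longrightarrow> (\<lambda>n. vnorm H (vdiff H (s n k) (t0 k))) \<longlonglongrightarrow> 0" by metis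
  define t where "t = (\<lambda>k\<in>I. t0 k)"
  have tV: "\<And>k. k \<in> I \<Longrightarrow> t k \<in> vecs H" and t: "\<And>k. k \<in> I \<Longrightarrow> (\<lambda>n. vnorm H (vdiff H (s n k) (t k))) \<longlonglongrightarrow> 0"
    using t0 by (auto simp: t_def)
  have fin: "(\<Sum>k\<in>F. (vnorm H (vdiff H (s n k) (t k)))\<^sup>2) \<le> 2 * e\<^sup>2"
    if F: "finite F" "F \<subseteq> I" and N: "\<And>m. m \<ge> N \<Longrightarrow> vnorm ?L (vdiff ?L (s n) (s m)) \<le> e" for F n N e
  proof -
    \<comment> \<open>The comparison goes through \<open>s m\<close>, at the cost of a harmless factor 2.\<close>
    let ?a = "\<lambda>m k. vnorm H (vdiff H (s n k) (s m k))"
      and ?b = "\<lambda>m k. vnorm H (vdiff H (s m k) (t k))"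
    have le: "(\<Sum>k\<in>F. (vnorm H (vdiff H (s n k) (t k)))\<^sup>2) \<le> 2 * e\<^sup>2 + 2 * (\<Sum>k\<in>F. (?b m k)\<^sup>2)"
      if m: "m \<ge> N" for m
    proof -
      have "(\<Sum>k\<in>F. (vnorm H (vdiff H (s n k) (t k)))\<^sup>2) \<le> (\<Sum>k\<in>F. 2 * (?a m k)\<^sup>2 + 2 * (?b m k)\<^sup>2)"
      proof (rule sum_mono)
        fix k assume "k \<in> F"
        then have k: "s n k \<in> vecs H" "s m k \<in> vecs H" "t k \<in> vecs H" using F sV tV by blast+
        have "vdiff H (s n k) (t k) = vadd H (vdiff H (s n k) (s m k)) (vdiff H (s m k) (t k))"
          using k by (intro inner_ext) auto
        then show "(vnorm H (vdiff H (s n k) (t k)))\<^sup>2 \<le> 2 * (?a m k)\<^sup>2 + 2 * (?b m k)\<^sup>2"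
          using k norm_add_sq_le[of "vdiff H (s n k) (s m k)" "vdiff H (s m k) (t k)"] by simp
      qed
      also have "\<dots> = 2 * (\<Sum>k\<in>F. (?a m k)\<^sup>2) + 2 * (\<Sum>k\<in>F. (?b m k)\<^sup>2)"
        by (simp add: sum.distrib sum_distrib_left)
      also have "(\<Sum>k\<in>F. (?a m k)\<^sup>2) \<le> e\<^sup>2"
      proof -
        note d = l2_diff_closed[OF s s, of n m]
        have "(\<Sum>k\<in>F. (?a m k)\<^sup>2) = (\<Sum>k\<in>F. (vnorm H (vdiff ?L (s n) (s m) k))\<^sup>2)"
          using F by (intro sum.cong) (auto simp: l2_vdiff)
        also have "\<dots> \<le> (vnorm ?L (vdiff ?L (s n) (s m)))\<^sup>2"
          unfolding l2_norm_sq[OF d] using d F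
            by (intro finite_sum_le_infsum) (auto simp: l2_mem_iff)
        also have "\<dots> \<le> e\<^sup>2"
          using N[OF m] d by (intro power_mono) (auto simp: vnorm_def l2_inner_self infsum_nonneg)
        finally show ?thesis .
      qed
      finally show ?thesis by simp
    qed
    have "(\<lambda>m. 2 * e\<^sup>2 + 2 * (\<Sum>k\<in>F. (?b m k)\<^sup>2)) \<longlonglongrightarrow> 2 * e\<^sup>2 + 2 * (\<Sum>k\<in>F. 0\<^sup>2)"
      using F t by (intro tendsto_intros) auto
    then show ?thesis using le by (intro LIMSEQ_le_const[of "\<lambda>m. 2 * e\<^sup>2 + 2 * (\<Sum>k\<in>F. (?b m k)\<^sup>2)"]) auto
  qed
  have diff_mem: "vdiff ?L (s n) t \<in> vecs ?L"
    and diff_norm: "(vnorm ?L (vdiff ?L (s n) t))\<^sup>2 \<le> 2 * e\<^sup>2"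
    if N: "\<And>m. m \<ge> N \<Longrightarrow> vnorm ?L (vdiff ?L (s n) (s m)) \<le> e" for n N e
  proof -
    have *: "sum (\<lambda>k. (vnorm H (vdiff ?L (s n) t k))\<^sup>2) F \<le> 2 * e\<^sup>2" if "finite F" "F \<subseteq> I" for F
      using fin[OF that N] that by (simp add: l2_vdiff subset_iff cong: sum.cong)
    have sum: "(\<lambda>k. (vnorm H (vdiff ?L (s n) t k))\<^sup>2) summable_on I"
      using * by (intro nonneg_bdd_above_summable_on) (auto intro!: bdd_aboveI2)
    show mem: "vdiff ?L (s n) t \<in> vecs ?L"
      by (rule l2_memI[OF _ _ sum]) (use sV tV in \<open>simp_all add: l2_vdiff, simp add: vdiff_def l2_vadd\<close>)
    show "(vnorm ?L (vdiff ?L (s n) t))\<^sup>2 \<le> 2 * e\<^sup>2"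
      unfolding l2_norm_sq[OF mem] using sum * by (intro infsum_le_finite_sums)
  qed
  obtain N1 where N1: "\<And>m n. m \<ge> N1 \<Longrightarrow> n \<ge> N1 \<Longrightarrow> vnorm ?L (vdiff ?L (s m) (s n)) \<le> 1"
    using cauchy[of 1] by auto
  have t_eq: "t = vdiff ?L (s N1) (vdiff ?L (s N1) t)"
  proof (rule extensionalityI[of _ I])
    fix k assume "k \<in> I"
    then show "t k = vdiff ?L (s N1) (vdiff ?L (s N1) t) k"
      using sV tV by (simp only: l2_vdiff) (intro inner_ext, simp_all)
  qed (auto simp: t_def vdiff_def l2_vadd)
  have "vdiff ?L (s N1) (vdiff ?L (s N1) t) \<in> vecs ?L"
    by (rule l2_diff_closed[OF s diff_mem[of N1 N1 1]]) (use N1 in simp)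
  then have tL: "t \<in> vecs ?L" by (fold t_eq)
  have "(\<lambda>n. vnorm ?L (vdiff ?L (s n) t)) \<longlonglongrightarrow> 0"
  proof (rule LIMSEQ_I)
    fix r :: real assume r: "r > 0"
    obtain N where N: "\<And>m n. m \<ge> N \<Longrightarrow> n \<ge> N \<Longrightarrow> vnorm ?L (vdiff ?L (s m) (s n)) \<le> r / 2"
      using cauchy[of "r/2"] r by auto
    have "norm (vnorm ?L (vdiff ?L (s n) t) - 0) < r" if n: "n \<ge> N" for n
    proof -
      have "(vnorm ?L (vdiff ?L (s n) t))\<^sup>2 \<le> 2 * (r/2)\<^sup>2" by (rule diff_norm[OF N[OF n]])
      also have "\<dots> < r\<^sup>2" using r by (simp add: power_divide)
      finally have "vnorm ?L (vdiff ?L (s n) t) < r" using r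
        by (meson less_imp_le power_less_imp_less_base)
      moreover have "0 \<le> vnorm ?L (vdiff ?L (s n) t)"
        using l2_diff_closed[OF s tL] by (simp add: vnorm_def l2_inner_self infsum_nonneg)
      ultimately show ?thesis by simp
    qed
    then show "\<exists>N. \<forall>n\<ge>N. norm (vnorm ?L (vdiff ?L (s n) t) - 0) < r" by blast
  qed
  with tL show ?thesis by blast
qed

lemma l2_hilb_space: "hilb_space (l2 I H)"
proof
  obtain v where v: "v \<in> vecs H" using nonempty by blast
  show "vecs (l2 I H) \<noteq> {}" by (metis empty_iff l2_single_mem v)
next
  fix u v w assume uvw: "u \<in> vecs (l2 I H)" "v \<in> vecs (l2 I H)" "w \<in> vecs (l2 I H)"
  have "vinner (l2 I H) (vadd (l2 I H) u v) w = (\<Sum>\<^sub>\<infinity>k\<in>I. vinner H (u k) (w k) + vinner H (v k) (w k))"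
    unfolding l2_vinner using uvw by (intro infsum_cong) (simp add: l2_vadd)
  also have "\<dots> = vinner (l2 I H) u w + vinner (l2 I H) v w"
    unfolding l2_vinner using uvw by (intro infsum_add l2_inner_summable)
  finally show "vinner (l2 I H) (vadd (l2 I H) u v) w = vinner (l2 I H) u w + vinner (l2 I H) v w" .
next
  fix c v w assume vw: "v \<in> vecs (l2 I H)" "w \<in> vecs (l2 I H)"
  have "vinner (l2 I H) (vscale (l2 I H) c v) w = (\<Sum>\<^sub>\<infinity>k\<in>I. c * vinner H (v k) (w k))"
    unfolding l2_vinner using vw by (intro infsum_cong) (simp add: l2_vscale)
  then show "vinner (l2 I H) (vscale (l2 I H) c v) w = c * vinner (l2 I H) v w"
    by (simp add: l2_vinner infsum_cmult_right')
next
  fix v w assume vw: "v \<in> vecs (l2 I H)" "w \<in> vecs (l2 I H)"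
  have "vinner (l2 I H) w v = (\<Sum>\<^sub>\<infinity>k\<in>I. cnj (vinner H (v k) (w k)))"
    unfolding l2_vinner using vw by (intro infsum_cong inner_commute) auto
  then show "vinner (l2 I H) w v = cnj (vinner (l2 I H) v w)" by (simp add: l2_vinner)
next
  fix u v assume u: "u \<in> vecs (l2 I H)" and v: "v \<in> vecs (l2 I H)"
    and eq: "\<And>w. w \<in> vecs (l2 I H) \<Longrightarrow> vinner (l2 I H) u w = vinner (l2 I H) v w"
  show "u = v"
  proof (rule extensionalityI[of _ I])
    fix k assume k: "k \<in> I"
    show "u k = v k"
    proof (rule inner_ext)
      fix w assume w: "w \<in> vecs H"
      show "vinner H (u k) w = vinner H (v k) w"
        using eq[OF l2_single_mem[OF w, of I k]] u v w k by simp
    qed (use u v k in auto)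
  qed (use u v in \<open>auto simp: l2_mem_iff PiE_def\<close>)
qed (simp_all add: l2_add_closed l2_scale_closed l2_complete l2_inner_self infsum_nonneg)

lemma l2_single_ext:
  assumes "\<And>k v. k \<in> I \<Longrightarrow> v \<in> vecs H \<Longrightarrow> 
     vinner (l2 I H) \<xi> (l2_single I H k v) = vinner (l2 I H) \<eta> (l2_single I H k v)"
    and "\<xi> \<in> vecs (l2 I H)" "\<eta> \<in> vecs (l2 I H)"
  shows "\<xi> = \<eta>"
proof (rule extensionalityI[of _ I])
  fix k assume k: "k \<in> I"
  show "\<xi> k = \<eta> k"
    using assms(1)[OF k] assms(2,3) k by (intro inner_ext) auto
qed (use assms in \<open>auto simp: l2_mem_iff PiE_def\<close>)

section \<open>Normal functionals are determined on a weakly dense algebra\<close>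

definition amplify :: "'k set \<Rightarrow> ('v \<Rightarrow> 'v) \<Rightarrow> ('k \<Rightarrow> 'v) \<Rightarrow> 'k \<Rightarrow> 'v" where
  "amplify I A \<xi> = (\<lambda>k\<in>I. A (\<xi> k))"

lemma amplify_mem:
  assumes A: "A \<in> bounded_ops H" and \<xi>: "\<xi> \<in> vecs (l2 I H)"
  shows "amplify I A \<xi> \<in> vecs (l2 I H)"
proof -
  obtain C where C0: "C \<ge> 0" and C: "\<And>v. v \<in> vecs H \<Longrightarrow> vnorm H (A v) \<le> C * vnorm H v"
    using bounded_bound[OF A] by blast
  show ?thesis
  proof (rule l2_memI[where g = "\<lambda>k. C\<^sup>2 * (vnorm H (\<xi> k))\<^sup>2"])
    show "(\<lambda>k. C\<^sup>2 * (vnorm H (\<xi> k))\<^sup>2) summable_on I"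
      using \<xi> by (intro summable_on_cmult_right) (auto simp: l2_mem_iff)
    fix k assume k: "k \<in> I"
    then have "(vnorm H (A (\<xi> k)))\<^sup>2 \<le> (C * vnorm H (\<xi> k))\<^sup>2"
      using \<xi> A C by (intro power_mono) auto
    then show "(vnorm H (amplify I A \<xi> k))\<^sup>2 \<le> C\<^sup>2 * (vnorm H (\<xi> k))\<^sup>2"
      using k by (simp add: amplify_def power_mult_distrib)
  qed (use A \<xi> in \<open>auto simp: amplify_def\<close>)
qed

lemma amplify_adjoint:
  assumes "adjoint_pair A B" "\<xi> \<in> vecs (l2 I H)" "\<eta> \<in> vecs (l2 I H)"
  shows "vinner (l2 I H) (amplify I A \<xi>) \<eta> = vinner (l2 I H) \<xi> (amplify I B \<eta>)"
  unfolding l2_vinner using assms by (intro infsum_cong) (auto simp: amplify_def adjoint_pair_def)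

text \<open>Von Neumann's density argument. Let \<open>Q\<close> be the projection onto the orthogonal complement of
  the orbit of \<open>\<xi>\<close> under the amplified operators. It commutes with them, so its matrix entries lie
  in the commutant, so \<open>Q\<close> also commutes with the amplification of any \<open>x\<close> in the bicommutant.
  Since \<open>Q\<close> kills \<open>\<xi>\<close> and fixes \<open>\<eta>\<close>, the functional vanishes at \<open>x\<close>.\<close>

lemma functional_vanishes_on_bicommutant:
  assumes S: "S \<subseteq> bounded_ops H"
    and S_adj: "\<And>A. A \<in> S \<Longrightarrow> \<exists>A'\<in>S. adjoint_pair A A'"
    and S_mult: "\<And>A B. A \<in> S \<Longrightarrow> B \<in> S \<Longrightarrow> op_mult H A B \<in> S"
    and E: "E \<in> S" "\<And>v. v \<in> vecs H \<Longrightarrow> E v = v"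
    and \<xi>: "\<xi> \<in> vecs (l2 I H)" and \<eta>: "\<eta> \<in> vecs (l2 I H)"
    and vanish: "\<And>A. A \<in> S \<Longrightarrow> (\<Sum>\<^sub>\<infinity>k\<in>I. vinner H (A (\<xi> k)) (\<eta> k)) = 0"
    and x: "x \<in> commutant H (commutant H S)"
  shows "(\<Sum>\<^sub>\<infinity>k\<in>I. vinner H (x (\<xi> k)) (\<eta> k)) = 0"
proof -
  let ?L = "l2 I H"
  interpret L: hilb_space ?L by (rule l2_hilb_space)
  have SB: "\<And>A. A \<in> S \<Longrightarrow> A \<in> bounded_ops H" using S by blast
  have amp_inner: "vinner ?L (amplify I A \<zeta>) \<omega> = (\<Sum>\<^sub>\<infinity>k\<in>I. vinner H (A (\<zeta> k)) (\<omega> k))" for A \<zeta> \<omega>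
    unfolding l2_vinner by (intro infsum_cong) (auto simp: amplify_def)
  define Y where "Y = {\<omega> \<in> vecs ?L. \<forall>A\<in>S. vinner ?L (amplify I A \<xi>) \<omega> = 0}"
  have YL: "\<And>y. y \<in> Y \<Longrightarrow> y \<in> vecs ?L" by (simp add: Y_def)
  have \<eta>Y: "\<eta> \<in> Y" using \<eta> vanish by (simp add: Y_def amp_inner)
  have Y: "L.closed_subspace Y"
    unfolding L.closed_subspace_def
  proof (intro conjI allI ballI impI)
    fix s u assume u: "u \<in> vecs ?L" and *: "(\<forall>n. s n \<in> Y) \<and> (\<lambda>n. vnorm ?L (vdiff ?L (s n) u)) \<longlonglongrightarrow> 0"
    have sL: "\<And>n. s n \<in> vecs ?L" using * YL by blast
    have "vinner ?L (amplify I A \<xi>) u = 0" if A: "A \<in> S" for A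
    proof -
      have mem: "amplify I A \<xi> \<in> vecs ?L" using amplify_mem[OF SB[OF A] \<xi>] .
      have "vinner ?L (s n) (amplify I A \<xi>) = 0" for n
        using * A L.inner_commute[OF mem sL[of n]] by (auto simp: Y_def)
      then have "vinner ?L u (amplify I A \<xi>) = 0"
        using L.inner_tendsto[OF sL u conjunct2[OF *] mem] by (simp add: LIMSEQ_const_iff)
      then show ?thesis using L.inner_commute[OF u mem] by simp
    qed
    then show "u \<in> Y" using u by (simp add: Y_def)
  qed (use \<eta>Y amplify_mem[OF SB \<xi>] in \<open>auto simp: Y_def\<close>)
  have "\<exists>y\<in>Y. \<forall>z\<in>Y. vinner ?L (vdiff ?L v y) z = 0" if "v \<in> vecs ?L" for v
    by (rule L.orthogonal_projection[OF Y that]) blast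
  then obtain Q where QY: "\<And>v. v \<in> vecs ?L \<Longrightarrow> Q v \<in> Y"
    and Qorth: "\<And>v z. v \<in> vecs ?L \<Longrightarrow> z \<in> Y \<Longrightarrow> vinner ?L (vdiff ?L v (Q v)) z = 0" by metis
  have QL [simp]: "\<And>v. v \<in> vecs ?L \<Longrightarrow> Q v \<in> vecs ?L" using QY YL by blast
  have Q1: "vinner ?L (Q v) z = vinner ?L v z" if "v \<in> vecs ?L" "z \<in> Y" for v z
    using Qorth[OF that] that YL by simp
  have Q_unique: "Q v = y" if v: "v \<in> vecs ?L" and y: "y \<in> Y"
    and "\<And>z. z \<in> Y \<Longrightarrow> vinner ?L y z = vinner ?L v z" for v y
  proof (rule L.inner_ext)
    fix w assume w: "w \<in> vecs ?L"
    have "vinner ?L (vdiff ?L (Q v) y) (vdiff ?L (Q v) y) = 0"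
      using that Q1[OF v] QY[OF v] YL v by simp
    then have "vnorm ?L (vdiff ?L (Q v) y) = 0" by (simp add: vnorm_def)
    then show "vinner ?L (Q v) w = vinner ?L y w"
      using L.norm_eq_0[of "vdiff ?L (Q v) y" w] v y YL w by simp
  qed (use v y YL in auto)
  have Q_sa: "vinner ?L (Q v) w = vinner ?L v (Q w)" if "v \<in> vecs ?L" "w \<in> vecs ?L" for v w
  proof -
    have "vinner ?L (Q v) (Q w) = vinner ?L (Q v) w"
      using Q1[OF that(2) QY[OF that(1)]] that L.inner_commute[of "Q w" "Q v"] L.inner_commute[of w "Q v"] by simp
    then show ?thesis using Q1[OF that(1) QY[OF that(2)]] by simp
  qed
  have Q_norm: "vnorm ?L (Q v) \<le> vnorm ?L v" if v: "v \<in> vecs ?L" for v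
  proof -
    have "(vnorm ?L (Q v))\<^sup>2 = Re (vinner ?L v (Q v))"
      using Q1[OF v QY[OF v]] v by (simp add: L.norm_sq)
    also have "\<dots> \<le> vnorm ?L v * vnorm ?L (Q v)"
      using L.cauchy_schwarz[of v "Q v"] complex_Re_le_cmod[of "vinner ?L v (Q v)"] v
        by (meson QL order_trans)
    finally have "vnorm ?L (Q v) * vnorm ?L (Q v) \<le> vnorm ?L v * vnorm ?L (Q v)"
      by (simp add: power2_eq_square)
    then show ?thesis using L.norm_nonneg[OF v] L.norm_nonneg[OF QL[OF v]]
      by (metis less_eq_real_def mult_right_le_imp_le)
  qed
  have Y_inv: "amplify I A \<omega> \<in> Y" if A: "A \<in> S" and \<omega>: "\<omega> \<in> Y" for A \<omega>
  proof -
    obtain A' where A': "A' \<in> S" "adjoint_pair A A'" using S_adj[OF A] by blast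
    have "vinner ?L (amplify I B \<xi>) (amplify I A \<omega>) = 0" if B: "B \<in> S" for B
    proof -
      have "adjoint_pair A' A" using adjoint_pair_sym[OF A'(2)] SB A A' by simp
      then have "vinner ?L (amplify I B \<xi>) (amplify I A \<omega>) = vinner ?L (amplify I A' (amplify I B \<xi>)) \<omega>"
        using amplify_adjoint[OF _ amplify_mem[OF SB[OF B] \<xi>] YL[OF \<omega>]] by simp
      also have "amplify I A' (amplify I B \<xi>) = amplify I (op_mult H A' B) \<xi>"
        using \<xi> by (auto simp: amplify_def op_mult_apply)
      finally show ?thesis using \<omega> S_mult[OF A'(1) B] by (simp add: Y_def)
    qed
    then show ?thesis using amplify_mem[OF SB[OF A] YL[OF \<omega>]] by (simp add: Y_def)
  qed
  have Q_amp: "Q (amplify I A v) = amplify I A (Q v)" if A: "A \<in> S" and v: "v \<in> vecs ?L" for A v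
  proof (rule Q_unique)
    fix z assume z: "z \<in> Y"
    obtain A' where A': "A' \<in> S" "adjoint_pair A A'" using S_adj[OF A] by blast
    show "vinner ?L (amplify I A (Q v)) z = vinner ?L (amplify I A v) z"
      using amplify_adjoint[OF A'(2) v YL[OF z]] amplify_adjoint[OF A'(2) QL[OF v] YL[OF z]]
        Q1[OF v Y_inv[OF A'(1) z]] by simp
  qed (use amplify_mem[OF SB[OF A] v] Y_inv[OF A QY[OF v]] in auto)
  define P where "P i j = (\<lambda>w\<in>vecs H. Q (l2_single I H j w) i)" for i j
  have P_adj: "adjoint_pair (P i j) (P j i)" if "i \<in> I" "j \<in> I" for i j
    unfolding adjoint_pair_def
  proof (intro ballI)
    fix v w assume "v \<in> vecs H" "w \<in> vecs H"
    then show "vinner H (P i j v) w = vinner H v (P j i w)"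
      using that Q_sa[of "l2_single I H j v" "l2_single I H i w"] by (simp add: P_def)
  qed
  have P_mem: "P i j \<in> commutant H S" if ij: "i \<in> I" "j \<in> I" for i j
    unfolding commutant_iff
  proof (intro conjI ballI)
    show "P i j \<in> bounded_ops H"
    proof (rule bounded_opsI[OF _ _ _ P_adj[OF ij], of 1])
      fix v assume v: "v \<in> vecs H"
      have "vnorm H (Q (l2_single I H j v) i) \<le> vnorm ?L (l2_single I H j v)"
        using l2_component_norm_le[OF QL[OF l2_single_mem[OF v]] ij(1)] Q_norm[OF l2_single_mem[OF v]] order_trans by blast
      also have "\<dots> = vnorm H v" using v ij by (simp add: vnorm_def)
      finally show "vnorm H (P i j v) \<le> 1 * vnorm H v" using v by (simp add: P_def)
    qed (use ij l2_closed[OF QL[OF l2_single_mem]] in \<open>auto simp: P_def\<close>)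
  next
    fix A v assume A: "A \<in> S" and v: "v \<in> vecs H"
    have "amplify I A (l2_single I H j v) = l2_single I H j (A v)"
      using SB[OF A] v ij by (auto simp: amplify_def l2_single_def bounded_scale)
    then show "P i j (A v) = A (P i j v)"
      using Q_amp[OF A l2_single_mem[OF v], of j] SB[OF A] v ij
        by (simp add: P_def) (simp add: amplify_def)
  qed
  have xB: "x \<in> bounded_ops H" using x by (simp add: commutant_iff)
  have xP: "x (P i j v) = P i j (x v)" if "i \<in> I" "j \<in> I" "v \<in> vecs H" for i j v
    using x P_mem[OF that(1,2)] that(3) by (simp add: commutant_iff[of x])
  obtain x' where x': "x' \<in> bounded_ops H" "adjoint_pair x x'" using adjoint_exists[OF xB] .
  have Q_x: "Q (amplify I x \<zeta>) = amplify I x (Q \<zeta>)" if \<zeta>: "\<zeta> \<in> vecs ?L" for \<zeta>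
  proof (rule l2_single_ext)
    fix i w assume i: "i \<in> I" and w: "w \<in> vecs H"
    have "vinner ?L (Q (amplify I x \<zeta>)) (l2_single I H i w) = vinner ?L (amplify I x \<zeta>) (Q (l2_single I H i w))"
      using Q_sa amplify_mem[OF xB \<zeta>] w by simp
    also have "\<dots> = (\<Sum>\<^sub>\<infinity>j\<in>I. vinner H (x (\<zeta> j)) (P j i w))"
      unfolding amp_inner using w by (simp add: P_def)
    also have "\<dots> = (\<Sum>\<^sub>\<infinity>j\<in>I. vinner H (\<zeta> j) (P j i (x' w)))"
    proof (rule infsum_cong)
      fix j assume j: "j \<in> I"
      note Pij = P_mem[OF i j] and Pb = P_mem[OF i j, unfolded commutant_iff, THEN conjunct1]
      have \<zeta>j: "\<zeta> j \<in> vecs H" using \<zeta> j by simp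
      have "vinner H (x (\<zeta> j)) (P j i w) = vinner H (x (P i j (\<zeta> j))) w"
        using adjoint_pairD[OF P_adj[OF i j], of "x (\<zeta> j)" w] xP[OF i j \<zeta>j] xB \<zeta>j w by simp
      also have "\<dots> = vinner H (P i j (\<zeta> j)) (x' w)"
        using adjoint_pairD[OF x'(2)] Pb \<zeta>j w by simp
      also have "\<dots> = vinner H (\<zeta> j) (P j i (x' w))"
        using adjoint_pairD[OF P_adj[OF i j]] \<zeta>j x' w by simp
      finally show "vinner H (x (\<zeta> j)) (P j i w) = vinner H (\<zeta> j) (P j i (x' w))" .
    qed
    also have "\<dots> = vinner ?L \<zeta> (Q (l2_single I H i (x' w)))"
      unfolding l2_vinner using w x' by (simp add: P_def)
    also have "\<dots> = vinner H (Q \<zeta> i) (x' w)" using Q_sa[symmetric] \<zeta> w x' i by simp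
    also have "\<dots> = vinner ?L (amplify I x (Q \<zeta>)) (l2_single I H i w)"
      using adjoint_pairD[OF x'(2) l2_closed[OF QL[OF \<zeta>] i] w] i w amplify_mem[OF xB QL[OF \<zeta>]]
      by (simp add: amplify_def)
    finally show "vinner ?L (Q (amplify I x \<zeta>)) (l2_single I H i w)
      = vinner ?L (amplify I x (Q \<zeta>)) (l2_single I H i w)" .
  qed (use amplify_mem[OF xB \<zeta>] amplify_mem[OF xB QL[OF \<zeta>]] in simp_all)
  have Q\<xi>: "vinner ?L (Q \<xi>) w = 0" if w: "w \<in> vecs ?L" for w
  proof -
    have "amplify I E \<xi> = \<xi>"
      using E(2) \<xi> by (intro extensionalityI[of _ I]) (auto simp: amplify_def l2_mem_iff PiE_def)
    then have "vinner ?L \<xi> (Q w) = 0" using QY[OF w] E(1) by (auto simp: Y_def)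
    then show ?thesis using Q_sa[OF \<xi> w] by simp
  qed
  have "vinner ?L (amplify I x \<xi>) \<eta> = vinner ?L (amplify I x \<xi>) (Q \<eta>)"
    using Q_unique[OF \<eta> \<eta>Y] by simp
  also have "\<dots> = vinner ?L (amplify I x (Q \<xi>)) \<eta>"
    using Q_sa[OF amplify_mem[OF xB \<xi>] \<eta>] Q_x[OF \<xi>] by simp
  also have "\<dots> = vinner ?L (Q \<xi>) (amplify I x' \<eta>)" by (rule amplify_adjoint[OF x'(2) QL[OF \<xi>] \<eta>])
  also have "\<dots> = 0" using Q\<xi> amplify_mem[OF x'(1) \<eta>] .
  finally show ?thesis by (simp add: amp_inner)
qed

end

section \<open>The Hilbert space of square integrable functions\<close>

lemma borel_measurable_cnj [measurable (raw)]:
  "f \<in> borel_measurable M \<Longrightarrow> (\<lambda>x. cnj (f x)) \<in> borel_measurable M"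
  by (rule borel_measurable_continuous_on[of cnj]) (auto intro: continuous_intros)

lemma square_integrable_iff: "f \<in> square_integrable M \<longleftrightarrow>
    f \<in> borel_measurable M \<and> integrable M (\<lambda>x. (cmod (f x))\<^sup>2)"
  by (simp add: square_integrable_def)

lemma square_integrable_measurable [measurable_dest]:
  "f \<in> square_integrable M \<Longrightarrow> f \<in> borel_measurable M"
  by (simp add: square_integrable_def)

lemma square_integrable_bound:
  assumes "g \<in> borel_measurable M" "integrable M h" "\<And>x. (cmod (g x))\<^sup>2 \<le> h x"
  shows "g \<in> square_integrable M"
  unfolding square_integrable_iff
proof
  show "integrable M (\<lambda>x. (cmod (g x))\<^sup>2)"
    by (rule Bochner_Integration.integrable_bound[OF assms(2)])
      (use assms in \<open>auto intro: order_trans[OF _ abs_ge_self]\<close>)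
qed (fact assms(1))

lemma cmod_add_sq_le: "(cmod (a + b))\<^sup>2 \<le> 2 * (cmod a)\<^sup>2 + 2 * (cmod b)\<^sup>2"
proof -
  have "(cmod (a + b))\<^sup>2 \<le> (cmod a + cmod b)\<^sup>2" by (intro power_mono norm_triangle_ineq) auto
  also have "\<dots> \<le> 2 * (cmod a)\<^sup>2 + 2 * (cmod b)\<^sup>2"
    using sum_squares_bound[of "cmod a" "cmod b"] by (simp add: power2_sum)
  finally show ?thesis .
qed

lemma square_integrable_add [intro]:
  assumes f: "f \<in> square_integrable M" and g: "g \<in> square_integrable M"
  shows "(\<lambda>x. f x + g x) \<in> square_integrable M"
proof (rule square_integrable_bound[where h = "\<lambda>x. 2 * (cmod (f x))\<^sup>2 + 2 * (cmod (g x))\<^sup>2"])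
  show "(\<lambda>x. f x + g x) \<in> borel_measurable M" using f g by measurable
  show "integrable M (\<lambda>x. 2 * (cmod (f x))\<^sup>2 + 2 * (cmod (g x))\<^sup>2)"
    using f g by (auto simp: square_integrable_iff)
qed (rule cmod_add_sq_le)

lemma square_integrable_cmult [intro]:
  assumes f: "f \<in> square_integrable M"
  shows "(\<lambda>x. c * f x) \<in> square_integrable M"
proof (rule square_integrable_bound[where h = "\<lambda>x. (cmod c)\<^sup>2 * (cmod (f x))\<^sup>2"])
  show "(\<lambda>x. c * f x) \<in> borel_measurable M" using f by measurable
  show "integrable M (\<lambda>x. (cmod c)\<^sup>2 * (cmod (f x))\<^sup>2)" using f
    by (auto simp: square_integrable_iff)
qed (simp add: norm_mult power_mult_distrib)

lemma square_integrable_diff [intro]: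
  assumes f: "f \<in> square_integrable M" and g: "g \<in> square_integrable M"
  shows "(\<lambda>x. f x - g x) \<in> square_integrable M"
  using square_integrable_add[OF f square_integrable_cmult[OF g, of "-1"]] by simp

lemma square_integrable_inner:
  assumes f: "f \<in> square_integrable M" and g: "g \<in> square_integrable M"
  shows "integrable M (\<lambda>x. f x * cnj (g x))"
proof (rule Bochner_Integration.integrable_bound[where f = "\<lambda>x. (cmod (f x))\<^sup>2 + (cmod (g x))\<^sup>2"])
  show "integrable M (\<lambda>x. (cmod (f x))\<^sup>2 + (cmod (g x))\<^sup>2)"
    using f g by (auto simp: square_integrable_iff)
  show "(\<lambda>x. f x * cnj (g x)) \<in> borel_measurable M" using f g by measurable
  have "a * b \<le> a\<^sup>2 + b\<^sup>2" if "a \<ge> 0" "b \<ge> 0" for a b :: real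
    using sum_squares_bound[of a b] mult_nonneg_nonneg[OF that] by linarith
  then show "AE x in M. norm (f x * cnj (g x)) \<le> norm ((cmod (f x))\<^sup>2 + (cmod (g x))\<^sup>2)"
    by (simp add: norm_mult)
qed

lemma L2_class_cong:
  assumes "AE x in M. f x = g x"
  shows "L2_class M f = L2_class M g"
proof -
  have "(AE x in M. h x = f x) \<longleftrightarrow> (AE x in M. h x = g x)" for h
    using assms by (auto elim: AE_mp)
  then show ?thesis by (simp add: L2_class_def)
qed

lemma L2_class_cong_space: "(\<And>x. x \<in> space M \<Longrightarrow> f x = g x) \<Longrightarrow> L2_class M f = L2_class M g"
  by (rule L2_class_cong) auto

lemma L2_rep_class:
  assumes "f \<in> square_integrable M"
  shows L2_rep_class_mem: "L2_rep (L2_class M f) \<in> square_integrable M"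
    and L2_rep_class_AE: "AE x in M. L2_rep (L2_class M f) x = f x"
proof -
  have "f \<in> L2_class M f" using assms by (simp add: L2_class_def)
  then have "L2_rep (L2_class M f) \<in> L2_class M f" unfolding L2_rep_def
    by (rule someI[of "\<lambda>h. h \<in> L2_class M f"])
  then show "L2_rep (L2_class M f) \<in> square_integrable M" "AE x in M. L2_rep (L2_class M f) x = f x"
    by (auto simp: L2_class_def)
qed

lemma L2_class_mem [intro]: "f \<in> square_integrable M \<Longrightarrow> L2_class M f \<in> vecs (L2 M)"
  by (simp add: L2_def)

lemma L2_rep_mem: "v \<in> vecs (L2 M) \<Longrightarrow> L2_rep v \<in> square_integrable M"
  using L2_rep_class_mem by (auto simp: L2_def)

lemma L2_class_rep: "v \<in> vecs (L2 M) \<Longrightarrow> L2_class M (L2_rep v) = v"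
  using L2_rep_class_AE L2_class_cong by (fastforce simp: L2_def)

lemma L2_vecsE:
  assumes "v \<in> vecs (L2 M)"
  obtains f where "f \<in> square_integrable M" "v = L2_class M f"
  using assms by (auto simp: L2_def)

lemma L2_inner_class:
  assumes f: "f \<in> square_integrable M" and g: "g \<in> square_integrable M"
  shows "vinner (L2 M) (L2_class M f) (L2_class M g) = (\<integral>x. f x * cnj (g x) \<partial>M)"
proof -
  note [measurable] = square_integrable_measurable[OF f] square_integrable_measurable[OF g]
    square_integrable_measurable[OF L2_rep_class_mem[OF f]]
    square_integrable_measurable[OF L2_rep_class_mem[OF g]]
  show ?thesis
    unfolding L2_def hilb.simps
  proof (rule integral_cong_AE)
    show "AE x in M. L2_rep (L2_class M f) x * cnj (L2_rep (L2_class M g) x) = f x * cnj (g x)"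
      using L2_rep_class_AE[OF f] L2_rep_class_AE[OF g] by eventually_elim simp
  qed measurable
qed

lemma L2_inner: "vinner (L2 M) v w = (\<integral>x. L2_rep v x * cnj (L2_rep w x) \<partial>M)"
  by (simp add: L2_def)

lemma L2_add_class:
  assumes f: "f \<in> square_integrable M" and g: "g \<in> square_integrable M"
  shows "vadd (L2 M) (L2_class M f) (L2_class M g) = L2_class M (\<lambda>x. f x + g x)"
  unfolding L2_def hilb.simps
proof (rule L2_class_cong)
  show "AE x in M. L2_rep (L2_class M f) x + L2_rep (L2_class M g) x = f x + g x"
    using L2_rep_class_AE[OF f] L2_rep_class_AE[OF g] by eventually_elim simp
qed

lemma L2_scale_class:
  assumes f: "f \<in> square_integrable M"
  shows "vscale (L2 M) c (L2_class M f) = L2_class M (\<lambda>x. c * f x)"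
  unfolding L2_def hilb.simps
proof (rule L2_class_cong)
  show "AE x in M. c * L2_rep (L2_class M f) x = c * f x"
    using L2_rep_class_AE[OF f] by eventually_elim simp
qed

lemma L2_diff_class:
  assumes f: "f \<in> square_integrable M" and g: "g \<in> square_integrable M"
  shows "vdiff (L2 M) (L2_class M f) (L2_class M g) = L2_class M (\<lambda>x. f x - g x)"
  unfolding vdiff_def L2_scale_class[OF g] L2_add_class[OF f square_integrable_cmult[OF g]] by simp

lemma L2_inner_self_class:
  assumes f: "f \<in> square_integrable M"
  shows "vinner (L2 M) (L2_class M f) (L2_class M f) = of_real (\<integral>x. (cmod (f x))\<^sup>2 \<partial>M)"
proof -
  have "vinner (L2 M) (L2_class M f) (L2_class M f) = (\<integral>x. complex_of_real ((cmod (f x))\<^sup>2) \<partial>M)"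
    unfolding L2_inner_class[OF f f] complex_norm_square ..
  also have "\<dots> = of_real (\<integral>x. (cmod (f x))\<^sup>2 \<partial>M)" by (rule integral_complex_of_real)
  finally show ?thesis .
qed

lemma L2_norm_sq_class:
  assumes f: "f \<in> square_integrable M"
  shows "(vnorm (L2 M) (L2_class M f))\<^sup>2 = (\<integral>x. (cmod (f x))\<^sup>2 \<partial>M)"
  by (simp add: vnorm_def L2_inner_self_class[OF f])

lemma L2_norm_class_nonneg: "f \<in> square_integrable M \<Longrightarrow> 0 \<le> vnorm (L2 M) (L2_class M f)"
  by (simp add: vnorm_def L2_inner_self_class)

lemma L2_norm_sq_class_nn:
  assumes f: "f \<in> square_integrable M"
  shows "ennreal ((vnorm (L2 M) (L2_class M f))\<^sup>2) = (\<integral>\<^sup>+x. ennreal ((cmod (f x))\<^sup>2) \<partial>M)"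
  unfolding L2_norm_sq_class[OF f] using f
  by (intro nn_integral_eq_integral[symmetric]) (auto simp: square_integrable_iff)

text \<open>Riesz--Fischer: a sequence whose successive distances decay fast enough converges
  pointwise almost everywhere, and Fatou's lemma bounds the distance to the limit.\<close>

lemma square_integrable_complete:
  fixes f :: "nat \<Rightarrow> 'a \<Rightarrow> complex"
  assumes f: "\<And>n. f n \<in> square_integrable M"
    and cauchy: "\<And>e. e > 0 \<Longrightarrow> \<exists>N. \<forall>m\<ge>N. \<forall>n\<ge>N. (\<integral>\<^sup>+x. ennreal ((cmod (f m x - f n x))\<^sup>2) \<partial>M) \<le> ennreal (e\<^sup>2)"
  obtains g where "g \<in> square_integrable M"
    "\<And>e. e > 0 \<Longrightarrow> \<exists>N. \<forall>n\<ge>N. (\<integral>\<^sup>+x. ennreal ((cmod (f n x - g x))\<^sup>2) \<partial>M) \<le> ennreal (e\<^sup>2)"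
proof -
  have [measurable]: "f n \<in> borel_measurable M" for n using f by (rule square_integrable_measurable)
  have "\<exists>N. \<forall>m\<ge>N. \<forall>n\<ge>N. (\<integral>\<^sup>+x. ennreal ((cmod (f m x - f n x))\<^sup>2) \<partial>M) \<le> ennreal (((1/2)^k)\<^sup>2)" for k
    by (rule cauchy) simp
  then obtain N where N: "\<And>k m n. m \<ge> N k \<Longrightarrow> n \<ge> N k \<Longrightarrow>
     (\<integral>\<^sup>+x. ennreal ((cmod (f m x - f n x))\<^sup>2) \<partial>M) \<le> ennreal (((1/2)^k)\<^sup>2)" by metis
  define r where "r k = (\<Sum>i\<le>2 * k. N i) + k" for k
  have rN: "N (2 * k) \<le> r k" "N (2 * k) \<le> r (Suc k)" "k \<le> r k" for k
  proof -
    show "N (2 * k) \<le> r k" "N (2 * k) \<le> r (Suc k)"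
      unfolding r_def by (intro trans_le_add1 member_le_sum; simp)+
  qed (simp add: r_def)
  define d where "d k x = f (r (Suc k)) x - f (r k) x" for k x
  have [measurable]: "d k \<in> borel_measurable M" for k unfolding d_def by measurable
  have d_bound: "(\<integral>\<^sup>+x. ennreal (2^k * (cmod (d k x))\<^sup>2) \<partial>M) \<le> ennreal ((1/2)^k)" for k
  proof -
    have "(\<integral>\<^sup>+x. ennreal (2^k * (cmod (d k x))\<^sup>2) \<partial>M) = ennreal (2^k) * (\<integral>\<^sup>+x. ennreal ((cmod (d k x))\<^sup>2) \<partial>M)"
      by (subst nn_integral_cmult[symmetric]) (auto simp: ennreal_mult)
    also have "\<dots> \<le> ennreal (2^k) * ennreal (((1/2)^(2*k))\<^sup>2)"
      unfolding d_def by (intro mult_left_mono N rN) auto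
    also have "\<dots> = ennreal (2^k * ((1/2)^(2*k))\<^sup>2)" by (simp add: ennreal_mult)
    also have "\<dots> \<le> ennreal ((1/2)^k)"
    proof (intro ennreal_leI)
      have "(2::real)^k * ((1/2)^(2*k))\<^sup>2 = (2 * ((1/2)\<^sup>2)\<^sup>2)^k"
        unfolding power_mult_distrib power_mult[symmetric] by (simp add: mult_ac)
      also have "\<dots> = (1/8)^k" by (simp add: power2_eq_square)
      also have "\<dots> \<le> (1/2)^k" by (intro power_mono) auto
      finally show "(2::real)^k * ((1/2)^(2*k))\<^sup>2 \<le> (1/2)^k" .
    qed
    finally show ?thesis .
  qed
  have "(\<integral>\<^sup>+x. (\<Sum>k. ennreal (2^k * (cmod (d k x))\<^sup>2)) \<partial>M) = (\<Sum>k. \<integral>\<^sup>+x. ennreal (2^k * (cmod (d k x))\<^sup>2) \<partial>M)"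
    by (rule nn_integral_suminf) measurable
  also have "\<dots> \<le> (\<Sum>k. ennreal ((1/2)^k))" by (intro suminf_le d_bound) auto
  also have "\<dots> = ennreal (\<Sum>k. (1/2)^k)" by (intro suminf_ennreal2 summable_geometric) auto
  also have "\<dots> < \<infinity>" by simp
  finally have "AE x in M. (\<Sum>k. ennreal (2^k * (cmod (d k x))\<^sup>2)) \<noteq> \<infinity>"
    by (intro nn_integral_PInf_AE) auto
  then have AE_conv: "AE x in M. convergent (\<lambda>k. f (r k) x)"
  proof eventually_elim
    case (elim x)
    then have 1: "summable (\<lambda>k. 2^k * (cmod (d k x))\<^sup>2)"
      by (intro summable_suminf_not_top) (auto simp: top_ennreal_def infinity_ennreal_def)
    \<comment> \<open>This turns a weighted bound on the squares into absolute summability.\<close>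
    have le: "cmod (d k x) \<le> (1/2)^k + 2^k * (cmod (d k x))\<^sup>2" for k
    proof (cases "cmod (d k x) \<le> (1/2)^k")
      case False
      then have "1 \<le> 2^k * cmod (d k x)" by (simp add: field_simps power_divide)
      then have "1 * cmod (d k x) \<le> 2^k * cmod (d k x) * cmod (d k x)"
        by (intro mult_right_mono) auto
      then show ?thesis by (simp add: power2_eq_square add_increasing mult.assoc)
    qed (simp add: add_increasing2)
    have "summable (\<lambda>k. (1/2)^k + 2^k * (cmod (d k x))\<^sup>2)"
      by (intro summable_add 1 summable_geometric) auto
    then have "summable (\<lambda>k. d k x)" by (rule summable_comparison_test'[where N = 0]) (use le in auto)
    then have "convergent (\<lambda>n. \<Sum>k<n. d k x)" by (simp add: summable_iff_convergent)
    moreover have "(\<Sum>k<n. d k x) = f (r n) x - f (r 0) x" for n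
      unfolding d_def by (rule sum_lessThan_telescope)
    ultimately show "convergent (\<lambda>k. f (r k) x)" by (simp add: convergent_diff_const_right_iff)
  qed
  define g where "g x = lim (\<lambda>k. f (r k) x)" for x
  have [measurable]: "g \<in> borel_measurable M" unfolding g_def by measurable
  have bound: "(\<integral>\<^sup>+x. ennreal ((cmod (f n x - g x))\<^sup>2) \<partial>M) \<le> ennreal (e\<^sup>2)"
    if "\<And>m. m \<ge> N' \<Longrightarrow> (\<integral>\<^sup>+x. ennreal ((cmod (f n x - f m x))\<^sup>2) \<partial>M) \<le> ennreal (e\<^sup>2)" for n e N'
  proof -
    have "(\<integral>\<^sup>+x. ennreal ((cmod (f n x - g x))\<^sup>2) \<partial>M)
        = (\<integral>\<^sup>+x. liminf (\<lambda>k. ennreal ((cmod (f n x - f (r k) x))\<^sup>2)) \<partial>M)"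
    proof (rule nn_integral_cong_AE)
      show "AE x in M. ennreal ((cmod (f n x - g x))\<^sup>2) = liminf (\<lambda>k. ennreal ((cmod (f n x - f (r k) x))\<^sup>2))"
        using AE_conv
      proof eventually_elim
        case (elim x)
        then have "(\<lambda>k. f (r k) x) \<longlonglongrightarrow> g x" by (simp add: g_def convergent_LIMSEQ_iff)
        then have "(\<lambda>k. ennreal ((cmod (f n x - f (r k) x))\<^sup>2)) \<longlonglongrightarrow> ennreal ((cmod (f n x - g x))\<^sup>2)"
          by (intro tendsto_ennrealI tendsto_intros)
        then show ?case by (rule lim_imp_Liminf[OF sequentially_bot, symmetric])
      qed
    qed
    also have "\<dots> \<le> liminf (\<lambda>k. \<integral>\<^sup>+x. ennreal ((cmod (f n x - f (r k) x))\<^sup>2) \<partial>M)"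
      by (rule nn_integral_liminf) measurable
    also have "\<dots> \<le> limsup (\<lambda>k. \<integral>\<^sup>+x. ennreal ((cmod (f n x - f (r k) x))\<^sup>2) \<partial>M)"
      by (rule Liminf_le_Limsup) simp
    also have "\<dots> \<le> ennreal (e\<^sup>2)"
      using that rN(3) by (intro Limsup_bounded eventually_sequentiallyI[of N']) (meson order_trans)
    finally show ?thesis .
  qed
  have lim: "\<exists>N. \<forall>n\<ge>N. (\<integral>\<^sup>+x. ennreal ((cmod (f n x - g x))\<^sup>2) \<partial>M) \<le> ennreal (e\<^sup>2)" if "e > 0" for e
    using cauchy[OF that] bound by meson
  obtain n where n: "(\<integral>\<^sup>+x. ennreal ((cmod (f n x - g x))\<^sup>2) \<partial>M) \<le> ennreal (1\<^sup>2)"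
    using lim[of 1] by auto
  have "(\<lambda>x. f n x - g x) \<in> square_integrable M"
    unfolding square_integrable_iff
    by (intro conjI integrableI_bounded) (use n in \<open>auto intro: le_less_trans\<close>)
  then have "(\<lambda>x. f n x - (f n x - g x)) \<in> square_integrable M"
    by (rule square_integrable_diff[OF f])
  then have "g \<in> square_integrable M" by simp
  with lim show ?thesis using that by blast
qed

lemma L2_hilb_space: "hilb_space (L2 M)"
proof
  have "(\<lambda>_. 0) \<in> square_integrable M" by (simp add: square_integrable_iff)
  then show "vecs (L2 M) \<noteq> {}" by (metis L2_class_mem empty_iff)
next
  fix v w assume "v \<in> vecs (L2 M)" "w \<in> vecs (L2 M)"
  then obtain f g where fg: "f \<in> square_integrable M" "g \<in> square_integrable M"
    "v = L2_class M f" "w = L2_class M g" by (metis L2_vecsE)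
  then show "vadd (L2 M) v w \<in> vecs (L2 M)" using L2_add_class
    by (metis L2_class_mem square_integrable_add)
  show "vinner (L2 M) w v = cnj (vinner (L2 M) v w)"
    using fg by (simp add: L2_inner_class mult.commute flip: Bochner_Integration.integral_cnj)
next
  fix c v assume "v \<in> vecs (L2 M)"
  then obtain f where fg: "f \<in> square_integrable M" "v = L2_class M f" by (metis L2_vecsE)
  then show "vscale (L2 M) c v \<in> vecs (L2 M)" using L2_scale_class
    by (metis L2_class_mem square_integrable_cmult)
  show "0 \<le> Re (vinner (L2 M) v v)" using fg by (simp add: L2_inner_self_class)
next
  fix u v w assume "u \<in> vecs (L2 M)" "v \<in> vecs (L2 M)" "w \<in> vecs (L2 M)"
  then obtain f g h where fg: "f \<in> square_integrable M" "g \<in> square_integrable M" "h \<in> square_integrable M"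
    "u = L2_class M f" "v = L2_class M g" "w = L2_class M h" by (metis L2_vecsE)
  then show "vinner (L2 M) (vadd (L2 M) u v) w = vinner (L2 M) u w + vinner (L2 M) v w"
    by (simp add: L2_add_class L2_inner_class square_integrable_add distrib_right square_integrable_inner)
next
  fix c v w assume "v \<in> vecs (L2 M)" "w \<in> vecs (L2 M)"
  then obtain f g where fg: "f \<in> square_integrable M" "g \<in> square_integrable M"
    "v = L2_class M f" "w = L2_class M g" by (metis L2_vecsE)
  then show "vinner (L2 M) (vscale (L2 M) c v) w = c * vinner (L2 M) v w"
    by (simp add: L2_scale_class L2_inner_class square_integrable_cmult mult.assoc)
next
  fix u v assume uv: "u \<in> vecs (L2 M)" "v \<in> vecs (L2 M)"
    and eq: "\<And>w. w \<in> vecs (L2 M) \<Longrightarrow> vinner (L2 M) u w = vinner (L2 M) v w"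
  then obtain f g where f: "f \<in> square_integrable M" and g: "g \<in> square_integrable M"
    and u: "u = L2_class M f" and v: "v = L2_class M g" by (metis L2_vecsE)
  note d = square_integrable_diff[OF f g]
  have "(\<integral>x. (f x - g x) * cnj (f x - g x) \<partial>M) = 
      (\<integral>x. f x * cnj (f x - g x) \<partial>M) - (\<integral>x. g x * cnj (f x - g x) \<partial>M)"
    by (subst Bochner_Integration.integral_diff[symmetric])
      (use square_integrable_inner[OF f d] square_integrable_inner[OF g d] in \<open>auto simp: algebra_simps\<close>)
  also have "\<dots> = 0" using eq[OF L2_class_mem[OF d]] by (simp add: u v L2_inner_class f g d)
  finally have "complex_of_real (\<integral>x. (cmod (f x - g x))\<^sup>2 \<partial>M) = 0"
    unfolding complex_norm_square[symmetric] integral_complex_of_real .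
  then have "AE x in M. (cmod (f x - g x))\<^sup>2 = 0"
    using d by (subst (asm) of_real_eq_0_iff, subst (asm) integral_nonneg_eq_0_iff_AE) (auto simp: square_integrable_iff)
  then show "u = v" unfolding u v by (intro L2_class_cong) auto
next
  fix s :: "nat \<Rightarrow> ('a \<Rightarrow> complex) set"
  assume s: "\<And>n. s n \<in> vecs (L2 M)"
    and cauchy: "\<And>e. e > 0 \<Longrightarrow> \<exists>N. \<forall>m\<ge>N. \<forall>n\<ge>N. vnorm (L2 M) (vdiff (L2 M) (s m) (s n)) \<le> e"
  have "\<exists>f. \<forall>n. f n \<in> square_integrable M \<and> s n = L2_class M (f n)"
    using s by (intro choice allI) (metis L2_vecsE)
  then obtain f where f: "\<And>n. f n \<in> square_integrable M" and sf: "\<And>n. s n = L2_class M (f n)"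
    by blast
  have norm_nn: "(\<integral>\<^sup>+x. ennreal ((cmod (a x - b x))\<^sup>2) \<partial>M) \<le> ennreal (e\<^sup>2) \<longleftrightarrow>
      vnorm (L2 M) (vdiff (L2 M) (L2_class M a) (L2_class M b)) \<le> e"
    if "a \<in> square_integrable M" "b \<in> square_integrable M" "e > 0" for a b e
  proof -
    note d = square_integrable_diff[OF that(1,2)]
    have "0 \<le> vnorm (L2 M) (L2_class M (\<lambda>x. a x - b x))" by (rule L2_norm_class_nonneg[OF d])
    then show ?thesis
      unfolding L2_diff_class[OF that(1,2)] L2_norm_sq_class_nn[OF d, symmetric]
      using that(3) by (auto intro: power_mono dest: power2_le_imp_le)
  qed
  obtain g where g: "g \<in> square_integrable M"
    and lim: "\<And>e. e > 0 \<Longrightarrow> \<exists>N. \<forall>n\<ge>N. (\<integral>\<^sup>+x. ennreal ((cmod (f n x - g x))\<^sup>2) \<partial>M) \<le> ennreal (e\<^sup>2)"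
  proof (rule square_integrable_complete[OF f])
    fix e :: real assume "e > 0"
    then show "\<exists>N. \<forall>m\<ge>N. \<forall>n\<ge>N. (\<integral>\<^sup>+x. ennreal ((cmod (f m x - f n x))\<^sup>2) \<partial>M) \<le> ennreal (e\<^sup>2)"
      using cauchy[of e] f by (simp add: norm_nn sf)
  qed blast
  have "(\<lambda>n. vnorm (L2 M) (vdiff (L2 M) (s n) (L2_class M g))) \<longlonglongrightarrow> 0"
  proof (rule LIMSEQ_I)
    fix e :: real assume e: "e > 0"
    then obtain N where N: "\<And>n. n \<ge> N \<Longrightarrow> vnorm (L2 M) (vdiff (L2 M) (s n) (L2_class M g)) \<le> e / 2"
      using lim[of "e/2"] f g by (auto simp: norm_nn sf)
    have "0 \<le> vnorm (L2 M) (vdiff (L2 M) (s n) (L2_class M g))" for n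
      unfolding sf L2_diff_class[OF f g] using square_integrable_diff[OF f g]
        by (rule L2_norm_class_nonneg)
    then show "\<exists>N. \<forall>n\<ge>N. norm (vnorm (L2 M) (vdiff (L2 M) (s n) (L2_class M g)) - 0) < e"
      using N e by (intro exI[of _ N]) (fastforce intro: le_less_trans)
  qed
  then show "\<exists>v\<in>vecs (L2 M). (\<lambda>n. vnorm (L2 M) (vdiff (L2 M) (s n) v)) \<longlonglongrightarrow> 0"
    using L2_class_mem[OF g] by blast
qed

section \<open>Invariant measures on measurable groups\<close>

locale measurable_group = group G for G :: "('a, 'b) monoid_scheme" (structure) +
  fixes S :: "'a measure"
  assumes space_S: "space S = carrier G"
    and mult_measurable: "(\<lambda>(x, y). x \<otimes> y) \<in> S \<Otimes>\<^sub>M S \<rightarrow>\<^sub>M S"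
    and inv_measurable [measurable]: "(\<lambda>x. inv x) \<in> S \<rightarrow>\<^sub>M S"
begin

lemma measurable_mult [measurable (raw)]:
  assumes "f \<in> M \<rightarrow>\<^sub>M S" "g \<in> M \<rightarrow>\<^sub>M S"
  shows "(\<lambda>x. f x \<otimes> g x) \<in> M \<rightarrow>\<^sub>M S"
  using measurable_compose[OF measurable_Pair[OF assms] mult_measurable] by simp

lemma measurable_inv [measurable (raw)]:
  assumes "f \<in> M \<rightarrow>\<^sub>M S"
  shows "(\<lambda>x. inv (f x)) \<in> M \<rightarrow>\<^sub>M S"
  using measurable_compose[OF assms inv_measurable] .

lemma const_measurable: "g \<in> carrier G \<Longrightarrow> (\<lambda>x. g) \<in> M \<rightarrow>\<^sub>M S"
  by (simp add: space_S)

lemma left_translation_measurable: "g \<in> carrier G \<Longrightarrow> (\<lambda>x. g \<otimes> x) \<in> S \<rightarrow>\<^sub>M S"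
  by (intro measurable_mult const_measurable) auto

lemma right_translation_measurable: "g \<in> carrier G \<Longrightarrow> (\<lambda>x. x \<otimes> g) \<in> S \<rightarrow>\<^sub>M S"
  by (intro measurable_mult const_measurable) auto

lemma l_coset_eq_vimage:
  assumes g: "g \<in> carrier G" and E: "E \<subseteq> carrier G"
  shows "g <# E = (\<lambda>x. inv g \<otimes> x) -` E \<inter> carrier G"
proof (intro subset_antisym subsetI)
  fix x assume "x \<in> (\<lambda>x. inv g \<otimes> x) -` E \<inter> carrier G"
  then have x: "inv g \<otimes> x \<in> E" "x \<in> carrier G" by auto
  moreover have "x = g \<otimes> (inv g \<otimes> x)" using x g by (simp add: m_assoc[symmetric])
  ultimately show "x \<in> g <# E" unfolding l_coset_def by blast
qed (use g E in \<open>auto simp: l_coset_def m_assoc[symmetric] subset_iff\<close>)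

lemma r_coset_eq_vimage:
  assumes g: "g \<in> carrier G" and E: "E \<subseteq> carrier G"
  shows "E #> g = (\<lambda>x. x \<otimes> inv g) -` E \<inter> carrier G"
proof (intro subset_antisym subsetI)
  fix x assume "x \<in> (\<lambda>x. x \<otimes> inv g) -` E \<inter> carrier G"
  then have x: "x \<otimes> inv g \<in> E" "x \<in> carrier G" by auto
  moreover have "x = (x \<otimes> inv g) \<otimes> g" using x g by (simp add: m_assoc)
  ultimately show "x \<in> E #> g" unfolding r_coset_def by blast
qed (use g E in \<open>auto simp: r_coset_def m_assoc subset_iff\<close>)

lemma sets_into_carrier: "E \<in> sets S \<Longrightarrow> E \<subseteq> carrier G"
  using sets.sets_into_space space_S by blast

lemma l_coset_sets: "g \<in> carrier G \<Longrightarrow> E \<in> sets S \<Longrightarrow> g <# E \<in> sets S"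
  using measurable_sets[OF left_translation_measurable[of "inv g"], of E]
  by (simp add: l_coset_eq_vimage sets_into_carrier space_S)

lemma r_coset_sets: "g \<in> carrier G \<Longrightarrow> E \<in> sets S \<Longrightarrow> E #> g \<in> sets S"
  using measurable_sets[OF right_translation_measurable[of "inv g"], of E]
  by (simp add: r_coset_eq_vimage sets_into_carrier space_S)

definition left_invariant :: "'a measure \<Rightarrow> bool" where
  "left_invariant \<mu> \<longleftrightarrow> sigma_finite_measure \<mu> \<and> sets \<mu> = sets S \<and> emeasure \<mu> (carrier G) \<noteq> 0 \<and>
     (\<forall>g\<in>carrier G. \<forall>E\<in>sets S. emeasure \<mu> (g <# E) = emeasure \<mu> E)"

lemma left_invariant_nn_integral:
  assumes \<mu>: "left_invariant \<mu>" and g: "g \<in> carrier G" and f: "f \<in> borel_measurable S"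
  shows "(\<integral>\<^sup>+x. f (g \<otimes> x) \<partial>\<mu>) = (\<integral>\<^sup>+x. f x \<partial>\<mu>)"
proof -
  have sets: "sets \<mu> = sets S" using \<mu> by (simp add: left_invariant_def)
  note [measurable_cong] = sets and [measurable] = left_translation_measurable[OF g] f
  have sp: "space \<mu> = carrier G" using sets_eq_imp_space_eq[OF sets] space_S by simp
  have "distr \<mu> S (\<lambda>x. g \<otimes> x) = \<mu>"
  proof (rule measure_eqI)
    fix E assume "E \<in> sets (distr \<mu> S (\<lambda>x. g \<otimes> x))"
    then have E: "E \<in> sets S" by simp
    have "emeasure (distr \<mu> S (\<lambda>x. g \<otimes> x)) E = emeasure \<mu> ((\<lambda>x. g \<otimes> x) -` E \<inter> carrier G)"
      using E by (subst emeasure_distr) (auto simp: sp)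
    also have "(\<lambda>x. g \<otimes> x) -` E \<inter> carrier G = inv g <# E"
      using g E by (subst l_coset_eq_vimage) (auto dest: sets_into_carrier)
    also have "emeasure \<mu> \<dots> = emeasure \<mu> E" using \<mu> g E by (simp add: left_invariant_def)
    finally show "emeasure (distr \<mu> S (\<lambda>x. g \<otimes> x)) E = emeasure \<mu> E" .
  qed (simp add: sets)
  then have "(\<integral>\<^sup>+x. f x \<partial>\<mu>) = (\<integral>\<^sup>+x. f x \<partial>distr \<mu> S (\<lambda>x. g \<otimes> x))" by simp
  also have "\<dots> = (\<integral>\<^sup>+x. f (g \<otimes> x) \<partial>\<mu>)" by (rule nn_integral_distr) measurable
  finally show ?thesis by simp
qed

text \<open>This is \<open>\<nu>(A x\<^sup>-\<^sup>1)\<close>; as an integral it is visibly measurable in \<open>x\<close>.\<close>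

definition right_translate_measure :: "'a measure \<Rightarrow> 'a set \<Rightarrow> 'a \<Rightarrow> ennreal" where
  "right_translate_measure \<nu> A x = (\<integral>\<^sup>+y. indicator A (y \<otimes> x) \<partial>\<nu>)"

lemma right_translate_measure_measurable [measurable]:
  assumes \<nu>: "left_invariant \<nu>" and A [measurable]: "A \<in> sets S"
  shows "right_translate_measure \<nu> A \<in> borel_measurable S"
proof -
  interpret \<nu>: sigma_finite_measure \<nu> using \<nu> by (simp add: left_invariant_def)
  have [measurable_cong]: "sets \<nu> = sets S" using \<nu> by (simp add: left_invariant_def)
  show ?thesis
    unfolding right_translate_measure_def[abs_def] by measurable
qed

text \<open>In the double integral of \<open>f(x) 1\<^sub>A(y x)\<close> replace \<open>x\<close> by \<open>y\<^sup>-\<^sup>1 x\<close> for fixed \<open>y\<close>, and then \<open>y\<close> by \<open>x y\<close>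
  for fixed \<open>x\<close>.\<close>

lemma left_invariant_exchange:
  assumes \<mu>: "left_invariant \<mu>" and \<nu>: "left_invariant \<nu>"
    and A [measurable]: "A \<in> sets S" and f [measurable]: "f \<in> borel_measurable S"
  shows "(\<integral>\<^sup>+x. f x * right_translate_measure \<nu> A x \<partial>\<mu>) = emeasure \<mu> A * (\<integral>\<^sup>+y. f (inv y) \<partial>\<nu>)"
proof -
  interpret \<mu>: sigma_finite_measure \<mu> using \<mu> by (simp add: left_invariant_def)
  interpret \<nu>: sigma_finite_measure \<nu> using \<nu> by (simp add: left_invariant_def)
  interpret P: pair_sigma_finite \<mu> \<nu> ..
  have [measurable_cong]: "sets \<nu> = sets S" "sets \<mu> = sets S" using \<mu> \<nu>
    by (simp_all add: left_invariant_def)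
  have sp [simp]: "space \<mu> = carrier G" "space \<nu> = carrier G"
    using sets_eq_imp_space_eq[of \<mu> S] sets_eq_imp_space_eq[of \<nu> S] \<mu> \<nu> space_S
      by (auto simp: left_invariant_def)
  have "(\<integral>\<^sup>+x. f x * right_translate_measure \<nu> A x \<partial>\<mu>) = (\<integral>\<^sup>+x. \<integral>\<^sup>+y. f x * indicator A (y \<otimes> x) \<partial>\<nu> \<partial>\<mu>)"
  proof (rule nn_integral_cong)
    fix x assume "x \<in> space \<mu>"
    then have [measurable]: "(\<lambda>y. y \<otimes> x) \<in> S \<rightarrow>\<^sub>M S" by (auto intro: right_translation_measurable)
    show "f x * right_translate_measure \<nu> A x = (\<integral>\<^sup>+y. f x * indicator A (y \<otimes> x) \<partial>\<nu>)"
      unfolding right_translate_measure_def by (rule nn_integral_cmult[symmetric]) measurable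
  qed
  also have "\<dots> = (\<integral>\<^sup>+y. \<integral>\<^sup>+x. f x * indicator A (y \<otimes> x) \<partial>\<mu> \<partial>\<nu>)"
    by (rule P.Fubini'[symmetric]) measurable
  also have "\<dots> = (\<integral>\<^sup>+y. \<integral>\<^sup>+x. f (inv y \<otimes> x) * indicator A x \<partial>\<mu> \<partial>\<nu>)"
  proof (rule nn_integral_cong)
    fix y assume "y \<in> space \<nu>"
    then have y: "y \<in> carrier G" by simp
    note [measurable] = left_translation_measurable[OF y] left_translation_measurable[OF inv_closed[OF y]]
    have "(\<integral>\<^sup>+x. f x * indicator A (y \<otimes> x) \<partial>\<mu>) = (\<integral>\<^sup>+x. f (inv y \<otimes> x) * indicator A (y \<otimes> (inv y \<otimes> x)) \<partial>\<mu>)"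
      by (rule left_invariant_nn_integral[OF \<mu> inv_closed[OF y], symmetric]) measurable
    also have "\<dots> = (\<integral>\<^sup>+x. f (inv y \<otimes> x) * indicator A x \<partial>\<mu>)"
      using y by (intro nn_integral_cong) (simp add: m_assoc[symmetric])
    finally show "(\<integral>\<^sup>+x. f x * indicator A (y \<otimes> x) \<partial>\<mu>) = (\<integral>\<^sup>+x. f (inv y \<otimes> x) * indicator A x \<partial>\<mu>)" .
  qed
  also have "\<dots> = (\<integral>\<^sup>+x. \<integral>\<^sup>+y. f (inv y \<otimes> x) * indicator A x \<partial>\<nu> \<partial>\<mu>)"
    by (rule P.Fubini') measurable
  also have "\<dots> = (\<integral>\<^sup>+x. (\<integral>\<^sup>+y. f (inv y) \<partial>\<nu>) * indicator A x \<partial>\<mu>)"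
  proof (rule nn_integral_cong)
    fix x assume "x \<in> space \<mu>"
    then have x: "x \<in> carrier G" by simp
    note [measurable] = right_translation_measurable[OF x]
    have "(\<integral>\<^sup>+y. f (inv y \<otimes> x) \<partial>\<nu>) = (\<integral>\<^sup>+y. f (inv (x \<otimes> y) \<otimes> x) \<partial>\<nu>)"
      by (rule left_invariant_nn_integral[OF \<nu> x, symmetric]) measurable
    also have "\<dots> = (\<integral>\<^sup>+y. f (inv y) \<partial>\<nu>)"
      using x by (intro nn_integral_cong) (simp add: inv_mult_group m_assoc)
    finally show "(\<integral>\<^sup>+y. f (inv y \<otimes> x) * indicator A x \<partial>\<nu>) = (\<integral>\<^sup>+y. f (inv y) \<partial>\<nu>) * indicator A x"
      by (subst nn_integral_multc) auto
  qed
  also have "\<dots> = (\<integral>\<^sup>+y. f (inv y) \<partial>\<nu>) * emeasure \<mu> A"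
    by (rule nn_integral_cmult_indicator) measurable
  finally show ?thesis by (simp add: mult.commute)
qed

definition inv_vimage :: "'a set \<Rightarrow> 'a set" where
  "inv_vimage E = {x \<in> carrier G. inv x \<in> E}"

lemma inv_vimage_sets [measurable]: "E \<in> sets S \<Longrightarrow> inv_vimage E \<in> sets S"
  using measurable_sets[OF inv_measurable, of E]
    by (simp add: inv_vimage_def space_S vimage_def Int_def conj_commute)

lemma inv_vimage_inv_vimage: "E \<in> sets S \<Longrightarrow> inv_vimage (inv_vimage E) = E"
  using sets_into_carrier[of E] by (auto simp: inv_vimage_def subset_iff)

lemma nn_integral_indicator_inv:
  assumes \<nu>: "left_invariant \<nu>" and E: "E \<in> sets S"
  shows "(\<integral>\<^sup>+y. indicator E (inv y) \<partial>\<nu>) = emeasure \<nu> (inv_vimage E)"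
proof -
  have sets: "sets \<nu> = sets S" using \<nu> by (simp add: left_invariant_def)
  have sp: "space \<nu> = carrier G" using sets_eq_imp_space_eq[OF sets] space_S by simp
  have "(\<integral>\<^sup>+y. indicator E (inv y) \<partial>\<nu>) = (\<integral>\<^sup>+y. indicator (inv_vimage E) y \<partial>\<nu>)"
    by (intro nn_integral_cong) (auto simp: sp inv_vimage_def indicator_def)
  then show ?thesis using inv_vimage_sets[OF E] by (simp add: sets)
qed

text \<open>The exchange identity for the whole group and the indicator of \<open>E\<close>.\<close>

lemma left_invariant_null_inv:
  assumes \<mu>: "left_invariant \<mu>" and \<nu>: "left_invariant \<nu>" and E: "E \<in> sets S"
    and 0: "emeasure \<mu> E = 0"
  shows "emeasure \<nu> (inv_vimage E) = 0"
proof -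
  have sets: "sets \<mu> = sets S" using \<mu> by (simp add: left_invariant_def)
  have C: "carrier G \<in> sets S" using sets.top[of S] by (simp add: space_S)
  have "(\<integral>\<^sup>+x. indicator E x * right_translate_measure \<nu> (carrier G) x \<partial>\<mu>) = 0"
    using nn_integral_null_set[of E \<mu> "right_translate_measure \<nu> (carrier G)"] 0 E sets
    by (simp add: null_setsI mult.commute)
  then have "emeasure \<mu> (carrier G) * emeasure \<nu> (inv_vimage E) = 0"
    using left_invariant_exchange[OF \<mu> \<nu> C, of "indicator E"] E nn_integral_indicator_inv[OF \<nu> E]
      by simp
  then show ?thesis using \<mu> by (simp add: left_invariant_def)
qed

lemma left_invariant_absolutely_continuous:
  assumes \<mu>: "left_invariant \<mu>" and \<nu>: "left_invariant \<nu>" and E: "E \<in> sets S"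
    and 0: "emeasure \<mu> E = 0"
  shows "emeasure \<nu> E = 0"
  using left_invariant_null_inv[OF \<nu> \<nu> inv_vimage_sets[OF E] left_invariant_null_inv[OF assms]]
  by (simp add: inv_vimage_inv_vimage[OF E])

lemma left_invariant_finite_nonnull:
  assumes \<mu>: "left_invariant \<mu>"
  obtains A where "A \<in> sets S" "emeasure \<mu> A \<noteq> 0" "emeasure \<mu> A < \<infinity>"
proof -
  interpret \<mu>: sigma_finite_measure \<mu> using \<mu> by (simp add: left_invariant_def)
  have sets: "sets \<mu> = sets S" using \<mu> by (simp add: left_invariant_def)
  obtain A :: "nat \<Rightarrow> 'a set" where A: "range A \<subseteq> sets \<mu>" "(\<Union>i. A i) = space \<mu>" "\<And>i. emeasure \<mu> (A i) \<noteq> \<infinity>"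
    using \<mu>.sigma_finite by blast
  have "\<exists>i. emeasure \<mu> (A i) \<noteq> 0"
  proof (rule ccontr)
    assume "\<nexists>i. emeasure \<mu> (A i) \<noteq> 0"
    then have "(\<Union>i. A i) \<in> null_sets \<mu>" using A by (intro null_sets_UN) auto
    then show False using A(2) \<mu> space_S sets_eq_imp_space_eq[OF sets]
      by (simp add: left_invariant_def null_sets_def)
  qed
  then show ?thesis using A that sets by (metis less_top infinity_ennreal_def range_subsetD)
qed

text \<open>Apply the exchange identity with both choices of the outer measure and divide by the
  measure of \<open>A x\<^sup>-\<^sup>1\<close>, which is positive and finite for almost all \<open>x\<close>.\<close>

theorem left_invariant_unique:
  assumes \<mu>: "left_invariant \<mu>" and \<nu>: "left_invariant \<nu>"
  obtains c :: real where "c > 0" "\<And>E. E \<in> sets S \<Longrightarrow> emeasure \<mu> E = ennreal c * emeasure \<nu> E"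
proof -
  interpret \<mu>: sigma_finite_measure \<mu> using \<mu> by (simp add: left_invariant_def)
  interpret \<nu>: sigma_finite_measure \<nu> using \<nu> by (simp add: left_invariant_def)
  have sets: "sets \<mu> = sets S" "sets \<nu> = sets S" using \<mu> \<nu> by (simp_all add: left_invariant_def)
  note [measurable_cong] = sets
  have sp: "space \<mu> = carrier G" "space \<nu> = carrier G"
    using sets_eq_imp_space_eq[of \<mu> S] sets_eq_imp_space_eq[of \<nu> S] sets space_S by auto
  obtain B :: "nat \<Rightarrow> 'a set" where B: "range B \<subseteq> sets \<mu>" "(\<Union>i. B i) = space \<mu>" "\<And>i. emeasure \<mu> (B i) \<noteq> \<infinity>"
    using \<mu>.sigma_finite by blast
  obtain C :: "nat \<Rightarrow> 'a set" where C: "range C \<subseteq> sets \<nu>" "(\<Union>i. C i) = space \<nu>" "\<And>i. emeasure \<nu> (C i) \<noteq> \<infinity>"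
    using \<nu>.sigma_finite by blast
  have BC: "B i \<in> sets S" "C i \<in> sets S" for i using B C sets by auto
  have "\<exists>i j. emeasure \<nu> (B i \<inter> C j) \<noteq> 0"
  proof (rule ccontr)
    assume "\<nexists>i j. emeasure \<nu> (B i \<inter> C j) \<noteq> 0"
    then have "(\<Union>i. \<Union>j. B i \<inter> C j) \<in> null_sets \<nu>"
      using BC sets by (intro null_sets_UN) (auto simp: null_sets_def)
    also have "(\<Union>i. \<Union>j. B i \<inter> C j) = carrier G"
    proof -
      have "(\<Union>i. \<Union>j. B i \<inter> C j) = (\<Union>i. B i) \<inter> (\<Union>j. C j)" by blast
      then show ?thesis using B(2) C(2) sp by simp
    qed
    finally show False using \<nu> by (simp add: left_invariant_def null_sets_def)
  qed
  then obtain i j where ij: "emeasure \<nu> (B i \<inter> C j) \<noteq> 0" by blast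
  define A where "A = B i \<inter> C j"
  have A [measurable]: "A \<in> sets S" using BC by (auto simp: A_def)
  have A\<nu>: "emeasure \<nu> A \<noteq> 0" using ij by (simp add: A_def)
  have A\<mu>: "emeasure \<mu> A \<noteq> 0" using left_invariant_absolutely_continuous[OF \<mu> \<nu> A] A\<nu> by blast
  have "emeasure \<mu> A \<le> emeasure \<mu> (B i)" "emeasure \<nu> A \<le> emeasure \<nu> (C j)"
    using BC sets by (auto simp: A_def intro!: emeasure_mono)
  then have fin: "emeasure \<mu> A < \<infinity>" "emeasure \<nu> A < \<infinity>"
    using B(3)[of i] C(3)[of j] by (auto simp: less_top[symmetric] top_unique)
  define D where "D = right_translate_measure \<nu> A"
  have D [measurable]: "D \<in> borel_measurable S" unfolding D_def
    by (rule right_translate_measure_measurable[OF \<nu> A])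
  have ex: "(\<integral>\<^sup>+x. f x * D x \<partial>\<kappa>) = emeasure \<kappa> A * (\<integral>\<^sup>+y. f (inv y) \<partial>\<nu>)"
    if "left_invariant \<kappa>" "f \<in> borel_measurable S" for f \<kappa>
    unfolding D_def by (rule left_invariant_exchange[OF that(1) \<nu> A that(2)])
  have exE: "(\<integral>\<^sup>+x. indicator E x * D x \<partial>\<nu>) = emeasure \<nu> A * emeasure \<nu> (inv_vimage E)"
    if "E \<in> sets S" for E
    using ex[OF \<nu>, of "indicator E"] that nn_integral_indicator_inv[OF \<nu> that] by simp
  \<comment> \<open>Over the zero set of \<open>D\<close> the exchange identity has left side 0, so the inverse of this set is
    null, and null sets are stable under inversion.\<close>
  have D0: "AE x in \<nu>. D x \<noteq> 0"
  proof -
    define Z where "Z = {x \<in> space S. D x = 0}"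
    have Z: "Z \<in> sets S" unfolding Z_def by measurable
    have "(\<integral>\<^sup>+x. indicator Z x * D x \<partial>\<nu>) = (\<integral>\<^sup>+x. 0 \<partial>\<nu>)"
      by (intro nn_integral_cong) (auto simp: Z_def indicator_def)
    then have "emeasure \<nu> (inv_vimage Z) = 0" using exE[OF Z] A\<nu> by simp
    then have "emeasure \<nu> Z = 0"
      using left_invariant_null_inv[OF \<nu> \<nu> inv_vimage_sets[OF Z]] inv_vimage_inv_vimage[OF Z]
        by simp
    then show ?thesis
      by (intro AE_I[of _ _ Z]) (use Z sets sp space_S in \<open>auto simp: Z_def\<close>)
  qed
  \<comment> \<open>By the same identity \<open>D\<close> is integrable over inverses of sets of finite measure.\<close>
  have Dfin: "AE x in \<nu>. D x \<noteq> \<infinity>"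
  proof -
    have "AE x in \<nu>. indicator (inv_vimage (C k)) x * D x \<noteq> \<infinity>" for k
    proof (rule nn_integral_PInf_AE)
      have "(\<integral>\<^sup>+x. indicator (inv_vimage (C k)) x * D x \<partial>\<nu>) = emeasure \<nu> A * emeasure \<nu> (C k)"
        using exE[OF inv_vimage_sets[OF BC(2)]] by (simp add: inv_vimage_inv_vimage BC)
      then show "(\<integral>\<^sup>+x. indicator (inv_vimage (C k)) x * D x \<partial>\<nu>) \<noteq> \<infinity>"
        using fin(2) C(3)[of k] by (simp add: ennreal_mult_eq_top_iff)
    qed (use BC in measurable)
    then have "AE x in \<nu>. \<forall>k. indicator (inv_vimage (C k)) x * D x \<noteq> \<infinity>"
      by (simp add: AE_all_countable)
    then show ?thesis
    proof (rule AE_mp, intro AE_I2 impI)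
      fix x assume x: "x \<in> space \<nu>" and *: "\<forall>k. indicator (inv_vimage (C k)) x * D x \<noteq> \<infinity>"
      then have "inv x \<in> (\<Union>i. C i)" using C(2) sp by simp
      then obtain k where "x \<in> inv_vimage (C k)" using x sp by (auto simp: inv_vimage_def)
      then show "D x \<noteq> \<infinity>" using *[rule_format, of k] by simp
    qed
  qed
  have cancel: "AE x in \<kappa>. f x / D x * D x = f x"
    if \<kappa>: "left_invariant \<kappa>" for \<kappa> and f :: "'a \<Rightarrow> ennreal"
  proof -
    define Z where "Z = {x \<in> space S. D x = 0 \<or> D x = \<infinity>}"
    have Z: "Z \<in> sets S" unfolding Z_def by measurable
    have setsK: "sets \<kappa> = sets S" using \<kappa> by (simp add: left_invariant_def)
    have "AE x in \<nu>. x \<notin> Z" using D0 Dfin by eventually_elim (auto simp: Z_def)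
    then have "emeasure \<nu> Z = 0" using Z sets
      by (subst (asm) AE_iff_measurable[of Z]) (auto simp: Z_def sp space_S)
    then have "emeasure \<kappa> Z = 0" by (rule left_invariant_absolutely_continuous[OF \<nu> \<kappa> Z])
    then have "AE x in \<kappa>. x \<notin> Z" using Z setsK by (intro AE_not_in null_setsI) auto
    then show ?thesis
    proof (rule AE_mp, intro AE_I2 impI)
      fix x assume "x \<in> space \<kappa>" "x \<notin> Z"
      then have "D x \<noteq> 0" "D x \<noteq> \<infinity>" using sets_eq_imp_space_eq[OF setsK] by (auto simp: Z_def)
      then show "f x / D x * D x = f x" by (simp add: ennreal_divide_times ennreal_divide_self less_top)
    qed
  qed
  have main: "emeasure \<nu> A * emeasure \<mu> E = emeasure \<mu> A * emeasure \<nu> E" if E [measurable]: "E \<in> sets S" for E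
  proof -
    let ?f = "\<lambda>x. indicator E x / D x"
    have f: "?f \<in> borel_measurable S" by measurable
    have *: "emeasure \<kappa> E = (\<integral>\<^sup>+x. ?f x * D x \<partial>\<kappa>)" if \<kappa>: "left_invariant \<kappa>" for \<kappa>
    proof -
      have "emeasure \<kappa> E = (\<integral>\<^sup>+x. indicator E x \<partial>\<kappa>)" using E \<kappa> by (simp add: left_invariant_def)
      also have "\<dots> = (\<integral>\<^sup>+x. ?f x * D x \<partial>\<kappa>)" using cancel[OF \<kappa>, of "indicator E"]
        by (intro nn_integral_cong_AE) (auto elim!: AE_mp)
      finally show ?thesis .
    qed
    show ?thesis
      unfolding *[OF \<mu>] *[OF \<nu>] ex[OF \<mu> f] ex[OF \<nu> f] by (simp add: mult_ac)
  qed
  obtain a b where a: "emeasure \<mu> A = ennreal a" "a > 0" and b: "emeasure \<nu> A = ennreal b" "b > 0"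
    using fin A\<mu> A\<nu> by (metis ennreal_cases ennreal_0 ennreal_less_zero_iff infinity_ennreal_def less_irrefl not_gr_zero)
  show ?thesis
  proof (rule that[of "a / b"])
    show "a / b > 0" using a b by simp
    fix E assume E: "E \<in> sets S"
    have "emeasure \<mu> E = (ennreal (1/b) * ennreal b) * emeasure \<mu> E" using b
      by (simp flip: ennreal_mult)
    also have "\<dots> = ennreal (1/b) * (ennreal a * emeasure \<nu> E)" using main[OF E] a b
      by (simp add: mult.assoc)
    also have "\<dots> = ennreal (a/b) * emeasure \<nu> E" using a b
      by (simp add: mult.assoc[symmetric] flip: ennreal_mult)
    finally show "emeasure \<mu> E = ennreal (a/b) * emeasure \<nu> E" .
  qed
qed

end

section \<open>Invariant bimeasures are diagonal for the modular function\<close>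

text \<open>Inside each \<open>B\<close>, the sets over which \<open>h\<close> integrates to zero form a Dynkin system.\<close>

lemma (in sigma_finite_measure) AE_zero_of_generator:
  fixes h :: "'a \<Rightarrow> complex"
  assumes \<D>: "countable \<D>" "Int_stable \<D>" "\<Union>\<D> = space M" "sets M = sigma_sets (space M) \<D>"
    and int: "\<And>B. B \<in> \<D> \<Longrightarrow> integrable M (\<lambda>x. indicator B x *\<^sub>R h x)"
    and zero: "\<And>B. B \<in> \<D> \<Longrightarrow> (\<integral>x. indicator B x *\<^sub>R h x \<partial>M) = 0"
  shows "AE x in M. h x = 0"
proof -
  have \<D>sets: "B \<in> sets M" if "B \<in> \<D>" for B using that by (simp add: \<D>(4) sigma_sets.Basic)
  have "AE x in M. indicator B x *\<^sub>R h x = 0" if B: "B \<in> \<D>" for B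
  proof (rule density_zero[OF int[OF B]])
    fix A assume A: "A \<in> sets M"
    let ?I = "\<lambda>A. \<integral>x. indicator A x *\<^sub>R (indicator B x *\<^sub>R h x) \<partial>M"
    have int': "integrable M (\<lambda>x. indicator A x *\<^sub>R (indicator B x *\<^sub>R h x))" if "A \<in> sets M" for A
      using integrable_mult_indicator[OF that int[OF B]] .
    have Pow: "\<D> \<subseteq> Pow (space M)" using \<D>(3) by blast
    have "?I A = 0"
      using \<D>(2) Pow A[unfolded \<D>(4)]
    proof (induction A rule: sigma_sets_induct_disjoint)
      case (basic A)
      have "A \<inter> B \<in> \<D>" using \<D>(2) basic B by (auto simp: Int_stable_def)
      then show ?case using zero[of "A \<inter> B"] by (simp add: indicator_inter_arith mult_ac)
    next
      case (compl A)
      then have A: "A \<in> sets M" by (simp add: \<D>(4))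
      have "?I (space M - A) = (\<integral>x. indicator B x *\<^sub>R h x - indicator A x *\<^sub>R (indicator B x *\<^sub>R h x) \<partial>M)"
        by (intro Bochner_Integration.integral_cong) (auto simp: indicator_def)
      also have "\<dots> = 0" using zero[OF B] compl(2) int[OF B] int'[OF A] by simp
      finally show ?case .
    next
      case (union F)
      then have F: "\<And>i. F i \<in> sets M" by (auto simp: \<D>(4))
      have "set_lebesgue_integral M (\<Union>i. F i) (\<lambda>x. indicator B x *\<^sub>R h x)
          = (\<Sum>i. set_lebesgue_integral M (F i) (\<lambda>x. indicator B x *\<^sub>R h x))"
        using F union(1) int'[of "\<Union>i. F i"]
        by (intro lebesgue_integral_countable_add) (auto simp: set_integrable_def disjoint_family_on_def)
      then show ?case using union(3) by (simp add: set_lebesgue_integral_def)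
    qed simp
    then show "set_lebesgue_integral M A (\<lambda>x. indicator B x *\<^sub>R h x) = 0"
      by (simp add: set_lebesgue_integral_def)
  qed
  then have "AE x in M. \<forall>B\<in>\<D>. indicator B x *\<^sub>R h x = 0"
    by (subst AE_ball_countable[OF \<D>(1)]) (rule ballI)
  then show ?thesis
  proof (rule AE_mp, intro AE_I2 impI)
    fix x assume "x \<in> space M" and *: "\<forall>B\<in>\<D>. indicator B x *\<^sub>R h x = 0"
    then obtain B where "B \<in> \<D>" "x \<in> B" using \<D>(3) by blast
    then show "h x = 0" using * by force
  qed
qed

text \<open>The measurable shadow of an almost unimodular second countable group. The countable
  generator takes the place of the topology: it reduces statements about all measurable sets to
  countably many, so that they hold simultaneously outside one null set.\<close>

locale modular_group = measurable_group G M for G :: "('a, 'b) monoid_scheme" (structure) and M +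
  fixes D :: "'a \<Rightarrow> real"
  assumes left_invariant_M: "left_invariant M"
    and D_pos: "g \<in> carrier G \<Longrightarrow> 0 < D g"
    and D_mult: "\<lbrakk>g \<in> carrier G; h \<in> carrier G\<rbrakk> \<Longrightarrow> D (g \<otimes> h) = D g * D h"
    and emeasure_r_coset: "\<lbrakk>g \<in> carrier G; E \<in> sets M\<rbrakk> \<Longrightarrow>
          emeasure M (E #> g) = ennreal (D g) * emeasure M E"
    and countable_range: "countable (D ` carrier G)"
    and fiber_sets': "{g \<in> carrier G. D g = k} \<in> sets M"
    and generator: "\<exists>\<D>. countable \<D> \<and> Int_stable \<D> \<and> \<Union>\<D> = carrier G \<and>
          sets M = sigma_sets (carrier G) \<D> \<and> (\<forall>B\<in>\<D>. emeasure M B < \<infinity>)"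
begin

sublocale sigma_finite_measure M using left_invariant_M by (simp add: left_invariant_def)

sublocale MM: pair_sigma_finite M M ..

definition fiber :: "real \<Rightarrow> 'a set" where
  "fiber k = {g \<in> carrier G. D g = k}"

lemma fiber_sets [measurable]: "fiber k \<in> sets M"
  by (simp add: fiber_def fiber_sets')

lemma D_one [simp]: "D \<one> = 1"
  using D_mult[of \<one> \<one>] D_pos[of \<one>] by simp

lemma D_inv [simp]: "g \<in> carrier G \<Longrightarrow> D (inv g) = inverse (D g)"
  using D_mult[of g "inv g"] D_pos[of g] by (simp add: inverse_unique)

lemma emeasure_l_coset: "g \<in> carrier G \<Longrightarrow> E \<in> sets M \<Longrightarrow> emeasure M (g <# E) = emeasure M E"
  using left_invariant_M by (simp add: left_invariant_def)

lemma measure_l_coset: "g \<in> carrier G \<Longrightarrow> E \<in> sets M \<Longrightarrow> measure M (g <# E) = measure M E"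
  by (simp add: measure_def emeasure_l_coset)

lemma measure_r_coset: "g \<in> carrier G \<Longrightarrow> E \<in> sets M \<Longrightarrow> measure M (E #> g) = D g * measure M E"
  using D_pos[of g] by (simp add: measure_def emeasure_r_coset enn2real_mult)

text \<open>These are the test sets. On a single fiber \<open>D\<close> is constant, so inverses and all translates of
  such a set have finite measure again.\<close>

definition piece :: "'a set \<Rightarrow> real \<Rightarrow> bool" where
  "piece X x \<longleftrightarrow> X \<in> sets M \<and> X \<subseteq> fiber x \<and> emeasure M X < \<infinity>"

lemma pieceD:
  assumes "piece X x"
  shows "X \<in> sets M" "emeasure M X < \<infinity>" "X \<subseteq> carrier G" "\<And>u. u \<in> X \<Longrightarrow> D u = x"
  using assms by (auto simp: piece_def fiber_def)

lemma mem_l_coset_iff: "g \<in> carrier G \<Longrightarrow> X \<subseteq> carrier G \<Longrightarrow> u \<in> carrier G \<Longrightarrow> u \<in> g <# X \<longleftrightarrow> inv g \<otimes> u \<in> X"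
  by (simp add: l_coset_eq_vimage)

lemma mem_r_coset_iff: "g \<in> carrier G \<Longrightarrow> X \<subseteq> carrier G \<Longrightarrow> u \<in> carrier G \<Longrightarrow> u \<in> X #> g \<longleftrightarrow> u \<otimes> inv g \<in> X"
  by (simp add: r_coset_eq_vimage)

lemma piece_l_coset:
  assumes X: "piece X x" and g: "g \<in> carrier G"
  shows "piece (g <# X) (D g * x)"
proof -
  note X' = pieceD[OF X]
  have "g <# X \<subseteq> fiber (D g * x)" using X' g by (auto simp: fiber_def l_coset_def D_mult)
  then show ?thesis using X' g by (simp add: piece_def l_coset_sets emeasure_l_coset)
qed

lemma piece_r_coset:
  assumes X: "piece X x" and g: "g \<in> carrier G"
  shows "piece (X #> g) (x * D g)"
proof -
  note X' = pieceD[OF X]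
  have "X #> g \<subseteq> fiber (x * D g)" using X' g by (auto simp: fiber_def r_coset_def D_mult)
  then show ?thesis using X' g by (simp add: piece_def r_coset_sets emeasure_r_coset ennreal_mult_less_top)
qed

lemma right_translate_measure_eq:
  assumes A: "A \<in> sets M" and x: "x \<in> carrier G"
  shows "right_translate_measure M A x = ennreal (inverse (D x)) * emeasure M A"
proof -
  have "right_translate_measure M A x = (\<integral>\<^sup>+y. indicator (A #> inv x) y \<partial>M)"
    unfolding right_translate_measure_def using x sets_into_carrier[OF A]
    by (intro nn_integral_cong) (simp add: indicator_def mem_r_coset_iff space_S)
  also have "\<dots> = emeasure M (A #> inv x)" using r_coset_sets[OF inv_closed[OF x] A] by simp
  also have "\<dots> = ennreal (inverse (D x)) * emeasure M A"
    using emeasure_r_coset[OF inv_closed[OF x] A] x by simp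
  finally show ?thesis .
qed

text \<open>The exchange identity for a set \<open>A\<close> of finite positive measure computes the measure of the
  inverse, because \<open>M(A u\<^sup>-\<^sup>1)\<close> is constant for \<open>u\<close> in one fiber.\<close>

lemma piece_inv:
  assumes X: "piece X x"
  shows "piece (inv_vimage X) (inverse x)"
proof -
  note X' = pieceD[OF X]
  obtain A where A: "A \<in> sets M" "emeasure M A \<noteq> 0" "emeasure M A < \<infinity>"
    by (rule left_invariant_finite_nonnull[OF left_invariant_M])
  have "emeasure M A * emeasure M (inv_vimage X) = (\<integral>\<^sup>+u. indicator X u * right_translate_measure M A u \<partial>M)"
    using left_invariant_exchange[OF left_invariant_M left_invariant_M A(1), of "indicator X"] X'
      nn_integral_indicator_inv[OF left_invariant_M, of X] by simp
  also have "\<dots> = (\<integral>\<^sup>+u. (ennreal (inverse x) * emeasure M A) * indicator X u \<partial>M)"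
    using X' by (intro nn_integral_cong) (auto simp: indicator_def right_translate_measure_eq A space_S)
  also have "\<dots> = ennreal (inverse x) * emeasure M A * emeasure M X"
    using X' by (intro nn_integral_cmult_indicator) auto
  also have "\<dots> < \<infinity>" using A X' by (simp add: ennreal_mult_less_top)
  finally have "emeasure M (inv_vimage X) < \<infinity>"
    using A by (auto simp: ennreal_mult_less_top)
  moreover have "inv_vimage X \<subseteq> fiber (inverse x)"
  proof
    fix u assume "u \<in> inv_vimage X"
    then have u: "u \<in> carrier G" "D (inv u) = x" using X' by (auto simp: inv_vimage_def)
    then show "u \<in> fiber (inverse x)" using D_inv[of u] by (auto simp: fiber_def)
  qed
  ultimately show ?thesis using X' inv_vimage_sets by (simp add: piece_def)
qed

definition fiber_square_integrable :: "('a \<Rightarrow> complex) \<Rightarrow> bool" where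
  "fiber_square_integrable f \<longleftrightarrow> f \<in> borel_measurable M \<and>
     (\<forall>k. integrable M (\<lambda>u. indicator (fiber k) u * (cmod (f u))\<^sup>2))"

lemma fiber_square_integrable_nn_bound:
  assumes f: "fiber_square_integrable f" and E: "E \<in> sets M" "E \<subseteq> fiber k"
  shows "(\<integral>\<^sup>+u. ennreal (norm (indicator E u *\<^sub>R f u)) \<partial>M) \<le>
     ennreal (\<integral>u. indicator (fiber k) u * (cmod (f u))\<^sup>2 \<partial>M) + emeasure M E"
proof -
  have f': "f \<in> borel_measurable M" "integrable M (\<lambda>u. indicator (fiber k) u * (cmod (f u))\<^sup>2)"
    using f by (auto simp: fiber_square_integrable_def)
  note [measurable] = f'(1) E(1)
  \<comment> \<open>On a set of finite measure this bounds the first moment by the second.\<close>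
  have le: "t \<le> t\<^sup>2 + 1" for t :: real using sum_squares_bound[of t 1]
    by (cases "t \<le> 0") (auto intro: order_trans[of t 0])
  have "(\<integral>\<^sup>+u. ennreal (norm (indicator E u *\<^sub>R f u)) \<partial>M)
     \<le> (\<integral>\<^sup>+u. ennreal (indicator (fiber k) u * (cmod (f u))\<^sup>2) + indicator E u \<partial>M)"
  proof (rule nn_integral_mono)
    fix u
    have "ennreal (cmod (f u)) \<le> ennreal ((cmod (f u))\<^sup>2) + 1"
      using le[of "cmod (f u)"] by (metis ennreal_1 ennreal_leI ennreal_plus zero_le_power2 zero_le_one)
    then show "ennreal (norm (indicator E u *\<^sub>R f u)) \<le> ennreal (indicator (fiber k) u * (cmod (f u))\<^sup>2) + indicator E u"
      using E(2) by (auto simp: indicator_def)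
  qed
  also have "\<dots> = (\<integral>\<^sup>+u. ennreal (indicator (fiber k) u * (cmod (f u))\<^sup>2) \<partial>M) + (\<integral>\<^sup>+u. indicator E u \<partial>M)"
    by (rule nn_integral_add) measurable
  also have "\<dots> = ennreal (\<integral>u. indicator (fiber k) u * (cmod (f u))\<^sup>2 \<partial>M) + emeasure M E"
    using nn_integral_indicator[OF E(1)] by (subst nn_integral_eq_integral[OF f'(2)]) auto
  finally show ?thesis .
qed

lemma fiber_square_integrable_piece:
  assumes f: "fiber_square_integrable f" and E: "piece E k"
  shows "integrable M (\<lambda>u. indicator E u *\<^sub>R f u)"
proof (rule integrableI_bounded)
  show "(\<lambda>u. indicator E u *\<^sub>R f u) \<in> borel_measurable M"
    using f E by (auto simp: fiber_square_integrable_def piece_def)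
  show "(\<integral>\<^sup>+u. ennreal (norm (indicator E u *\<^sub>R f u)) \<partial>M) < \<infinity>"
    using le_less_trans[OF fiber_square_integrable_nn_bound[OF f, of E k]] E
      by (simp add: piece_def)
qed

text \<open>Fubini for averages of integrals over a measurable family of sets in one fiber.\<close>

lemma average_integrals:
  assumes f: "fiber_square_integrable f" and A: "A \<in> sets M" "emeasure M A < \<infinity>"
    and P: "{p \<in> space (M \<Otimes>\<^sub>M M). P (fst p) (snd p)} \<in> sets (M \<Otimes>\<^sub>M M)" and c: "c < \<infinity>"
    and F: "\<And>s. s \<in> A \<Longrightarrow> F s \<subseteq> fiber k \<and> F s \<in> sets M \<and> emeasure M (F s) \<le> c"
    and FP: "\<And>s u. s \<in> A \<Longrightarrow> u \<in> carrier G \<Longrightarrow> u \<in> F s \<longleftrightarrow> P s u"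
  shows "integrable M (\<lambda>s. indicator A s *\<^sub>R (\<integral>u. indicator (F s) u *\<^sub>R f u \<partial>M))"
    and "(\<integral>s. indicator A s *\<^sub>R (\<integral>u. indicator (F s) u *\<^sub>R f u \<partial>M) \<partial>M)
       = (\<integral>u. measure M {s \<in> A. P s u} *\<^sub>R f u \<partial>M)"
proof -
  define R where "R = {p \<in> space (M \<Otimes>\<^sub>M M). P (fst p) (snd p)}"
  have R: "R \<in> sets (M \<Otimes>\<^sub>M M)" using P by (simp add: R_def)
  have RP: "(s, u) \<in> R \<longleftrightarrow> P s u" if "s \<in> A" "u \<in> carrier G" for s u
    using that sets_into_carrier[OF A(1)] by (auto simp: R_def space_pair_measure space_S)
  have FR: "u \<in> F s \<longleftrightarrow> (s, u) \<in> R" if "s \<in> A" "u \<in> carrier G" for s u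
    using FP[OF that] RP[OF that] by simp
  have [measurable]: "f \<in> borel_measurable M" using f by (simp add: fiber_square_integrable_def)
  note [measurable] = A(1) R
  let ?h = "\<lambda>(s, u). indicator A s *\<^sub>R (indicator R (s, u) *\<^sub>R f u)"
  define b where "b = ennreal (\<integral>u. indicator (fiber k) u * (cmod (f u))\<^sup>2 \<partial>M) + c"
  have b: "b < \<infinity>" using c by (simp add: b_def)
  have hint: "integrable (M \<Otimes>\<^sub>M M) ?h"
  proof (rule integrableI_bounded)
    show "?h \<in> borel_measurable (M \<Otimes>\<^sub>M M)" by measurable
    have "(\<integral>\<^sup>+p. ennreal (norm (?h p)) \<partial>(M \<Otimes>\<^sub>M M)) = (\<integral>\<^sup>+s. \<integral>\<^sup>+u. ennreal (norm (?h (s, u))) \<partial>M \<partial>M)"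
      by (rule nn_integral_fst[symmetric]) measurable
    also have "\<dots> \<le> (\<integral>\<^sup>+s. b * indicator A s \<partial>M)"
    proof (rule nn_integral_mono)
      fix s assume s: "s \<in> space M"
      show "(\<integral>\<^sup>+u. ennreal (norm (?h (s, u))) \<partial>M) \<le> b * indicator A s"
      proof (cases "s \<in> A")
        case True
        have "(\<integral>\<^sup>+u. ennreal (norm (?h (s, u))) \<partial>M) = (\<integral>\<^sup>+u. ennreal (norm (indicator (F s) u *\<^sub>R f u)) \<partial>M)"
          using True FR[OF True] by (intro nn_integral_cong) (simp add: indicator_def space_S)
        also have "\<dots> \<le> ennreal (\<integral>u. indicator (fiber k) u * (cmod (f u))\<^sup>2 \<partial>M) + emeasure M (F s)"
          using F[OF True] by (intro fiber_square_integrable_nn_bound[OF f]) auto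
        also have "\<dots> \<le> b" unfolding b_def using F[OF True] by (intro add_left_mono) auto
        finally show ?thesis using True by simp
      qed simp
    qed
    also have "\<dots> = b * emeasure M A" by (rule nn_integral_cmult_indicator) measurable
    also have "\<dots> < \<infinity>" using b A by (simp add: ennreal_mult_less_top)
    finally show "(\<integral>\<^sup>+p. ennreal (norm (?h p)) \<partial>(M \<Otimes>\<^sub>M M)) < \<infinity>" .
  qed
  have inner: "(\<integral>u. ?h (s, u) \<partial>M) = indicator A s *\<^sub>R (\<integral>u. indicator (F s) u *\<^sub>R f u \<partial>M)" for s
  proof (cases "s \<in> A")
    case True
    then show ?thesis using FR[OF True] by (auto simp: indicator_def space_S intro!: Bochner_Integration.integral_cong)
  qed simp
  show "integrable M (\<lambda>s. indicator A s *\<^sub>R (\<integral>u. indicator (F s) u *\<^sub>R f u \<partial>M))"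
    using MM.integrable_fst'[OF hint] by (simp only: inner)
  have "(\<integral>s. indicator A s *\<^sub>R (\<integral>u. indicator (F s) u *\<^sub>R f u \<partial>M) \<partial>M) = (\<integral>s. \<integral>u. ?h (s, u) \<partial>M \<partial>M)"
    by (simp only: inner)
  also have "\<dots> = (\<integral>u. \<integral>s. ?h (s, u) \<partial>M \<partial>M)"
    using MM.Fubini_integral[of "\<lambda>s u. ?h (s, u)"] hint by simp
  also have "\<dots> = (\<integral>u. measure M {s \<in> A. P s u} *\<^sub>R f u \<partial>M)"
  proof (rule Bochner_Integration.integral_cong[OF refl])
    fix u assume u: "u \<in> space M"
    have "{s \<in> A. P s u} = A \<inter> {s \<in> space M. (s, u) \<in> R}"
      using sets.sets_into_space[OF A(1)] RP u by (auto simp: space_S)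
    moreover have "{s \<in> space M. (s, u) \<in> R} \<in> sets M" using u by measurable
    ultimately have meas: "{s \<in> A. P s u} \<in> sets M" by simp
    have "emeasure M {s \<in> A. P s u} \<le> emeasure M A" by (rule emeasure_mono) auto
    then have fin: "emeasure M {s \<in> A. P s u} \<noteq> \<infinity>" using A(2) by (auto simp: top_unique)
    have "(\<integral>s. ?h (s, u) \<partial>M) = (\<integral>s. indicator {s \<in> A. P s u} s *\<^sub>R f u \<partial>M)"
      using RP u by (intro Bochner_Integration.integral_cong) (auto simp: indicator_def space_S)
    also have "\<dots> = measure M {s \<in> A. P s u} *\<^sub>R f u"
      using meas fin sets.sets_into_space[OF meas]
        by (subst integral_scaleR_left) (auto simp: Int_absorb2 less_top)
    finally show "(\<integral>s. ?h (s, u) \<partial>M) = measure M {s \<in> A. P s u} *\<^sub>R f u" .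
  qed
  finally show "(\<integral>s. indicator A s *\<^sub>R (\<integral>u. indicator (F s) u *\<^sub>R f u \<partial>M) \<partial>M)
       = (\<integral>u. measure M {s \<in> A. P s u} *\<^sub>R f u \<partial>M)" .
qed


text \<open>Countably many translates of the kernel cover the group.\<close>

lemma fiber_one_not_null: "emeasure M (fiber 1) \<noteq> 0"
proof
  assume 0: "emeasure M (fiber 1) = 0"
  have "fiber k \<in> null_sets M" if k: "k \<in> D ` carrier G" for k
  proof -
    obtain g where g: "g \<in> carrier G" "k = D g" using k by blast
    have "fiber k = g <# fiber 1"
    proof (rule Set.set_eqI)
      fix u show "u \<in> fiber k \<longleftrightarrow> u \<in> g <# fiber 1"
      proof (cases "u \<in> carrier G")
        case True
        then show ?thesis using g D_pos[OF g(1)]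
          by (subst mem_l_coset_iff) (auto simp: fiber_def D_mult field_simps)
      qed (use g in \<open>auto simp: fiber_def l_coset_def\<close>)
    qed
    then show ?thesis using emeasure_l_coset[OF g(1), of "fiber 1"] 0 l_coset_sets[OF g(1), of "fiber 1"] by (simp add: null_setsI)
  qed
  then have "(\<Union>k\<in>D ` carrier G. fiber k) \<in> null_sets M"
    using countable_range by (intro null_sets_UN') auto
  also have "(\<Union>k\<in>D ` carrier G. fiber k) = carrier G" by (auto simp: fiber_def)
  finally show False using left_invariant_M by (simp add: left_invariant_def null_sets_def)
qed

end

text \<open>Think of \<open>E X Z\<close> as \<open>\<langle>n 1\<^sub>X, 1\<^sub>Z\<rangle>\<close> for an operator \<open>n\<close> commuting with the left and right
  regular representations; \<open>V X\<close> and the conjugate of \<open>W Z\<close> are then the functions \<open>n 1\<^sub>X\<close> and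
  \<open>n\<^sup>* 1\<^sub>Z\<close>. Averages of \<open>E\<close> over translates by \<open>s \<in> Y\<close> can be rewritten by left
    and right invariance
  in two ways, which shows that the trilinear form
  \<open>Q X Y Z = \<integral>\<^sub>Y E X (Z s) ds\<close> is invariant under the rotation \<open>(X, Y, Z) \<mapsto> (Y\<^sup>-\<^sup>1, Z, X\<^sup>-\<^sup>1)\<close> up to a
  factor determined by the modular function. The rotation has order three and its three factors
  multiply to \<open>x / (y z)\<close>, so \<open>Q\<close> vanishes unless \<open>Z s\<close> lies in the same fiber as \<open>X\<close>.\<close>

locale invariant_bimeasure = modular_group +
  fixes E :: "'a set \<Rightarrow> 'a set \<Rightarrow> complex" and V W :: "'a set \<Rightarrow> 'a \<Rightarrow> complex"
  assumes V: "piece X x \<Longrightarrow> fiber_square_integrable (V X)"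
    and W: "piece Z z \<Longrightarrow> fiber_square_integrable (W Z)"
    and EV: "\<lbrakk>piece X x; piece Z z\<rbrakk> \<Longrightarrow> E X Z = (\<integral>u. indicator Z u *\<^sub>R V X u \<partial>M)"
    and EW: "\<lbrakk>piece X x; piece Z z\<rbrakk> \<Longrightarrow> E X Z = (\<integral>u. indicator X u *\<^sub>R W Z u \<partial>M)"
    and left: "\<lbrakk>piece X x; piece Z z; g \<in> carrier G\<rbrakk> \<Longrightarrow> E (g <# X) (g <# Z) = E X Z"
    and right: "\<lbrakk>piece X x; piece Z z; g \<in> carrier G\<rbrakk> \<Longrightarrow> E (X #> g) (Z #> g) = D g * E X Z"
begin

definition Q :: "'a set \<Rightarrow> 'a set \<Rightarrow> 'a set \<Rightarrow> complex" where
  "Q X Y Z = (\<integral>s. indicator Y s *\<^sub>R E X (Z #> s) \<partial>M)"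

lemma pred_sets_pair:
  assumes f: "(\<lambda>p. f (fst p) (snd p)) \<in> M \<Otimes>\<^sub>M M \<rightarrow>\<^sub>M M" and X: "X \<in> sets M"
  shows "{p \<in> space (M \<Otimes>\<^sub>M M). f (fst p) (snd p) \<in> X} \<in> sets (M \<Otimes>\<^sub>M M)"
  using measurable_sets[OF f X] by (simp add: vimage_def Int_def conj_commute)

lemma coset_integral:
  assumes X: "piece X x" and Y: "piece Y y" and Z: "piece Z z"
  shows "integrable M (\<lambda>s. indicator Y s *\<^sub>R E X (Z #> s))" 
    and "Q X Y Z = (\<integral>u. measure M {s \<in> Y. u \<otimes> inv s \<in> Z} *\<^sub>R V X u \<partial>M)"
proof -
  note Y' = pieceD[OF Y] and Z' = pieceD[OF Z]
  have R: "{p \<in> space (M \<Otimes>\<^sub>M M). snd p \<otimes> inv (fst p) \<in> Z} \<in> sets (M \<Otimes>\<^sub>M M)"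
    by (rule pred_sets_pair[OF _ Z'(1)]) measurable
  have F: "Z #> s \<subseteq> fiber (z * y) \<and> Z #> s \<in> sets M \<and> emeasure M (Z #> s) \<le> ennreal y * emeasure M Z"
    if "s \<in> Y" for s
    using piece_r_coset[OF Z, of s] that Y' emeasure_r_coset[of s Z] Z'
      by (auto simp: piece_def subset_iff)
  have FP: "u \<in> Z #> s \<longleftrightarrow> u \<otimes> inv s \<in> Z" if "s \<in> Y" "u \<in> carrier G" for s u
    using that Y' Z' by (subst mem_r_coset_iff) auto
  have c: "ennreal y * emeasure M Z < \<infinity>" using Z' by (simp add: ennreal_mult_less_top)
  note avg = average_integrals[where P = "\<lambda>s u. u \<otimes> inv s \<in> Z", OF V[OF X] Y'(1,2) R c F FP]
  have eq: "indicator Y s *\<^sub>R E X (Z #> s) = indicator Y s *\<^sub>R (\<integral>u. indicator (Z #> s) u *\<^sub>R V X u \<partial>M)" for s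
    using EV[OF X piece_r_coset[OF Z, of s]] Y' by (auto simp: indicator_def)
  show "integrable M (\<lambda>s. indicator Y s *\<^sub>R E X (Z #> s))" unfolding eq by (rule avg(1))
  show "Q X Y Z = (\<integral>u. measure M {s \<in> Y. u \<otimes> inv s \<in> Z} *\<^sub>R V X u \<partial>M)"
    unfolding Q_def eq by (rule avg(2))
qed

text \<open>Right invariance moves the translation by \<open>s\<close> from \<open>Z\<close> to \<open>X\<close>.\<close>

lemma Q_right:
  assumes X: "piece X x" and Y: "piece Y y" and Z: "piece Z z"
  shows "Q X Y Z = y * (\<integral>u. measure M {s \<in> Y. u \<otimes> s \<in> X} *\<^sub>R W Z u \<partial>M)"
proof -
  note X' = pieceD[OF X] and Y' = pieceD[OF Y]
  have R: "{p \<in> space (M \<Otimes>\<^sub>M M). snd p \<otimes> fst p \<in> X} \<in> sets (M \<Otimes>\<^sub>M M)"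
    by (rule pred_sets_pair[OF _ X'(1)]) measurable
  have F: "X #> inv s \<subseteq> fiber (x * inverse y) \<and> X #> inv s \<in> sets M \<and>
      emeasure M (X #> inv s) \<le> ennreal (inverse y) * emeasure M X" if "s \<in> Y" for s
    using piece_r_coset[OF X, of "inv s"] that Y' emeasure_r_coset[of "inv s" X] X'
      by (auto simp: piece_def subset_iff)
  have FP: "u \<in> X #> inv s \<longleftrightarrow> u \<otimes> s \<in> X" if "s \<in> Y" "u \<in> carrier G" for s u
    using that Y' X' by (subst mem_r_coset_iff) auto
  have c: "ennreal (inverse y) * emeasure M X < \<infinity>" using X' by (simp add: ennreal_mult_less_top)
  note avg = average_integrals[where P = "\<lambda>s u. u \<otimes> s \<in> X", OF W[OF Z] Y'(1,2) R c F FP]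
  have eq: "indicator Y s *\<^sub>R E X (Z #> s) = y * (indicator Y s *\<^sub>R (\<integral>u. indicator (X #> inv s) u *\<^sub>R W Z u \<partial>M))" for s
  proof (cases "s \<in> Y")
    case True
    then have s: "s \<in> carrier G" "D s = y" using Y' by auto
    have "X #> inv s #> s = X" using s X' by (simp add: coset_mult_assoc coset_mult_one)
    then have "E X (Z #> s) = y * E (X #> inv s) Z"
      using right[OF piece_r_coset[OF X inv_closed[OF s(1)]] Z s(1)] s by simp
    then show ?thesis using EW[OF piece_r_coset[OF X inv_closed[OF s(1)]] Z] by simp
  qed simp
  have "Q X Y Z = y * (\<integral>s. indicator Y s *\<^sub>R (\<integral>u. indicator (X #> inv s) u *\<^sub>R W Z u \<partial>M) \<partial>M)"
    unfolding Q_def eq by (rule integral_mult_right_zero)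
  then show ?thesis by (simp only: avg(2))
qed

text \<open>The average of translates of \<open>X\<close> in the previous formula is also the average of the left
  translates \<open>s Y\<^sup>-\<^sup>1\<close> over \<open>s \<in> X\<close>, and left invariance moves these translations to \<open>Z\<close>.\<close>

lemma Q_left:
  assumes X: "piece X x" and Y: "piece Y y" and Z: "piece Z z"
  shows "Q X Y Z = y * (\<integral>u. measure M {s \<in> X. s \<otimes> u \<in> Z} *\<^sub>R V (inv_vimage Y) u \<partial>M)"
proof -
  note X' = pieceD[OF X] and Y' = pieceD[OF Y] and Z' = pieceD[OF Z]
  let ?Y = "inv_vimage Y"
  note pY = piece_inv[OF Y] and pY' = pieceD[OF piece_inv[OF Y]]
  have R: "{p \<in> space (M \<Otimes>\<^sub>M M). inv (snd p) \<otimes> fst p \<in> Y} \<in> sets (M \<Otimes>\<^sub>M M)"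
    by (rule pred_sets_pair[OF _ Y'(1)]) measurable
  have F: "s <# ?Y \<subseteq> fiber (x * inverse y) \<and> s <# ?Y \<in> sets M \<and> emeasure M (s <# ?Y) \<le> emeasure M ?Y"
    if "s \<in> X" for s
    using piece_l_coset[OF pY, of s] that X' emeasure_l_coset[of s ?Y] pY'
      by (auto simp: piece_def subset_iff)
  have FP: "u \<in> s <# ?Y \<longleftrightarrow> inv u \<otimes> s \<in> Y" if "s \<in> X" "u \<in> carrier G" for s u
    using that X' pY' by (subst mem_l_coset_iff) (auto simp: subset_iff inv_vimage_def inv_mult_group)
  note avg = average_integrals[where P = "\<lambda>s u. inv u \<otimes> s \<in> Y", OF W[OF Z] X'(1,2) R _ F FP]
  have R2: "{p \<in> space (M \<Otimes>\<^sub>M M). fst p \<otimes> snd p \<in> Z} \<in> sets (M \<Otimes>\<^sub>M M)"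
    by (rule pred_sets_pair[OF _ Z'(1)]) measurable
  have F2: "inv s <# Z \<subseteq> fiber (inverse x * z) \<and> inv s <# Z \<in> sets M \<and> emeasure M (inv s <# Z) \<le> emeasure M Z"
    if "s \<in> X" for s
    using piece_l_coset[OF Z, of "inv s"] that X' emeasure_l_coset[of "inv s" Z] Z'
      by (auto simp: piece_def subset_iff)
  have FP2: "u \<in> inv s <# Z \<longleftrightarrow> s \<otimes> u \<in> Z" if "s \<in> X" "u \<in> carrier G" for s u
    using that X' Z' by (subst mem_l_coset_iff) auto
  note avg2 = average_integrals[where P = "\<lambda>s u. s \<otimes> u \<in> Z", OF V[OF pY] X'(1,2) R2 _ F2 FP2]
  have "(\<integral>u. measure M {s \<in> Y. u \<otimes> s \<in> X} *\<^sub>R W Z u \<partial>M) = (\<integral>u. measure M {s \<in> X. inv u \<otimes> s \<in> Y} *\<^sub>R W Z u \<partial>M)"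
  proof (rule Bochner_Integration.integral_cong[OF refl])
    fix u assume "u \<in> space M"
    then have u: "u \<in> carrier G" by (simp add: space_S)
    have "{s \<in> X. inv u \<otimes> s \<in> Y} = u <# {s \<in> Y. u \<otimes> s \<in> X}"
    proof (rule Set.set_eqI)
      fix s show "s \<in> {s \<in> X. inv u \<otimes> s \<in> Y} \<longleftrightarrow> s \<in> u <# {s \<in> Y. u \<otimes> s \<in> X}"
      proof (cases "s \<in> carrier G")
        case True
        then show ?thesis using u Y' by (subst mem_l_coset_iff) (auto simp: m_assoc[symmetric])
      qed (use X' Y' u in \<open>auto simp: l_coset_def\<close>)
    qed
    moreover have "{s \<in> Y. u \<otimes> s \<in> X} = Y \<inter> (inv u <# X)"
      using u X' Y' mem_l_coset_iff[of "inv u" X] by (auto simp: subset_iff)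
    then have "{s \<in> Y. u \<otimes> s \<in> X} \<in> sets M" using l_coset_sets[of "inv u" X] u X' Y' by simp
    ultimately have "measure M {s \<in> X. inv u \<otimes> s \<in> Y} = measure M {s \<in> Y. u \<otimes> s \<in> X}"
      using measure_l_coset[OF u] by simp
    then show "measure M {s \<in> Y. u \<otimes> s \<in> X} *\<^sub>R W Z u = measure M {s \<in> X. inv u \<otimes> s \<in> Y} *\<^sub>R W Z u"
      by simp
  qed
  also have "\<dots> = (\<integral>s. indicator X s *\<^sub>R (\<integral>u. indicator (s <# ?Y) u *\<^sub>R W Z u \<partial>M) \<partial>M)"
    by (rule avg(2)[symmetric]) (use pY' in auto)
  also have "\<dots> = (\<integral>s. indicator X s *\<^sub>R (\<integral>u. indicator (inv s <# Z) u *\<^sub>R V ?Y u \<partial>M) \<partial>M)"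
  proof (rule Bochner_Integration.integral_cong[OF refl])
    fix s
    show "indicator X s *\<^sub>R (\<integral>u. indicator (s <# ?Y) u *\<^sub>R W Z u \<partial>M) = indicator X s *\<^sub>R (\<integral>u. indicator (inv s <# Z) u *\<^sub>R V ?Y u \<partial>M)"
    proof (cases "s \<in> X")
      case True
      then have s: "s \<in> carrier G" using X' by auto
      have "inv s <# (s <# ?Y) = ?Y" using s pY' by (simp add: lcos_m_assoc lcos_mult_one)
      then have "E (s <# ?Y) Z = E ?Y (inv s <# Z)"
        using left[OF piece_l_coset[OF pY s] Z inv_closed[OF s]] by simp
      then show ?thesis using EW[OF piece_l_coset[OF pY s] Z] EV[OF pY piece_l_coset[OF Z inv_closed[OF s]]] by simp
    qed simp
  qed
  also have "\<dots> = (\<integral>u. measure M {s \<in> X. s \<otimes> u \<in> Z} *\<^sub>R V ?Y u \<partial>M)"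
    by (rule avg2(2)) (use Z' in auto)
  finally show ?thesis using Q_right[OF X Y Z] by simp
qed

text \<open>Both \<open>Q\<close> are integrals of the same function \<open>V Y\<^sup>-\<^sup>1\<close> against measures of sets that are right
  translates by \<open>u\<close> of each other; where these sets are nonempty, \<open>D u = z / x\<close>.\<close>

lemma Q_rotate:
  assumes X: "piece X x" and Y: "piece Y y" and Z: "piece Z z" and pos: "x > 0" "y > 0" "z > 0"
  shows "Q X Y Z = of_real (x * y / z) * Q (inv_vimage Y) Z (inv_vimage X)"
proof -
  note X' = pieceD[OF X] and Y' = pieceD[OF Y] and Z' = pieceD[OF Z]
  let ?f = "V (inv_vimage Y)"
  have eq: "measure M {t \<in> Z. u \<otimes> inv t \<in> inv_vimage X} *\<^sub>R ?f u = (z / x) *\<^sub>R (measure M {s \<in> X. s \<otimes> u \<in> Z} *\<^sub>R ?f u)"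
    if u: "u \<in> carrier G" for u
  proof -
    let ?A = "{s \<in> X. s \<otimes> u \<in> Z}"
    have "{t \<in> Z. u \<otimes> inv t \<in> inv_vimage X} = ?A #> u"
    proof (rule Set.set_eqI)
      fix s show "s \<in> {t \<in> Z. u \<otimes> inv t \<in> inv_vimage X} \<longleftrightarrow> s \<in> ?A #> u"
      proof (cases "s \<in> carrier G")
        case True
        then show ?thesis using u X'
          by (subst mem_r_coset_iff) (auto simp: inv_vimage_def m_assoc inv_mult_group)
      qed (use X' Z' u in \<open>auto simp: r_coset_def\<close>)
    qed
    moreover have "?A = X \<inter> (Z #> inv u)"
      using u X' Z' mem_r_coset_iff[of "inv u" Z] by (auto simp: subset_iff)
    then have "?A \<in> sets M" using r_coset_sets[of "inv u" Z] u X' Z' by simp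
    ultimately have m: "measure M {t \<in> Z. u \<otimes> inv t \<in> inv_vimage X} = D u * measure M ?A"
      using measure_r_coset[OF u] by simp
    show ?thesis
    proof (cases "?A = {}")
      case True
      then show ?thesis using m unfolding True by simp
    next
      case False
      then obtain s where "s \<in> X" "s \<otimes> u \<in> Z" by blast
      then have "D s = x" "D (s \<otimes> u) = z" "s \<in> carrier G" using X' Z' by auto
      then have "x * D u = z" using D_mult[of s u] u by simp
      then have "D u = z / x" using pos by (auto simp: field_simps)
      then show ?thesis using m by simp
    qed
  qed
  have "Q (inv_vimage Y) Z (inv_vimage X) = (\<integral>u. (z / x) *\<^sub>R (measure M {s \<in> X. s \<otimes> u \<in> Z} *\<^sub>R ?f u) \<partial>M)"
    unfolding coset_integral(2)[OF piece_inv[OF Y] Z piece_inv[OF X]]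
    by (intro Bochner_Integration.integral_cong) (auto simp: eq space_S)
  also have "\<dots> = of_real (z / x) * (\<integral>u. measure M {s \<in> X. s \<otimes> u \<in> Z} *\<^sub>R ?f u \<partial>M)"
    by (simp add: scaleR_conv_of_real)
  finally show ?thesis using Q_left[OF X Y Z] pos by simp
qed

text \<open>Three rotations return to \<open>Q X Y Z\<close> with the factor \<open>x / (y z)\<close>.\<close>

lemma Q_eq_0:
  assumes X: "piece X x" and Y: "piece Y y" and Z: "piece Z z" and pos: "x > 0" "y > 0" "z > 0"
    and ne: "x \<noteq> y * z"
  shows "Q X Y Z = 0"
proof -
  have Xs: "X \<in> sets M" "Y \<in> sets M" "Z \<in> sets M" using X Y Z by (auto simp: piece_def)
  have "Q X Y Z = of_real (x * y / z) * Q (inv_vimage Y) Z (inv_vimage X)"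
    by (rule Q_rotate[OF X Y Z pos])
  also have "Q (inv_vimage Y) Z (inv_vimage X) = of_real (inverse y * z / inverse x) * Q (inv_vimage Z) (inv_vimage X) Y"
    using Q_rotate[OF piece_inv[OF Y] Z piece_inv[OF X]] pos by (simp add: inv_vimage_inv_vimage Xs)
  also have "Q (inv_vimage Z) (inv_vimage X) Y = of_real (inverse z * inverse x / y) * Q X Y Z"
    using Q_rotate[OF piece_inv[OF Z] piece_inv[OF X] Y] pos by (simp add: inv_vimage_inv_vimage Xs)
  finally have "Q X Y Z = of_real ((x * y / z) * (inverse y * z / inverse x) * (inverse z * inverse x / y)) * Q X Y Z"
    by (unfold of_real_mult mult.assoc)
  also have "(x * y / z) * (inverse y * z / inverse x) * (inverse z * inverse x / y) = x / (y * z)"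
    using pos by (simp add: field_simps)
  finally have Q_eq: "Q X Y Z = of_real (x / (y * z)) * Q X Y Z" .
  have "of_real (x / (y * z)) \<noteq> (1 :: complex)"
    using ne pos by (simp only: of_real_eq_1_iff) (simp add: field_simps)
  moreover have "c = 1 \<or> q = 0" if "q = c * q" for c q :: complex using that by auto
  ultimately show ?thesis using Q_eq by blast
qed

text \<open>The averages over \<open>s\<close> in the kernel vanish, so some single \<open>s\<close> works for the countably many
  sets \<open>Z\<close> of a generator; translating by this \<open>s\<close> proves the claim.\<close>

theorem bimeasure_diagonal:
  assumes X: "piece X x" and Z: "piece Z z" and ne: "x \<noteq> z"
  shows "E X Z = 0"
proof (cases "X = {} \<or> Z = {}")
  case True
  then show ?thesis using EV[OF X Z] EW[OF X Z] by auto
next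
  case False
  then obtain a b where ab: "a \<in> X" "b \<in> Z" by blast
  then have pos: "x > 0" "z > 0" using D_pos[of a] D_pos[of b] pieceD(3,4)[OF X] pieceD(3,4)[OF Z]
    by auto
  obtain \<D> where \<D>: "countable \<D>" "Int_stable \<D>" "\<Union>\<D> = space M" "sets M = sigma_sets (space M) \<D>"
    and \<D>fin: "\<And>B. B \<in> \<D> \<Longrightarrow> emeasure M B < \<infinity>"
    by (rule exE[OF generator[folded space_S]]) (elim conjE, metis)
  have \<D>sets: "B \<in> sets M" if "B \<in> \<D>" for B using that by (simp add: \<D>(4) sigma_sets.Basic)
  have pB: "piece (B \<inter> fiber k) k" if "B \<in> \<D>" for B k
  proof -
    have "emeasure M (B \<inter> fiber k) \<le> emeasure M B" using \<D>sets[OF that]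
      by (intro emeasure_mono) auto
    then show ?thesis using \<D>sets[OF that] \<D>fin[OF that] by (auto simp: piece_def)
  qed
  have ae: "AE s in M. s \<in> fiber 1 \<longrightarrow> E X ((B \<inter> fiber z) #> s) = 0" if B: "B \<in> \<D>" for B
  proof -
    have "AE s in M. indicator (C \<inter> fiber 1) s *\<^sub>R E X ((B \<inter> fiber z) #> s) = 0" if C: "C \<in> \<D>" for C
    proof (rule density_zero[OF coset_integral(1)[OF X pB[OF C] pB[OF B]]])
      fix A assume A: "A \<in> sets M"
      have "emeasure M (A \<inter> (C \<inter> fiber 1)) \<le> emeasure M (C \<inter> fiber 1)" using pB[OF C, of 1]
        by (intro emeasure_mono) (auto simp: piece_def)
      then have "piece (A \<inter> (C \<inter> fiber 1)) 1" using pB[OF C, of 1] A by (auto simp: piece_def)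
      from Q_eq_0[OF X this pB[OF B, of z]] pos ne have "Q X (A \<inter> (C \<inter> fiber 1)) (B \<inter> fiber z) = 0"
        by simp
      then show "set_lebesgue_integral M A (\<lambda>s. indicator (C \<inter> fiber 1) s *\<^sub>R E X ((B \<inter> fiber z) #> s)) = 0"
        by (simp add: Q_def set_lebesgue_integral_def indicator_inter_arith mult.assoc)
    qed
    then have "AE s in M. \<forall>C\<in>\<D>. indicator (C \<inter> fiber 1) s *\<^sub>R E X ((B \<inter> fiber z) #> s) = 0"
      by (subst AE_ball_countable[OF \<D>(1)]) (rule ballI)
    then show ?thesis
    proof (rule AE_mp, intro AE_I2 impI)
      fix s assume s: "s \<in> space M" "s \<in> fiber 1"
        and *: "\<forall>C\<in>\<D>. indicator (C \<inter> fiber 1) s *\<^sub>R E X ((B \<inter> fiber z) #> s) = 0"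
      obtain C where "C \<in> \<D>" "s \<in> C" using s \<D>(3) by blast
      then show "E X ((B \<inter> fiber z) #> s) = 0" using * s by force
    qed
  qed
  then have "AE s in M. \<forall>B\<in>\<D>. s \<in> fiber 1 \<longrightarrow> E X ((B \<inter> fiber z) #> s) = 0"
    by (subst AE_ball_countable[OF \<D>(1)]) (rule ballI)
  then obtain N where N: "{s \<in> space M. \<not> (\<forall>B\<in>\<D>. s \<in> fiber 1 \<longrightarrow> E X ((B \<inter> fiber z) #> s) = 0)} \<subseteq> N" "N \<in> null_sets M"
    by (auto elim!: AE_E)
  have "\<not> fiber 1 \<subseteq> N"
    using fiber_one_not_null null_sets_subset[OF N(2), of "fiber 1"] by (auto simp: null_sets_def)
  then obtain s where s: "s \<in> fiber 1" "s \<notin> N" by blast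
  then have sG: "s \<in> carrier G" "D s = 1" by (auto simp: fiber_def)
  have s0: "E X ((B \<inter> fiber z) #> s) = 0" if "B \<in> \<D>" for B using N(1) s sG that
    by (auto simp: space_S)
  let ?X = "X #> inv s"
  have pX: "piece ?X x" using piece_r_coset[OF X, of "inv s"] sG by simp
  have shift: "E X (Z' #> s) = E ?X Z'" if "piece Z' z'" for Z' z'
  proof -
    have "?X #> s = X" using sG pieceD(3)[OF X] by (simp add: coset_mult_assoc coset_mult_one)
    then show ?thesis using right[OF pX that sG(1)] sG by simp
  qed
  note V' = V[OF pX]
  have [measurable]: "V ?X \<in> borel_measurable M" using V' by (simp add: fiber_square_integrable_def)
  have "AE u in M. indicator (fiber z) u *\<^sub>R V ?X u = 0"
  proof (rule AE_zero_of_generator[OF \<D>])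
    fix B assume B: "B \<in> \<D>"
    show "integrable M (\<lambda>u. indicator B u *\<^sub>R (indicator (fiber z) u *\<^sub>R V ?X u))"
      using fiber_square_integrable_piece[OF V' pB[OF B, of z]] by (simp add: indicator_inter_arith)
    show "(\<integral>u. indicator B u *\<^sub>R (indicator (fiber z) u *\<^sub>R V ?X u) \<partial>M) = 0"
      using EV[OF pX pB[OF B, of z]] s0[OF B] shift[OF pB[OF B, of z]]
        by (simp add: indicator_inter_arith)
  qed
  then have zero: "E ?X Z' = 0" if Z': "piece Z' z" for Z'
  proof -
    have "E ?X Z' = (\<integral>u. 0 \<partial>M)"
      unfolding EV[OF pX Z']
    proof (rule integral_cong_AE)
      show "(\<lambda>u. indicator Z' u *\<^sub>R V ?X u) \<in> borel_measurable M" using Z' by (auto simp: piece_def)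
      show "AE u in M. indicator Z' u *\<^sub>R V ?X u = 0"
        using \<open>AE u in M. indicator (fiber z) u *\<^sub>R V ?X u = 0\<close>
        by eventually_elim (use Z' in \<open>auto simp: piece_def indicator_def split: if_splits\<close>)
    qed simp
    then show ?thesis by simp
  qed
  have "E X Z = E X ((Z #> inv s) #> s)"
    using sG pieceD(3)[OF Z] by (simp add: coset_mult_assoc coset_mult_one)
  also have "\<dots> = 0" using piece_r_coset[OF Z, of "inv s"] sG zero shift by simp
  finally show ?thesis .
qed

end

section \<open>Haar measures of second countable groups\<close>

text \<open>By local compactness, the basic open sets of finite measure are still a basis; close them
  under finite intersections.\<close>

lemma topology_generator:
  assumes lc: "locally_compact_space T" and haus: "Hausdorff_space T" and sc: "second_countable T"
    and sets: "sets \<mu> = sigma_sets (topspace T) {U. openin T U}"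
    and fin: "\<And>C. compactin T C \<Longrightarrow> emeasure \<mu> C < \<infinity>"
  obtains \<D> where "countable \<D>" "Int_stable \<D>" "\<Union>\<D> = topspace T"
    "sets \<mu> = sigma_sets (topspace T) \<D>" "\<forall>B\<in>\<D>. emeasure \<mu> B < \<infinity>"
proof -
  obtain \<B> where \<B>: "countable \<B>" "\<And>V. V \<in> \<B> \<Longrightarrow> openin T V"
    "\<And>U x. openin T U \<Longrightarrow> x \<in> U \<Longrightarrow> \<exists>V\<in>\<B>. x \<in> V \<and> V \<subseteq> U"
    using sc unfolding second_countable_def by metis
  define \<D>\<^sub>0 where "\<D>\<^sub>0 = {V \<in> \<B>. emeasure \<mu> V < \<infinity>}"
  define \<D> where "\<D> = Inter ` {F. finite F \<and> F \<subseteq> \<D>\<^sub>0 \<and> F \<noteq> {}}"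
  have open_sets: "U \<in> sets \<mu>" if "openin T U" for U using that by (simp add: sets sigma_sets.Basic)
  have compact_sets: "C \<in> sets \<mu>" if "compactin T C" for C
  proof -
    have "closedin T C" using compactin_imp_closedin[OF haus that] .
    then have "openin T (topspace T - C)" "C \<subseteq> topspace T" by (auto simp: closedin_def)
    then have "topspace T - (topspace T - C) \<in> sets \<mu>" unfolding sets
      by (intro sigma_sets.Compl sigma_sets.Basic) simp
    also have "topspace T - (topspace T - C) = C" using \<open>C \<subseteq> topspace T\<close> by blast
    finally show ?thesis .
  qed
  have base: "\<exists>V\<in>\<D>\<^sub>0. x \<in> V \<and> V \<subseteq> U" if U: "openin T U" "x \<in> U" for U x
  proof -
    have "x \<in> topspace T" using U openin_subset by blast
    then obtain W C where W: "openin T W" "compactin T C" "x \<in> W" "W \<subseteq> C"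
      using lc unfolding locally_compact_space_def by blast
    obtain V where V: "V \<in> \<B>" "x \<in> V" "V \<subseteq> U \<inter> W"
      using \<B>(3)[of "U \<inter> W" x] U W by auto
    have "emeasure \<mu> V \<le> emeasure \<mu> C" using V W compact_sets by (intro emeasure_mono) auto
    then have "V \<in> \<D>\<^sub>0" using V fin[OF W(2)] by (auto simp: \<D>\<^sub>0_def)
    then show ?thesis using V by blast
  qed
  have \<D>\<^sub>0_sub: "\<D>\<^sub>0 \<subseteq> \<D>" unfolding \<D>_def by (force intro!: image_eqI[of _ _ "{x}" for x])
  have \<D>_open: "openin T B" if "B \<in> \<D>" for B
    using that \<B>(2) unfolding \<D>_def \<D>\<^sub>0_def by (auto intro!: openin_Inter)
  show ?thesis
  proof (rule that)
    have "countable \<D>\<^sub>0" using \<B>(1) by (simp add: \<D>\<^sub>0_def)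
    then have "countable {F. finite F \<and> F \<subseteq> \<D>\<^sub>0}" by (rule countable_Collect_finite_subset)
    then show "countable \<D>" unfolding \<D>_def
      by (intro countable_image) (auto elim: countable_subset[rotated])
    show "Int_stable \<D>"
      unfolding Int_stable_def
    proof (intro ballI)
      fix a b assume "a \<in> \<D>" "b \<in> \<D>"
      then obtain F F' where F: "finite F" "F \<subseteq> \<D>\<^sub>0" "F \<noteq> {}" "a = \<Inter>F" "finite F'" "F' \<subseteq> \<D>\<^sub>0" "F' \<noteq> {}" "b = \<Inter>F'"
        by (auto simp: \<D>_def)
      then have "a \<inter> b = \<Inter>(F \<union> F')" by auto
      then show "a \<inter> b \<in> \<D>" unfolding \<D>_def using F by (intro image_eqI[of _ _ "F \<union> F'"]) auto
    qed
    show "\<Union>\<D> = topspace T"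
    proof (rule subset_antisym)
      show "\<Union>\<D> \<subseteq> topspace T" using \<D>_open openin_subset by blast
      show "topspace T \<subseteq> \<Union>\<D>" using base[OF openin_topspace] \<D>\<^sub>0_sub by blast
    qed
    show "sets \<mu> = sigma_sets (topspace T) \<D>"
      unfolding sets
    proof (rule sigma_sets_eqI)
      fix U assume U: "U \<in> {U. openin T U}"
      have "(\<Union>{V \<in> \<D>\<^sub>0. V \<subseteq> U}) \<in> sigma_sets (topspace T) \<D>"
      proof (rule sigma_sets_UNION)
        show "countable {V \<in> \<D>\<^sub>0. V \<subseteq> U}" using \<open>countable \<D>\<^sub>0\<close> by simp
      qed (use \<D>\<^sub>0_sub in \<open>auto intro: sigma_sets.Basic\<close>)
      also have "\<Union>{V \<in> \<D>\<^sub>0. V \<subseteq> U} = U" using base[of U] U by blast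
      finally show "U \<in> sigma_sets (topspace T) \<D>" .
    qed (use \<D>_open in \<open>auto intro: sigma_sets.Basic\<close>)
    show "\<forall>B\<in>\<D>. emeasure \<mu> B < \<infinity>"
    proof
      fix B assume B: "B \<in> \<D>"
      then obtain F V where F: "F \<subseteq> \<D>\<^sub>0" "B = \<Inter>F" "V \<in> F" by (auto simp: \<D>_def)
      then have "emeasure \<mu> B \<le> emeasure \<mu> V" using \<B>(2)
        by (intro emeasure_mono open_sets) (auto simp: \<D>\<^sub>0_def)
      then show "emeasure \<mu> B < \<infinity>" using F by (auto simp: \<D>\<^sub>0_def)
    qed
  qed
qed

lemma sigma_finite_of_generator:
  assumes "countable \<D>" "\<Union>\<D> = space \<mu>" "sets \<mu> = sigma_sets (space \<mu>) \<D>" "\<And>B. B \<in> \<D> \<Longrightarrow> emeasure \<mu> B < \<infinity>"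
  shows "sigma_finite_measure \<mu>"
proof
  show "\<exists>A. countable A \<and> A \<subseteq> sets \<mu> \<and> \<Union>A = space \<mu> \<and> (\<forall>a\<in>A. emeasure \<mu> a \<noteq> \<infinity>)"
    using assms by (intro exI[of _ \<D>]) (auto simp: less_top[symmetric] sigma_sets.Basic)
qed

lemma borel_space_eq:
  assumes "sets \<mu> = sigma_sets (topspace T) {U. openin T U}"
  shows "space \<mu> = topspace T"
proof -
  have "{U. openin T U} \<subseteq> Pow (topspace T)" using openin_subset by blast
  then have "sets \<mu> = sets (sigma (topspace T) {U. openin T U})" using assms by simp
  from sets_eq_imp_space_eq[OF this] show ?thesis using openin_subset
    by (subst (asm) space_measure_of) auto
qed

text \<open>By second countability, open sets of the product topology are measurable for the product
  \<open>\<sigma>\<close>-algebra, so the multiplication is jointly measurable.\<close>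

lemma measurable_group_borel:
  assumes tg: "topological_group G T" and sc: "second_countable T"
    and sets: "sets S = sigma_sets (topspace T) {U. openin T U}"
  shows "measurable_group G S"
proof -
  interpret group G using tg by (simp add: topological_group_def)
  have top: "topspace T = carrier G" using tg by (simp add: topological_group_def)
  have sp: "space S = topspace T" by (rule borel_space_eq[OF sets])
  have Pow: "{U. openin T U} \<subseteq> Pow (topspace T)" using openin_subset by blast
  obtain \<B> where \<B>: "countable \<B>" "\<And>V. V \<in> \<B> \<Longrightarrow> openin T V"
    "\<And>U x. openin T U \<Longrightarrow> x \<in> U \<Longrightarrow> \<exists>V\<in>\<B>. x \<in> V \<and> V \<subseteq> U"
    using sc unfolding second_countable_def by metis
  have open_sets: "U \<in> sets S" if "openin T U" for U using that by (simp add: sets sigma_sets.Basic)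
  have prod_open: "P \<in> sets (S \<Otimes>\<^sub>M S)" if P: "openin (prod_topology T T) P" for P
  proof -
    define R where "R = {p \<in> \<B> \<times> \<B>. fst p \<times> snd p \<subseteq> P}"
    have "countable R" using \<B>(1) by (auto simp: R_def)
    have "(\<Union>p\<in>R. fst p \<times> snd p) = P"
    proof (rule subset_antisym)
      show "P \<subseteq> (\<Union>p\<in>R. fst p \<times> snd p)"
      proof
        fix z assume "z \<in> P"
        moreover obtain x y where z: "z = (x, y)" by fastforce
        ultimately have "(x, y) \<in> P" by simp
        from P[unfolded openin_prod_topology_alt, rule_format, OF this]
        obtain U V where UV: "openin T U" "openin T V" "x \<in> U" "y \<in> V" "U \<times> V \<subseteq> P"
          by (elim exE conjE)
        obtain U' V' where U': "U' \<in> \<B>" "x \<in> U'" "U' \<subseteq> U" and V': "V' \<in> \<B>" "y \<in> V'" "V' \<subseteq> V"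
          using \<B>(3) UV by metis
        have "(U', V') \<in> R" using U' V' UV(5) by (auto simp: R_def)
        then show "z \<in> (\<Union>p\<in>R. fst p \<times> snd p)" using U' V' z by force
      qed
    qed (auto simp: R_def)
    moreover have "(\<Union>p\<in>R. fst p \<times> snd p) \<in> sets (S \<Otimes>\<^sub>M S)"
      using \<open>countable R\<close> \<B>(2) open_sets by (intro sets.countable_UN') (auto simp: R_def)
    ultimately show ?thesis by simp
  qed
  have mult: "continuous_map (prod_topology T T) T (\<lambda>(x, y). x \<otimes>\<^bsub>G\<^esub> y)"
    and inv: "continuous_map T T (\<lambda>x. inv\<^bsub>G\<^esub> x)"
    using tg by (simp_all add: topological_group_def)
  show ?thesis
  proof
    show "space S = carrier G" using sp top by simp
    show "(\<lambda>(x, y). x \<otimes>\<^bsub>G\<^esub> y) \<in> S \<Otimes>\<^sub>M S \<rightarrow>\<^sub>M S"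
    proof (rule measurable_sigma_sets[OF sets Pow])
      show "(\<lambda>(x, y). x \<otimes>\<^bsub>G\<^esub> y) \<in> space (S \<Otimes>\<^sub>M S) \<rightarrow> topspace T"
        by (auto simp: space_pair_measure sp top)
      fix U assume "U \<in> {U. openin T U}"
      then have "openin (prod_topology T T) {p \<in> topspace (prod_topology T T). (\<lambda>(x, y). x \<otimes>\<^bsub>G\<^esub> y) p \<in> U}"
        using openin_continuous_map_preimage[OF mult] by simp
      from prod_open[OF this] show "(\<lambda>(x, y). x \<otimes>\<^bsub>G\<^esub> y) -` U \<inter> space (S \<Otimes>\<^sub>M S) \<in> sets (S \<Otimes>\<^sub>M S)"
        by (simp add: space_pair_measure sp vimage_def Int_def conj_commute)
    qed
    show "(\<lambda>x. inv\<^bsub>G\<^esub> x) \<in> S \<rightarrow>\<^sub>M S"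
    proof (rule measurable_sigma_sets[OF sets Pow])
      show "(\<lambda>x. inv\<^bsub>G\<^esub> x) \<in> space S \<rightarrow> topspace T" by (auto simp: sp top)
      fix U assume "U \<in> {U. openin T U}"
      then have "openin T {p \<in> topspace T. inv\<^bsub>G\<^esub> p \<in> U}"
        using openin_continuous_map_preimage[OF inv] by simp
      from open_sets[OF this] show "(\<lambda>x. inv\<^bsub>G\<^esub> x) -` U \<inter> space S \<in> sets S"
        by (simp add: sp vimage_def Int_def conj_commute)
    qed
  qed
qed

lemma measurable_subgroup:
  assumes "measurable_group G S" and H: "subgroup H G" and HS: "H \<in> sets S"
  shows "measurable_group (G\<lparr>carrier := H\<rparr>) (restrict_space S H)"
proof -
  interpret measurable_group G S by fact
  let ?R = "restrict_space S H"
  have sp: "space ?R = H" using sets_into_carrier[OF HS]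
    by (simp add: space_restrict_space space_S Int_absorb2)
  interpret H: group "G\<lparr>carrier := H\<rparr>" using H by (rule subgroup_imp_group)
  have id: "(\<lambda>x. x) \<in> ?R \<rightarrow>\<^sub>M S" by (intro measurable_restrict_space1) simp
  show ?thesis
  proof
    show "space ?R = carrier (G\<lparr>carrier := H\<rparr>)" using sp by simp
    have "(\<lambda>p. fst p \<otimes>\<^bsub>G\<^esub> snd p) \<in> ?R \<Otimes>\<^sub>M ?R \<rightarrow>\<^sub>M ?R"
    proof (rule measurable_restrict_space2)
      show "(\<lambda>p. fst p \<otimes>\<^bsub>G\<^esub> snd p) \<in> ?R \<Otimes>\<^sub>M ?R \<rightarrow>\<^sub>M S"
        by (intro measurable_mult measurable_compose[OF measurable_fst id] measurable_compose[OF measurable_snd id])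
    qed (use subgroup.m_closed[OF H] sp in \<open>auto simp: space_pair_measure\<close>)
    then show "(\<lambda>(x, y). x \<otimes>\<^bsub>G\<lparr>carrier := H\<rparr>\<^esub> y) \<in> ?R \<Otimes>\<^sub>M ?R \<rightarrow>\<^sub>M ?R" by (simp add: case_prod_beta')
    have "(\<lambda>x. inv\<^bsub>G\<^esub> x) \<in> ?R \<rightarrow>\<^sub>M ?R"
      using subgroup.m_inv_closed[OF H] sp
        by (intro measurable_restrict_space2 measurable_inv[OF id]) auto
    also have "?this \<longleftrightarrow> (\<lambda>x. inv\<^bsub>G\<lparr>carrier := H\<rparr>\<^esub> x) \<in> ?R \<rightarrow>\<^sub>M ?R"
      using H sp by (intro measurable_cong) (simp add: m_inv_consistent)
    finally show "(\<lambda>x. inv\<^bsub>G\<lparr>carrier := H\<rparr>\<^esub> x) \<in> ?R \<rightarrow>\<^sub>M ?R" .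
  qed
qed

lemma haar_left_invariant:
  assumes mg: "measurable_group G S" and lc: "locally_compact_space T" and haus: "Hausdorff_space T"
    and sc: "second_countable T" and \<mu>: "left_haar_measure G T \<mu>" and S: "sets S = sets \<mu>"
  shows "measurable_group.left_invariant G S \<mu>"
proof -
  interpret measurable_group G S by fact
  have sets: "sets \<mu> = sigma_sets (topspace T) {U. openin T U}"
    and fin: "\<And>C. compactin T C \<Longrightarrow> emeasure \<mu> C < \<infinity>"
    using \<mu> by (simp_all add: left_haar_measure_def)
  have sp: "space \<mu> = topspace T" "space \<mu> = carrier G"
    using borel_space_eq[OF sets] sets_eq_imp_space_eq[OF S] space_S by auto
  obtain \<D> where \<D>: "countable \<D>" "Int_stable \<D>" "\<Union>\<D> = topspace T" "sets \<mu> = sigma_sets (topspace T) \<D>" "\<forall>B\<in>\<D>. emeasure \<mu> B < \<infinity>"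
    by (rule topology_generator[OF lc haus sc sets fin])
  have "sigma_finite_measure \<mu>"
    by (rule sigma_finite_of_generator[OF \<D>(1)]) (use \<D> sp in auto)
  moreover have "emeasure \<mu> (space \<mu>) \<noteq> 0" "\<forall>g\<in>carrier G. \<forall>E\<in>sets \<mu>. emeasure \<mu> (g <#\<^bsub>G\<^esub> E) = emeasure \<mu> E"
    using \<mu> unfolding left_haar_measure_def by - (elim conjE, assumption)+
  ultimately show ?thesis using S sp by (simp add: left_invariant_def)
qed

context measurable_group
begin

text \<open>The measure \<open>E \<mapsto> \<mu>(E g)\<close> is again left invariant.\<close>

lemma left_invariant_r_coset:
  assumes \<mu>: "left_invariant \<mu>" and g: "g \<in> carrier G"
  obtains c :: real where "c > 0" "\<And>E. E \<in> sets S \<Longrightarrow> emeasure \<mu> (E #> g) = ennreal c * emeasure \<mu> E"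
proof -
  interpret \<mu>: sigma_finite_measure \<mu> using \<mu> by (simp add: left_invariant_def)
  have sets: "sets \<mu> = sets S" using \<mu> by (simp add: left_invariant_def)
  note [measurable_cong] = sets
  have sp: "space \<mu> = carrier G" using sets_eq_imp_space_eq[OF sets] space_S by simp
  let ?\<mu> = "distr \<mu> S (\<lambda>x. x \<otimes> inv g)"
  have [measurable]: "(\<lambda>x. x \<otimes> inv g) \<in> S \<rightarrow>\<^sub>M S" using g
    by (intro right_translation_measurable) simp
  have em: "emeasure ?\<mu> E = emeasure \<mu> (E #> g)" if E: "E \<in> sets S" for E
    using E g by (subst emeasure_distr) (auto simp: sp r_coset_eq_vimage sets_into_carrier)
  have "left_invariant ?\<mu>"
    unfolding left_invariant_def
  proof (intro conjI ballI)
    show "sigma_finite_measure ?\<mu>"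
    proof
      obtain A where A: "countable A" "A \<subseteq> sets \<mu>" "\<Union>A = space \<mu>" "\<forall>a\<in>A. emeasure \<mu> a \<noteq> \<infinity>"
        using \<mu>.sigma_finite_countable by (elim exE conjE)
      have a: "a #> inv g #> g = a" if "a \<in> A" for a
      proof -
        have "a \<subseteq> carrier G" using that A sets sets_into_carrier by blast
        then show ?thesis using g by (simp add: coset_mult_assoc coset_mult_one)
      qed
      have cover: "\<Union>((\<lambda>a. a #> inv g) ` A) = carrier G"
      proof -
        have "\<Union>((\<lambda>a. a #> inv g) ` A) = (\<Union>A) #> inv g" by (auto simp: r_coset_def)
        also have "\<dots> = carrier G" using A(3) sp g by (simp add: r_coset_eq_vimage) auto
        finally show ?thesis .
      qed
      show "\<exists>A. countable A \<and> A \<subseteq> sets ?\<mu> \<and> \<Union>A = space ?\<mu> \<and> (\<forall>a\<in>A. emeasure ?\<mu> a \<noteq> \<infinity>)"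
      proof (intro exI[of _ "(\<lambda>a. a #> inv g) ` A"] conjI ballI)
        fix b assume "b \<in> (\<lambda>a. a #> inv g) ` A"
        then obtain a where a': "a \<in> A" "b = a #> inv g" by blast
        have "b \<in> sets S" unfolding a'(2) using A(2) a'(1) g sets by (intro r_coset_sets) auto
        then have "emeasure ?\<mu> b = emeasure \<mu> (b #> g)" by (rule em)
        also have "b #> g = a" unfolding a'(2) by (rule a[OF a'(1)])
        finally show "emeasure ?\<mu> b \<noteq> \<infinity>" using A(4) a'(1) by metis
      qed (use A g sets cover space_S in \<open>auto intro: r_coset_sets\<close>)
    qed
    have C: "carrier G \<in> sets S" using sets.top[of S] by (simp add: space_S)
    have "carrier G #> g = carrier G" using g by (simp add: r_coset_eq_vimage) auto
    then show "emeasure ?\<mu> (carrier G) \<noteq> 0" using em[OF C] \<mu> by (simp add: left_invariant_def)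
    fix h E assume h: "h \<in> carrier G" and E: "E \<in> sets S"
    have "(h <# E) #> g = h <# (E #> g)"
      using h g sets_into_carrier[OF E] by (auto simp: r_coset_def l_coset_def m_assoc subset_iff)
    then show "emeasure ?\<mu> (h <# E) = emeasure ?\<mu> E"
      using h g E \<mu> by (simp add: em l_coset_sets r_coset_sets left_invariant_def)
  qed simp
  then show ?thesis using left_invariant_unique[OF _ \<mu>] em that by metis
qed

text \<open>The defining property of the modular function holds, by uniqueness of invariant measures.\<close>

lemma modular_function_unique:
  assumes \<mu>: "left_invariant \<mu>" and c: "c > 0"
    and eq: "\<And>E. E \<in> sets S \<Longrightarrow> emeasure \<mu> (E #> g) = ennreal c * emeasure \<mu> E"
  shows "modular_function G \<mu> g = c"
  unfolding modular_function_def
proof (rule the_equality)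
  have sets: "sets \<mu> = sets S" using \<mu> by (simp add: left_invariant_def)
  show "0 < c \<and> (\<forall>E\<in>sets \<mu>. emeasure \<mu> (E #> g) = ennreal c * emeasure \<mu> E)" using c eq sets by simp
  fix d assume d: "0 < d \<and> (\<forall>E\<in>sets \<mu>. emeasure \<mu> (E #> g) = ennreal d * emeasure \<mu> E)"
  obtain A where A: "A \<in> sets S" "emeasure \<mu> A \<noteq> 0" "emeasure \<mu> A < \<infinity>"
    by (rule left_invariant_finite_nonnull[OF \<mu>])
  then have "emeasure \<mu> A * ennreal d = emeasure \<mu> A * ennreal c" using d eq[OF A(1)] sets
    by (simp add: mult.commute)
  then have "ennreal d = ennreal c" using A by (auto simp: ennreal_mult_cancel_left)
  then show "d = c" using c d by simp
qed

lemma modular_function: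
  assumes \<mu>: "left_invariant \<mu>" and g: "g \<in> carrier G"
  shows modular_function_pos: "0 < modular_function G \<mu> g"
    and emeasure_modular_function: "E \<in> sets S \<Longrightarrow> emeasure \<mu> (E #> g) = ennreal (modular_function G \<mu> g) * emeasure \<mu> E"
proof -
  obtain c :: real where c: "c > 0" "\<And>E. E \<in> sets S \<Longrightarrow> emeasure \<mu> (E #> g) = ennreal c * emeasure \<mu> E"
    using left_invariant_r_coset[OF assms] by blast
  then have "modular_function G \<mu> g = c" by (rule modular_function_unique[OF \<mu>])
  then show "0 < modular_function G \<mu> g"
    "E \<in> sets S \<Longrightarrow> emeasure \<mu> (E #> g) = ennreal (modular_function G \<mu> g) * emeasure \<mu> E" using c
      by simp_all
qed

lemma modular_function_mult:
  assumes \<mu>: "left_invariant \<mu>" and g: "g \<in> carrier G" and h: "h \<in> carrier G"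
  shows "modular_function G \<mu> (g \<otimes> h) = modular_function G \<mu> g * modular_function G \<mu> h"
proof (rule modular_function_unique[OF \<mu>])
  show "0 < modular_function G \<mu> g * modular_function G \<mu> h"
    using modular_function_pos[OF \<mu>] g h by simp
  fix E assume E: "E \<in> sets S"
  have "E #> (g \<otimes> h) = E #> g #> h" using g h sets_into_carrier[OF E]
    by (simp add: coset_mult_assoc)
  then show "emeasure \<mu> (E #> (g \<otimes> h)) = ennreal (modular_function G \<mu> g * modular_function G \<mu> h) * emeasure \<mu> E"
    using modular_function_pos[OF \<mu> g] modular_function_pos[OF \<mu> h]
    by (simp add: emeasure_modular_function[OF \<mu> h r_coset_sets[OF g E]] emeasure_modular_function[OF \<mu> g E] ennreal_mult mult_ac)
qed

end

lemma (in modular_group) subgroup_fiber_one: "subgroup (fiber 1) G"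
  by (unfold_locales) (auto simp: fiber_def D_mult)

lemma (in modular_group) scale:
  assumes c: "c > 0"
  shows "modular_group G (scale_measure (ennreal c) M) D"
proof -
  let ?M = "scale_measure (ennreal c) M"
  interpret c: measurable_group G ?M
    by unfold_locales (use space_S mult_measurable inv_measurable in \<open>simp_all add: space_scale_measure cong: measurable_cong_sets\<close>)
  obtain \<D> where \<D>: "countable \<D>" "Int_stable \<D>" "\<Union>\<D> = carrier G" "sets M = sigma_sets (carrier G) \<D>" "\<forall>B\<in>\<D>. emeasure M B < \<infinity>"
    by (rule exE[OF generator]) (elim conjE, metis)
  show ?thesis
  proof
    have "sigma_finite_measure ?M"
      by (rule sigma_finite_of_generator[OF \<D>(1)]) (use \<D> in \<open>auto simp: space_scale_measure space_S ennreal_mult_less_top\<close>)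
    then show "c.left_invariant ?M"
      using left_invariant_M c by (simp add: c.left_invariant_def left_invariant_def)
    show "\<exists>\<D>. countable \<D> \<and> Int_stable \<D> \<and> \<Union>\<D> = carrier G \<and> sets ?M = sigma_sets (carrier G) \<D> \<and> (\<forall>B\<in>\<D>. emeasure ?M B < \<infinity>)"
      using \<D> by (intro exI[of _ \<D>]) (auto simp: ennreal_mult_less_top)
  qed (use D_pos D_mult emeasure_r_coset countable_range fiber_sets' in \<open>auto simp: mult_ac\<close>)
qed

text \<open>The fibers of the modular function are cosets of its open kernel; being open and disjoint,
  there are only countably many of them.\<close>

lemma haar_modular_group:
  assumes lc: "locally_compact_group G T" and sc: "second_countable T"
    and \<mu>: "left_haar_measure G T \<mu>" and au: "almost_unimodular G T \<mu>"
  shows "modular_group G \<mu> (modular_function G \<mu>)"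
proof -
  have tg: "topological_group G T" and haus: "Hausdorff_space T" and lcs: "locally_compact_space T"
    using lc by (simp_all add: locally_compact_group_def)
  have sets: "sets \<mu> = sigma_sets (topspace T) {U. openin T U}"
    and fin: "\<And>C. compactin T C \<Longrightarrow> emeasure \<mu> C < \<infinity>"
    using \<mu> by (simp_all add: left_haar_measure_def)
  interpret measurable_group G \<mu> by (rule measurable_group_borel[OF tg sc sets])
  have li: "left_invariant \<mu>" by (rule haar_left_invariant[OF measurable_group_axioms lcs haus sc \<mu> refl])
  have top: "topspace T = carrier G" using tg by (simp add: topological_group_def)
  let ?D = "modular_function G \<mu>"
  let ?F = "\<lambda>k. {g \<in> carrier G. ?D g = k}"
  have one: "openin T (?F 1)" using au by (simp add: almost_unimodular_def modular_kernel_def)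
  have D_inv: "?D (inv\<^bsub>G\<^esub> g \<otimes>\<^bsub>G\<^esub> x) = inverse (?D g) * ?D x"
    if "g \<in> carrier G" "x \<in> carrier G" for g x
  proof -
    have "?D g * ?D (inv\<^bsub>G\<^esub> g \<otimes>\<^bsub>G\<^esub> x) = ?D x"
      using that modular_function_mult[OF li that(1), of "inv\<^bsub>G\<^esub> g \<otimes>\<^bsub>G\<^esub> x"]
        by (simp add: m_assoc[symmetric])
    then show ?thesis using modular_function_pos[OF li that(1)] by (auto simp: field_simps)
  qed
  have fib_open: "openin T (?F k)" for k
  proof (cases "k \<in> ?D ` carrier G")
    case True
    then obtain g where g: "g \<in> carrier G" "k = ?D g" by blast
    have "continuous_map T (prod_topology T T) (\<lambda>x. (inv\<^bsub>G\<^esub> g, x))"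
      using g top by (intro continuous_map_pairedI) auto
    then have "continuous_map T T ((\<lambda>(x, y). x \<otimes>\<^bsub>G\<^esub> y) \<circ> (\<lambda>x. (inv\<^bsub>G\<^esub> g, x)))"
      using tg unfolding topological_group_def by (blast intro: continuous_map_compose)
    from openin_continuous_map_preimage[OF this one]
    have "openin T {x \<in> topspace T. inv\<^bsub>G\<^esub> g \<otimes>\<^bsub>G\<^esub> x \<in> ?F 1}" by simp
    also have "{x \<in> topspace T. inv\<^bsub>G\<^esub> g \<otimes>\<^bsub>G\<^esub> x \<in> ?F 1} = ?F k"
      using g top modular_function_pos[OF li g(1)] by (auto simp: D_inv field_simps)
    finally show ?thesis .
  next
    case False
    then have "?F k = {}" by blast
    then show ?thesis by (rule ssubst) simp
  qed
  have "countable (?D ` carrier G)"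
  proof -
    obtain \<B> where \<B>: "countable \<B>" "\<And>V. V \<in> \<B> \<Longrightarrow> openin T V"
      "\<And>U x. openin T U \<Longrightarrow> x \<in> U \<Longrightarrow> \<exists>V\<in>\<B>. x \<in> V \<and> V \<subseteq> U"
      using sc unfolding second_countable_def by metis
    have "\<exists>V. V \<in> \<B> \<and> V \<noteq> {} \<and> V \<subseteq> ?F k" if "k \<in> ?D ` carrier G" for k
    proof -
      from that obtain g where "g \<in> ?F k" by blast
      then show ?thesis using \<B>(3)[OF fib_open, of g k] by blast
    qed
    then obtain f where f: "\<And>k. k \<in> ?D ` carrier G \<Longrightarrow> f k \<in> \<B> \<and> f k \<noteq> {} \<and> f k \<subseteq> ?F k" by metis
    have "inj_on f (?D ` carrier G)"
    proof (rule inj_onI)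
      fix k l assume kl: "k \<in> ?D ` carrier G" "l \<in> ?D ` carrier G" "f k = f l"
      obtain x where "x \<in> f k" using f[OF kl(1)] by blast
      then have "x \<in> ?F k" "x \<in> ?F l" using f[OF kl(1)] f[OF kl(2)] kl(3) by blast+
      then show "k = l" by simp
    qed
    moreover have "countable (f ` ?D ` carrier G)" using f
      by (intro countable_subset[OF _ \<B>(1)]) blast
    ultimately show ?thesis by (rule countable_image_inj_on[rotated])
  qed
  moreover obtain \<D> where \<D>: "countable \<D>" "Int_stable \<D>" "\<Union>\<D> = topspace T" "sets \<mu> = sigma_sets (topspace T) \<D>" "\<forall>B\<in>\<D>. emeasure \<mu> B < \<infinity>"
    by (rule topology_generator[OF lcs haus sc sets fin])
  moreover have "?F k \<in> sets \<mu>" for k using fib_open[of k] by (simp add: sets sigma_sets.Basic)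
  ultimately show ?thesis
    using li modular_function_pos[OF li] modular_function_mult[OF li] emeasure_modular_function[OF li]
    by unfold_locales (auto simp: top)
qed

text \<open>Both \<open>\<nu>\<close> and the restriction of \<open>\<mu>\<close> are left invariant on the kernel, so they differ by a
  factor, by which \<open>\<mu>\<close> can be rescaled without changing its modular function.\<close>

lemma haar_modular_kernel:
  assumes lc: "locally_compact_group G T" and sc: "second_countable T"
    and \<mu>: "left_haar_measure G T \<mu>" and au: "almost_unimodular G T \<mu>"
    and \<nu>: "left_haar_measure (modular_kernel_group G \<mu>) (subtopology T (modular_kernel G \<mu>)) \<nu>"
  obtains M where "modular_group G M (modular_function G \<mu>)" "\<nu> = restrict_space M (modular_kernel G \<mu>)"
proof -
  interpret modular_group G \<mu> "modular_function G \<mu>" by (rule haar_modular_group[OF lc sc \<mu> au])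
  let ?H = "modular_kernel G \<mu>"
  have H: "?H = fiber 1" by (simp add: fiber_def modular_kernel_def)
  have haus: "Hausdorff_space T" and lcs: "locally_compact_space T"
    using lc by (simp_all add: locally_compact_group_def)
  have Hopen: "openin T ?H" using au by (simp add: almost_unimodular_def)
  have HT: "?H \<subseteq> topspace T" by (rule openin_subset[OF Hopen])
  interpret H: measurable_group "G\<lparr>carrier := ?H\<rparr>" "restrict_space \<mu> ?H"
    unfolding H by (rule measurable_subgroup[OF measurable_group_axioms subgroup_fiber_one fiber_sets])
  have sets\<mu>: "sets \<mu> = sigma_sets (topspace T) {U. openin T U}" using \<mu>
    by (simp add: left_haar_measure_def)
  have Hsets: "?H \<in> sets \<mu>" by (simp add: H)
  have sets: "sets (restrict_space \<mu> ?H) = sets \<nu>"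
  proof -
    have "{U. openin (subtopology T ?H) U} = (\<inter>) ?H ` {U. openin T U}"
      by (auto simp: openin_subtopology)
    then have "sets \<nu> = sigma_sets ?H ((\<inter>) ?H ` {U. openin T U})"
      using \<nu> HT by (simp add: left_haar_measure_def Int_absorb1)
    also have "\<dots> = (\<inter>) ?H ` sets \<mu>" unfolding sets\<mu>
      by (rule sigma_sets_Int[symmetric]) (use Hsets HT sets\<mu> in auto)
    finally show ?thesis by (simp add: sets_restrict_space)
  qed
  have li\<nu>: "H.left_invariant \<nu>"
    by (rule haar_left_invariant[OF H.measurable_group_axioms _ _ _ \<nu> sets])
      (auto simp: haus lcs sc Hopen Hausdorff_space_subtopology second_countable_subtopology intro!: locally_compact_space_open_subset)
  have sub: "E \<in> sets \<mu> \<and> E \<subseteq> ?H" if "E \<in> sets (restrict_space \<mu> ?H)" for E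
    using that Hsets by (auto simp: sets_restrict_space)
  have li\<mu>: "H.left_invariant (restrict_space \<mu> ?H)"
    unfolding H.left_invariant_def
  proof (intro conjI ballI)
    show "sigma_finite_measure (restrict_space \<mu> ?H)"
      by (rule sigma_finite_measure_restrict_space[OF sigma_finite_measure_axioms Hsets])
    show "emeasure (restrict_space \<mu> ?H) (carrier (G\<lparr>carrier := ?H\<rparr>)) \<noteq> 0"
      using fiber_one_not_null Hsets by (simp add: emeasure_restrict_space H)
    fix g E assume g: "g \<in> carrier (G\<lparr>carrier := ?H\<rparr>)" and E: "E \<in> sets (restrict_space \<mu> ?H)"
    have eq: "g <#\<^bsub>G\<lparr>carrier := ?H\<rparr>\<^esub> E = g <#\<^bsub>G\<^esub> E" by (simp add: l_coset_def)
    have "g <#\<^bsub>G\<lparr>carrier := ?H\<rparr>\<^esub> E \<in> sets (restrict_space \<mu> ?H)" by (rule H.l_coset_sets[OF g E])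
    then have "g <#\<^bsub>G\<^esub> E \<subseteq> ?H" using sub eq by simp
    moreover have "g \<in> carrier G" using g H by (simp add: fiber_def)
    ultimately show "emeasure (restrict_space \<mu> ?H) (g <#\<^bsub>G\<lparr>carrier := ?H\<rparr>\<^esub> E) = emeasure (restrict_space \<mu> ?H) E"
      using Hsets sub[OF E] by (simp add: eq emeasure_restrict_space emeasure_l_coset)
  qed simp
  obtain c :: real where c: "c > 0" "\<And>E. E \<in> sets (restrict_space \<mu> ?H) \<Longrightarrow> emeasure \<nu> E = ennreal c * emeasure (restrict_space \<mu> ?H) E"
    using H.left_invariant_unique[OF li\<nu> li\<mu>] by blast
  show ?thesis
  proof (rule that)
    show "modular_group G (scale_measure (ennreal c) \<mu>) (modular_function G \<mu>)"
      by (rule scale[OF c(1)])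
    show "\<nu> = restrict_space (scale_measure (ennreal c) \<mu>) ?H"
    proof (rule measure_eqI)
      show "sets \<nu> = sets (restrict_space (scale_measure (ennreal c) \<mu>) ?H)"
        using sets by (simp add: sets_restrict_space)
      fix E assume "E \<in> sets \<nu>"
      then have E: "E \<in> sets (restrict_space \<mu> ?H)" using sets by simp
      then show "emeasure \<nu> E = emeasure (restrict_space (scale_measure (ennreal c) \<mu>) ?H) E"
        using c(2)[OF E] sub[OF E] Hsets by (simp add: emeasure_restrict_space)
    qed
  qed
qed

section \<open>Automorphisms of von Neumann algebras\<close>

context hilb_space
begin

lemma op_add_apply: "v \<in> vecs H \<Longrightarrow> op_add H A B v = vadd H (A v) (B v)"
  by (simp add: op_add_def)

lemma op_scale_apply: "v \<in> vecs H \<Longrightarrow> op_scale H c A v = vscale H c (A v)"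
  by (simp add: op_scale_def)

lemma op_add_bounded:
  assumes A: "A \<in> bounded_ops H" and B: "B \<in> bounded_ops H"
  shows "op_add H A B \<in> bounded_ops H"
proof -
  obtain C D where C: "\<And>v. v \<in> vecs H \<Longrightarrow> vnorm H (A v) \<le> C * vnorm H v"
    and D: "\<And>v. v \<in> vecs H \<Longrightarrow> vnorm H (B v) \<le> D * vnorm H v"
    using bounded_bound[OF A] bounded_bound[OF B] by metis
  show ?thesis
  proof (rule bounded_opsI)
    show "adjoint_pair (op_add H A B) (\<lambda>v. vadd H (op_adjoint H A v) (op_adjoint H B v))"
      using A B op_adjoint_pair[OF A] op_adjoint_pair[OF B] op_adjoint_bounded[OF A]
        op_adjoint_bounded[OF B]
      by (auto simp: adjoint_pair_def op_add_def)
    fix v assume v: "v \<in> vecs H"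
    show "vadd H (op_adjoint H A v) (op_adjoint H B v) \<in> vecs H"
      using v A B by (auto intro: bounded_closed op_adjoint_bounded)
    show "vnorm H (op_add H A B v) \<le> (C + D) * vnorm H v"
      using norm_triangle[of "A v" "B v"] C[OF v] D[OF v] A B v
        by (simp add: op_add_def distrib_right)
  qed (use A B in \<open>auto simp: op_add_def\<close>)
qed

lemma op_scale_bounded:
  assumes A: "A \<in> bounded_ops H"
  shows "op_scale H c A \<in> bounded_ops H"
proof -
  obtain C where C: "\<And>v. v \<in> vecs H \<Longrightarrow> vnorm H (A v) \<le> C * vnorm H v"
    using bounded_bound[OF A] by metis
  show ?thesis
  proof (rule bounded_opsI)
    show "adjoint_pair (op_scale H c A) (\<lambda>v. vscale H (cnj c) (op_adjoint H A v))"
      using A op_adjoint_pair[OF A] op_adjoint_bounded[OF A]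
      by (auto simp: adjoint_pair_def op_scale_def)
    fix v assume v: "v \<in> vecs H"
    show "vscale H (cnj c) (op_adjoint H A v) \<in> vecs H"
      using v A by (auto intro: bounded_closed op_adjoint_bounded)
    have "cmod c * vnorm H (A v) \<le> cmod c * (C * vnorm H v)" using C[OF v]
      by (intro mult_left_mono) auto
    then show "vnorm H (op_scale H c A v) \<le> (cmod c * C) * vnorm H v"
      using A v by (simp add: op_scale_def norm_scale mult.assoc)
  qed (use A in \<open>auto simp: op_scale_def\<close>)
qed

lemma commutant_bounded: "A \<in> commutant H S \<Longrightarrow> A \<in> bounded_ops H"
  by (simp add: commutant_iff)

lemma commutantD: "A \<in> commutant H S \<Longrightarrow> B \<in> S \<Longrightarrow> v \<in> vecs H \<Longrightarrow> A (B v) = B (A v)"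
  by (simp add: commutant_iff)

lemma subset_bicommutant: "S \<subseteq> bounded_ops H \<Longrightarrow> S \<subseteq> commutant H (commutant H S)"
  by (auto simp: commutant_iff)

lemma commutant_add:
  "S \<subseteq> bounded_ops H \<Longrightarrow> A \<in> commutant H S \<Longrightarrow> B \<in> commutant H S \<Longrightarrow> op_add H A B \<in> commutant H S"
  by (auto simp: commutant_iff op_add_bounded bounded_add subset_iff op_add_apply)

lemma commutant_scale:
  "S \<subseteq> bounded_ops H \<Longrightarrow> A \<in> commutant H S \<Longrightarrow> op_scale H c A \<in> commutant H S"
  by (auto simp: commutant_iff op_scale_bounded bounded_scale subset_iff op_scale_apply)

lemma commutant_mult:
  "S \<subseteq> bounded_ops H \<Longrightarrow> A \<in> commutant H S \<Longrightarrow> B \<in> commutant H S \<Longrightarrow> op_mult H A B \<in> commutant H S"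
  by (auto simp: commutant_iff op_mult_bounded subset_iff op_mult_apply)

lemma commutant_adjoint:
  assumes S: "S \<subseteq> bounded_ops H" and S_adj: "\<And>A. A \<in> S \<Longrightarrow> \<exists>A'\<in>S. adjoint_pair A A'"
    and B: "B \<in> commutant H S"
  shows "op_adjoint H B \<in> commutant H S"
  unfolding commutant_iff
proof (intro conjI ballI)
  show "op_adjoint H B \<in> bounded_ops H" by (rule op_adjoint_bounded[OF commutant_bounded[OF B]])
  fix A v assume A: "A \<in> S" and v: "v \<in> vecs H"
  obtain A' where A': "A' \<in> S" "adjoint_pair A A'" using S_adj[OF A] by blast
  show "op_adjoint H B (A v) = A (op_adjoint H B v)"
    by (rule commutes_op_adjoint[OF commutant_bounded[OF B] _ _ A'(2) _ v, symmetric])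
      (use S A A' commutantD[OF B A'(1)] in auto)
qed

lemma bicommutant_adjoint:
  assumes S: "S \<subseteq> bounded_ops H" and S_adj: "\<And>A. A \<in> S \<Longrightarrow> \<exists>A'\<in>S. adjoint_pair A A'"
    and x: "x \<in> commutant H (commutant H S)"
  shows "op_adjoint H x \<in> commutant H (commutant H S)"
proof (rule commutant_adjoint[OF _ _ x])
  fix B assume B: "B \<in> commutant H S"
  show "\<exists>B'\<in>commutant H S. adjoint_pair B B'"
    using commutant_adjoint[OF S S_adj B] op_adjoint_pair[OF commutant_bounded[OF B]] by blast
qed (auto intro: commutant_bounded)

definition conj_op :: "('v \<Rightarrow> 'v) \<Rightarrow> ('v \<Rightarrow> 'v) \<Rightarrow> ('v \<Rightarrow> 'v) \<Rightarrow> ('v \<Rightarrow> 'v)" where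
  "conj_op U U' A = op_mult H (op_mult H U A) U'"

definition unitary_pair :: "('v \<Rightarrow> 'v) \<Rightarrow> ('v \<Rightarrow> 'v) \<Rightarrow> bool" where
  "unitary_pair U U' \<longleftrightarrow> U \<in> bounded_ops H \<and> U' \<in> bounded_ops H \<and> adjoint_pair U U' \<and>
     (\<forall>v\<in>vecs H. U (U' v) = v \<and> U' (U v) = v)"

lemma unitary_pair_sym: "unitary_pair U U' \<Longrightarrow> unitary_pair U' U"
  unfolding unitary_pair_def by (auto intro: adjoint_pair_sym)

lemma conj_op_apply: "U' \<in> bounded_ops H \<Longrightarrow> v \<in> vecs H \<Longrightarrow> conj_op U U' A v = U (A (U' v))"
  by (simp add: conj_op_def op_mult_apply)

lemma conj_op_bounded:
  "unitary_pair U U' \<Longrightarrow> A \<in> bounded_ops H \<Longrightarrow> conj_op U U' A \<in> bounded_ops H"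
  by (simp add: conj_op_def unitary_pair_def op_mult_bounded)

lemma conj_op_commutant:
  assumes U: "unitary_pair U U'" and S: "S \<subseteq> bounded_ops H"
    and inv: "\<And>A. A \<in> S \<Longrightarrow> conj_op U' U A \<in> S" and B: "B \<in> commutant H S"
  shows "conj_op U U' B \<in> commutant H S"
  unfolding commutant_iff
proof (intro conjI ballI)
  show "conj_op U U' B \<in> bounded_ops H" by (rule conj_op_bounded[OF U commutant_bounded[OF B]])
  fix C v assume C: "C \<in> S" and v: "v \<in> vecs H"
  have U': "U \<in> bounded_ops H" "U' \<in> bounded_ops H" "\<And>v. v \<in> vecs H \<Longrightarrow> U (U' v) = v" "\<And>v. v \<in> vecs H \<Longrightarrow> U' (U v) = v"
    using U by (auto simp: unitary_pair_def)
  have Cb: "C \<in> bounded_ops H" and Bb: "B \<in> bounded_ops H" using S C commutant_bounded[OF B] by auto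
  have "conj_op U U' B (C v) = U (B (conj_op U' U C (U' v)))" using v U' Cb
    by (simp add: conj_op_apply)
  also have "\<dots> = U (conj_op U' U C (B (U' v)))" using commutantD[OF B inv[OF C]] v U' by simp
  also have "\<dots> = C (conj_op U U' B v)" using v U' Cb Bb by (simp add: conj_op_apply)
  finally show "conj_op U U' B (C v) = C (conj_op U U' B v)" .
qed

text \<open>Conjugation preserves \<open>S\<close>, hence its commutant and its bicommutant. It is normal because it
  only moves the vectors of a normal functional by \<open>U'\<close>.\<close>

lemma conj_vna_aut:
  assumes U: "unitary_pair U U'" and S: "S \<subseteq> bounded_ops H"
    and S_adj: "\<And>A. A \<in> S \<Longrightarrow> \<exists>A'\<in>S. adjoint_pair A A'"
    and inv: "\<And>A. A \<in> S \<Longrightarrow> conj_op U U' A \<in> S" "\<And>A. A \<in> S \<Longrightarrow> conj_op U' U A \<in> S"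
  defines "M \<equiv> commutant H (commutant H S)"
  shows "(\<lambda>A\<in>M. conj_op U U' A) \<in> vna_aut H M"
proof -
  have U': "U \<in> bounded_ops H" "U' \<in> bounded_ops H" "\<And>v. v \<in> vecs H \<Longrightarrow> U (U' v) = v" "\<And>v. v \<in> vecs H \<Longrightarrow> U' (U v) = v"
    and UU': "adjoint_pair U U'"
    using U by (auto simp: unitary_pair_def)
  note Us = unitary_pair_sym[OF U]
  have S': "commutant H S \<subseteq> bounded_ops H" using commutant_bounded by blast
  have Mb: "\<And>A. A \<in> M \<Longrightarrow> A \<in> bounded_ops H" using commutant_bounded by (auto simp: M_def)
  have closed: "conj_op U U' A \<in> M" if "A \<in> M" for A
    unfolding M_def by (rule conj_op_commutant[OF U S' conj_op_commutant[OF Us S inv(1)]]) (use that in \<open>auto simp: M_def\<close>)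
  have closed': "conj_op U' U A \<in> M" if "A \<in> M" for A
    unfolding M_def by (rule conj_op_commutant[OF Us S' conj_op_commutant[OF U S inv(2)]]) (use that in \<open>auto simp: M_def\<close>)
  have add: "op_add H A B \<in> M" if "A \<in> M" "B \<in> M" for A B using commutant_add[OF S'] that
    by (simp add: M_def)
  have scale: "op_scale H c A \<in> M" if "A \<in> M" for A c using commutant_scale[OF S'] that
    by (simp add: M_def)
  have mult: "op_mult H A B \<in> M" if "A \<in> M" "B \<in> M" for A B using commutant_mult[OF S'] that
    by (simp add: M_def)
  have adj: "op_adjoint H A \<in> M" if "A \<in> M" for A using bicommutant_adjoint[OF S S_adj] that
    by (simp add: M_def)
  have bij: "bij_betw (\<lambda>A\<in>M. conj_op U U' A) M M"
  proof (rule bij_betw_byWitness[where f' = "conj_op U' U"])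
    show "\<forall>A\<in>M. conj_op U' U ((\<lambda>A\<in>M. conj_op U U' A) A) = A"
    proof
      fix A assume A: "A \<in> M"
      show "conj_op U' U ((\<lambda>A\<in>M. conj_op U U' A) A) = A"
        using A U' by (intro bounded_ext) (auto simp: conj_op_apply Mb closed intro!: Mb closed')
    qed
    show "\<forall>A\<in>M. (\<lambda>A\<in>M. conj_op U U' A) (conj_op U' U A) = A"
    proof
      fix A assume A: "A \<in> M"
      show "(\<lambda>A\<in>M. conj_op U U' A) (conj_op U' U A) = A"
        using A U' by (intro bounded_ext) (auto simp: conj_op_apply Mb closed' intro!: Mb closed)
    qed
  qed (auto simp: closed closed')
  have normal: "normal_functional H M (\<phi> \<circ> (\<lambda>A\<in>M. conj_op U U' A))"
    if "normal_functional H M \<phi>" for \<phi>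
  proof -
    obtain \<xi> \<eta> :: "nat \<Rightarrow> 'v" where *: "range \<xi> \<subseteq> vecs H" "range \<eta> \<subseteq> vecs H"
        "summable (\<lambda>n. (vnorm H (\<xi> n))\<^sup>2)" "summable (\<lambda>n. (vnorm H (\<eta> n))\<^sup>2)"
        "\<forall>A\<in>M. \<phi> A = (\<Sum>n. vinner H (A (\<xi> n)) (\<eta> n))"
      using \<open>normal_functional H M \<phi>\<close> unfolding normal_functional_def by (elim exE conjE)
    have V: "\<xi> n \<in> vecs H" "\<eta> n \<in> vecs H" for n using * by auto
    have norm: "vnorm H (U' v) = vnorm H v" if "v \<in> vecs H" for v
      using adjoint_pairD[OF UU', of "U' v" v] that U' by (simp add: vnorm_def)
    show ?thesis
      unfolding normal_functional_def
    proof (rule exI[of _ "\<lambda>n. U' (\<xi> n)"], rule exI[of _ "\<lambda>n. U' (\<eta> n)"], intro conjI ballI)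
      fix A assume A: "A \<in> M"
      have "vinner H (conj_op U U' A (\<xi> n)) (\<eta> n) = vinner H (A (U' (\<xi> n))) (U' (\<eta> n))" for n
        using adjoint_pairD[OF UU', of "A (U' (\<xi> n))" "\<eta> n"] V U' Mb[OF A]
          by (simp add: conj_op_apply)
      then show "(\<phi> \<circ> (\<lambda>A\<in>M. conj_op U U' A)) A = (\<Sum>n. vinner H (A (U' (\<xi> n))) (U' (\<eta> n)))"
        using *(5) closed[OF A] A by simp
    qed (use V U' * norm in auto)
  qed
  show ?thesis
    unfolding vna_aut_def
  proof (intro CollectI conjI ballI allI impI)
    fix A B assume A: "A \<in> M" and B: "B \<in> M"
    have V: "\<And>v. v \<in> vecs H \<Longrightarrow> A (U' v) \<in> vecs H" "\<And>v. v \<in> vecs H \<Longrightarrow> B (U' v) \<in> vecs H"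
      using Mb[OF A] Mb[OF B] U' by auto
    show "(\<lambda>A\<in>M. conj_op U U' A) (op_add H A B) = op_add H ((\<lambda>A\<in>M. conj_op U U' A) A) ((\<lambda>A\<in>M. conj_op U U' A) B)"
      using A B U' V by (intro bounded_ext)
        (auto simp: add closed bounded_add conj_op_apply op_add_apply intro!: Mb op_add_bounded)
    show "(\<lambda>A\<in>M. conj_op U U' A) (op_mult H A B) = op_mult H ((\<lambda>A\<in>M. conj_op U U' A) A) ((\<lambda>A\<in>M. conj_op U U' A) B)"
      using A B U' V by (intro bounded_ext)
        (auto simp: mult closed conj_op_apply op_mult_apply intro!: Mb)
  next
    fix c A assume A: "A \<in> M"
    then show "(\<lambda>A\<in>M. conj_op U U' A) (op_scale H c A) = op_scale H c ((\<lambda>A\<in>M. conj_op U U' A) A)"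
      using U' Mb[OF A] by (intro bounded_ext)
        (auto simp: scale closed bounded_scale conj_op_apply op_scale_apply intro!: Mb op_scale_bounded)
  next
    fix A assume A: "A \<in> M"
    note Ab = Mb[OF A]
    note Ab' = op_adjoint_bounded[OF Ab]
    have "adjoint_pair (conj_op U U' A) (conj_op U U' (op_adjoint H A))"
      unfolding adjoint_pair_def
    proof (intro ballI)
      fix v w assume vw: "v \<in> vecs H" "w \<in> vecs H"
      have "vinner H (conj_op U U' A v) w = vinner H (A (U' v)) (U' w)"
        using adjoint_pairD[OF UU', of "A (U' v)" w] vw U' Ab by (simp add: conj_op_apply)
      also have "\<dots> = vinner H (U' v) (op_adjoint H A (U' w))"
        using adjoint_pairD[OF op_adjoint_pair[OF Ab], of "U' v" "U' w"] vw U' by simp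
      also have "\<dots> = vinner H v (conj_op U U' (op_adjoint H A) w)"
        using adjoint_pairD[OF adjoint_pair_sym[OF UU'], of v "op_adjoint H A (U' w)"] vw U' Ab'
          by (simp add: conj_op_apply)
      finally show "vinner H (conj_op U U' A v) w = vinner H v (conj_op U U' (op_adjoint H A) w)" .
    qed
    then have "op_adjoint H (conj_op U U' A) = conj_op U U' (op_adjoint H A)"
      by (rule op_adjoint_eq[OF conj_op_bounded[OF U Ab']])
    then show "(\<lambda>A\<in>M. conj_op U U' A) (op_adjoint H A) = op_adjoint H ((\<lambda>A\<in>M. conj_op U U' A) A)"
      using A adj[OF A] by simp
  qed (use bij normal in auto)
qed

lemma normal_functional_infsum:
  assumes "range \<xi> \<subseteq> vecs H" "range \<eta> \<subseteq> vecs H"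
    "summable (\<lambda>n. (vnorm H (\<xi> n))\<^sup>2)" "summable (\<lambda>n. (vnorm H (\<eta> n))\<^sup>2)" and A: "A \<in> bounded_ops H"
  shows "((\<lambda>n. vinner H (A (\<xi> n)) (\<eta> n)) has_sum (\<Sum>n. vinner H (A (\<xi> n)) (\<eta> n))) UNIV"
proof -
  obtain C where C0: "C \<ge> 0" and C: "\<And>v. v \<in> vecs H \<Longrightarrow> vnorm H (A v) \<le> C * vnorm H v"
    using bounded_bound[OF A] by blast
  have V: "\<xi> n \<in> vecs H" "\<eta> n \<in> vecs H" for n using assms by auto
  have "summable (\<lambda>n. norm (vinner H (A (\<xi> n)) (\<eta> n)))"
  proof (rule summable_comparison_test')
    show "summable (\<lambda>n. C\<^sup>2 * (vnorm H (\<xi> n))\<^sup>2 + (vnorm H (\<eta> n))\<^sup>2)"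
      using assms by (intro summable_add summable_mult)
    fix n
    have "cmod (vinner H (A (\<xi> n)) (\<eta> n)) \<le> (vnorm H (A (\<xi> n)))\<^sup>2 + (vnorm H (\<eta> n))\<^sup>2"
      using V A by (intro inner_bound) auto
    also have "(vnorm H (A (\<xi> n)))\<^sup>2 \<le> (C * vnorm H (\<xi> n))\<^sup>2" using C V A by (intro power_mono) auto
    finally show "norm (norm (vinner H (A (\<xi> n)) (\<eta> n))) \<le> C\<^sup>2 * (vnorm H (\<xi> n))\<^sup>2 + (vnorm H (\<eta> n))\<^sup>2"
      by (simp add: power_mult_distrib)
  qed
  from norm_summable_imp_has_sum[OF this summable_sums[OF summable_norm_cancel[OF this]]] show ?thesis .
qed

text \<open>The difference of the matrix coefficients \<open>\<langle>a(\<cdot>) v, w\<rangle>\<close> and \<open>\<langle>b(\<cdot>) v, w\<rangle>\<close> is a normal functional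
  that vanishes on \<open>S\<close>. Its two sequences of vectors are indexed by a disjoint sum.\<close>

lemma vna_aut_unique:
  assumes S: "S \<subseteq> bounded_ops H"
    and S_adj: "\<And>A. A \<in> S \<Longrightarrow> \<exists>A'\<in>S. adjoint_pair A A'"
    and S_mult: "\<And>A B. A \<in> S \<Longrightarrow> B \<in> S \<Longrightarrow> op_mult H A B \<in> S"
    and E: "E \<in> S" "\<And>v. v \<in> vecs H \<Longrightarrow> E v = v"
  defines "M \<equiv> commutant H (commutant H S)"
  assumes a: "a \<in> vna_aut H M" and b: "b \<in> vna_aut H M" and eq: "\<And>A. A \<in> S \<Longrightarrow> a A = b A"
  shows "a = b"
proof (rule extensionalityI[of _ M])
  show "a \<in> extensional M" "b \<in> extensional M" using a b by (auto simp: vna_aut_def)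
  have Mb: "\<And>A. A \<in> M \<Longrightarrow> A \<in> bounded_ops H" using commutant_bounded by (auto simp: M_def)
  have SM: "\<And>A. A \<in> S \<Longrightarrow> A \<in> M" using subset_bicommutant[OF S] by (auto simp: M_def)
  have ab: "a A \<in> bounded_ops H" "b A \<in> bounded_ops H" if "A \<in> M" for A
    using a b that by (auto simp: vna_aut_def bij_betw_def intro!: Mb)
  fix x assume x: "x \<in> M"
  show "a x = b x"
  proof (intro bounded_ext ab x inner_ext)
    fix v w assume v: "v \<in> vecs H" and w: "w \<in> vecs H"
    define \<phi> where "\<phi> A = vinner H (A v) w" for A
    have "normal_functional H M \<phi>"
      unfolding normal_functional_def
    proof (rule exI[of _ "\<lambda>n. if n = 0 then v else vscale H 0 v"],
        rule exI[of _ "\<lambda>n. if n = 0 then w else vscale H 0 w"], intro conjI ballI)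
      let ?f = "\<lambda>n::nat. if n = 0 then v else vscale H 0 v"
        and ?g = "\<lambda>n::nat. if n = 0 then w else vscale H 0 w"
      show "range ?f \<subseteq> vecs H" "range ?g \<subseteq> vecs H" using v w by auto
      show "summable (\<lambda>n. (vnorm H (?f n))\<^sup>2)" "summable (\<lambda>n. (vnorm H (?g n))\<^sup>2)"
        using v w by (auto intro!: summable_finite[of "{0}"] simp: norm_zero_vec split: if_splits)
      fix A assume "A \<in> M"
      then have "(\<Sum>n. vinner H (A (?f n)) (?g n)) = (\<Sum>n\<in>{0}. vinner H (A (?f n)) (?g n))"
        using v w Mb by (intro suminf_finite) auto
      then show "\<phi> A = (\<Sum>n. vinner H (A (?f n)) (?g n))" by (simp add: \<phi>_def)
    qed
    then have na: "normal_functional H M (\<phi> \<circ> a)" and nb: "normal_functional H M (\<phi> \<circ> b)"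
      using a b by (auto simp: vna_aut_def)
    obtain \<xi> \<eta> :: "nat \<Rightarrow> 'v" where A: "range \<xi> \<subseteq> vecs H" "range \<eta> \<subseteq> vecs H"
        "summable (\<lambda>n. (vnorm H (\<xi> n))\<^sup>2)" "summable (\<lambda>n. (vnorm H (\<eta> n))\<^sup>2)"
        "\<forall>A\<in>M. (\<phi> \<circ> a) A = (\<Sum>n. vinner H (A (\<xi> n)) (\<eta> n))"
      using na unfolding normal_functional_def by (elim exE conjE)
    obtain \<xi>' \<eta>' :: "nat \<Rightarrow> 'v" where B: "range \<xi>' \<subseteq> vecs H" "range \<eta>' \<subseteq> vecs H"
        "summable (\<lambda>n. (vnorm H (\<xi>' n))\<^sup>2)" "summable (\<lambda>n. (vnorm H (\<eta>' n))\<^sup>2)"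
        "\<forall>A\<in>M. (\<phi> \<circ> b) A = (\<Sum>n. vinner H (A (\<xi>' n)) (\<eta>' n))"
      using nb unfolding normal_functional_def by (elim exE conjE)
    have V: "\<xi> n \<in> vecs H" "\<eta> n \<in> vecs H" "\<xi>' n \<in> vecs H" "\<eta>' n \<in> vecs H" for n using A B by auto
    define X where "X = case_sum \<xi> \<xi>'"
    define Y where "Y = case_sum \<eta> (\<lambda>n. vscale H (-1) (\<eta>' n))"
    have sum_has_sum: "((\<lambda>i. case_sum f g i) has_sum (p + q)) (UNIV :: (nat + nat) set)"
      if "(f has_sum p) UNIV" "(g has_sum q) UNIV" for f g :: "nat \<Rightarrow> 'c :: {topological_comm_monoid_add, t2_space}" and p q
      unfolding UNIV_sum
    proof (rule has_sum_Un_disjoint)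
      show "((\<lambda>i. case_sum f g i) has_sum p) (range Inl)" "((\<lambda>i. case_sum f g i) has_sum q) (range Inr)"
        using that by (simp_all add: has_sum_reindex comp_def)
    qed auto
    have sq: "((\<lambda>n. (vnorm H (f n))\<^sup>2) has_sum (\<Sum>n. (vnorm H (f n))\<^sup>2)) UNIV"
      if "summable (\<lambda>n. (vnorm H (f n))\<^sup>2)" for f :: "nat \<Rightarrow> 'v"
      using that by (intro norm_summable_imp_has_sum) (auto intro: summable_sums)
    have "X \<in> vecs (l2 UNIV H)"
      unfolding l2_mem_iff
    proof
      have "(\<lambda>i. (vnorm H (X i))\<^sup>2) = case_sum (\<lambda>n. (vnorm H (\<xi> n))\<^sup>2) (\<lambda>n. (vnorm H (\<xi>' n))\<^sup>2)"
        by (auto simp: X_def fun_eq_iff split: sum.split)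
      then show "(\<lambda>i. (vnorm H (X i))\<^sup>2) summable_on UNIV"
        using sum_has_sum[OF sq[OF A(3)] sq[OF B(3)]] by (simp add: has_sum_imp_summable)
    qed (use V in \<open>auto simp: X_def split: sum.split\<close>)
    moreover have "Y \<in> vecs (l2 UNIV H)"
      unfolding l2_mem_iff
    proof
      have "(\<lambda>i. (vnorm H (Y i))\<^sup>2) = case_sum (\<lambda>n. (vnorm H (\<eta> n))\<^sup>2) (\<lambda>n. (vnorm H (\<eta>' n))\<^sup>2)"
        using V by (auto simp: Y_def fun_eq_iff norm_scale split: sum.split)
      then show "(\<lambda>i. (vnorm H (Y i))\<^sup>2) summable_on UNIV"
        using sum_has_sum[OF sq[OF A(4)] sq[OF B(4)]] by (simp add: has_sum_imp_summable)
    qed (use V in \<open>auto simp: Y_def split: sum.split\<close>)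
    moreover have val: "(\<Sum>\<^sub>\<infinity>i. vinner H (A' (X i)) (Y i)) = \<phi> (a A') - \<phi> (b A')" if A': "A' \<in> M" for A'
    proof -
      have b': "((\<lambda>n. - vinner H (A' (\<xi>' n)) (\<eta>' n)) has_sum (- \<phi> (b A'))) UNIV"
        using normal_functional_infsum[OF B(1-4) Mb[OF A']] B(5) A' by (simp add: has_sum_uminus)
      have a': "((\<lambda>n. vinner H (A' (\<xi> n)) (\<eta> n)) has_sum (\<phi> (a A'))) UNIV"
        using normal_functional_infsum[OF A(1-4) Mb[OF A']] A(5) A' by simp
      have "(\<lambda>i. vinner H (A' (X i)) (Y i)) = case_sum (\<lambda>n. vinner H (A' (\<xi> n)) (\<eta> n)) (\<lambda>n. - vinner H (A' (\<xi>' n)) (\<eta>' n))"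
        using V Mb[OF A'] by (auto simp: X_def Y_def fun_eq_iff split: sum.split)
      then show ?thesis using infsumI[OF sum_has_sum[OF a' b']] by simp
    qed
    moreover have "(\<Sum>\<^sub>\<infinity>i. vinner H (A' (X i)) (Y i)) = 0" if "A' \<in> S" for A'
      using val[OF SM[OF that]] eq[OF that] by simp
    ultimately have "(\<Sum>\<^sub>\<infinity>i. vinner H (x (X i)) (Y i)) = 0"
      using functional_vanishes_on_bicommutant[OF S S_adj S_mult E, of X UNIV Y x] x
        by (simp add: M_def)
    then show "vinner H (a x v) w = vinner H (b x v) w" using val[OF x] by (simp add: \<phi>_def)
  qed (use ab[OF x] in auto)
qed

end

section \<open>Two-sided translations on the kernel of the modular function\<close>

locale modular_section = modular_group G M "modular_function G \<mu>"
  for G :: "('a, 'b) monoid_scheme" (structure) and M \<mu> +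
  fixes \<nu> :: "'a measure" and \<sigma> :: "real \<Rightarrow> 'a"
  assumes \<nu>_eq: "\<nu> = restrict_space M (modular_kernel G \<mu>)"
    and section_\<sigma>: "normalized_section G \<mu> \<sigma>"
begin

abbreviation D :: "'a \<Rightarrow> real" where "D \<equiv> modular_function G \<mu>"
abbreviation H :: "'a set" where "H \<equiv> modular_kernel G \<mu>"
abbreviation G1 where "G1 \<equiv> modular_kernel_group G \<mu>"
abbreviation K :: "real set" where "K \<equiv> D ` carrier G"

lemma H_eq: "H = fiber 1"
  by (simp add: fiber_def modular_kernel_def)

lemma H_iff: "h \<in> H \<longleftrightarrow> h \<in> carrier G \<and> D h = 1"
  by (simp add: modular_kernel_def)

lemma H_sets: "H \<in> sets M"
  by (simp add: H_eq)

lemma space_\<nu>: "space \<nu> = H"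
  using sets_into_carrier[OF H_sets] by (auto simp: \<nu>_eq space_restrict_space space_S)

lemma subgroup_H: "subgroup H G"
  unfolding H_eq by (rule subgroup_fiber_one)

lemma emeasure_\<nu>: "E \<in> sets M \<Longrightarrow> E \<subseteq> H \<Longrightarrow> emeasure \<nu> E = emeasure M E"
  using H_sets sets_into_carrier[OF H_sets]
    by (simp add: \<nu>_eq emeasure_restrict_space Int_absorb2 space_S)

lemma sets_\<nu>: "E \<in> sets \<nu> \<longleftrightarrow> E \<in> sets M \<and> E \<subseteq> H"
proof -
  have "E \<in> sets \<nu> \<longleftrightarrow> (\<exists>F\<in>sets M. E = H \<inter> F)" by (auto simp: \<nu>_eq sets_restrict_space)
  also have "\<dots> \<longleftrightarrow> E \<in> sets M \<and> E \<subseteq> H" using H_sets by (auto intro!: bexI[of _ E])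
  finally show ?thesis .
qed

lemma \<sigma>_closed [simp, intro]: "k \<in> K \<Longrightarrow> \<sigma> k \<in> carrier G"
  and D_\<sigma> [simp]: "k \<in> K \<Longrightarrow> D (\<sigma> k) = k"
  and \<sigma>_one [simp]: "\<sigma> 1 = \<one>"
  using section_\<sigma> by (auto simp: normalized_section_def modular_range_group_def)

lemma K_pos: "k \<in> K \<Longrightarrow> 0 < k"
  using D_pos by auto

lemma K_mult [intro]: assumes "k \<in> K" "l \<in> K" shows "k * l \<in> K"
proof -
  obtain g h where "g \<in> carrier G" "h \<in> carrier G" "k = D g" "l = D h" using assms by blast
  then have "k * l = D (g \<otimes> h)" "g \<otimes> h \<in> carrier G" by (simp_all add: D_mult)
  then show ?thesis by (rule image_eqI)
qed

lemma K_inverse [intro]: assumes "k \<in> K" shows "inverse k \<in> K"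
proof -
  obtain g where "g \<in> carrier G" "k = D g" using assms by blast
  then have "inverse k = D (inv g)" "inv g \<in> carrier G" by simp_all
  then show ?thesis by (rule image_eqI)
qed

lemma one_in_K [intro, simp]: "1 \<in> K"
  by (rule image_eqI[where x = \<one>]) simp_all

subsection \<open>Translations\<close>

text \<open>The map \<open>y \<mapsto> a y b\<close> preserves the kernel precisely if \<open>D a * D b = 1\<close>.\<close>

definition adm :: "'a \<Rightarrow> 'a \<Rightarrow> bool" where
  "adm a b \<longleftrightarrow> a \<in> carrier G \<and> b \<in> carrier G \<and> D a * D b = 1"

lemma admD: "adm a b \<Longrightarrow> a \<in> carrier G" "adm a b \<Longrightarrow> b \<in> carrier G" "adm a b \<Longrightarrow> D a * D b = 1"
  by (auto simp: adm_def)

lemma adm_inv: "adm a b \<Longrightarrow> adm (inv a) (inv b)"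
  by (simp add: adm_def flip: inverse_mult_distrib)

lemma adm_mult: "adm a b \<Longrightarrow> adm c d \<Longrightarrow> adm (c \<otimes> a) (b \<otimes> d)"
  by (auto simp: adm_def D_mult)
    (metis (no_types, opaque_lifting) mult.assoc mult.commute mult.right_neutral)

lemma adm_one: "adm \<one> \<one>"
  by (simp add: adm_def)

lemma adm_H: "h \<in> H \<Longrightarrow> adm h \<one>" "h \<in> H \<Longrightarrow> adm \<one> h"
  by (simp_all add: adm_def H_iff)

lemma adm_mem: "adm a b \<Longrightarrow> y \<in> H \<Longrightarrow> a \<otimes> y \<otimes> b \<in> H"
  by (auto simp: adm_def H_iff D_mult)

text \<open>Left translation preserves the measure and right translation by \<open>b\<close> scales it by \<open>D b\<close>.\<close>

lemma distr_translation:
  assumes ab: "adm a b"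
  shows "(\<lambda>y. a \<otimes> y \<otimes> b) \<in> \<nu> \<rightarrow>\<^sub>M \<nu>"
    and "distr \<nu> \<nu> (\<lambda>y. a \<otimes> y \<otimes> b) = density \<nu> (\<lambda>_. ennreal (inverse (D b)))"
proof -
  let ?t = "\<lambda>y. a \<otimes> y \<otimes> b"
  note [simp] = admD(1,2)[OF ab]
  have "?t \<in> M \<rightarrow>\<^sub>M M"
    using measurable_compose[OF left_translation_measurable right_translation_measurable, of a b]
      by simp
  then show meas: "?t \<in> \<nu> \<rightarrow>\<^sub>M \<nu>"
    unfolding \<nu>_eq using adm_mem[OF ab] space_\<nu>[unfolded \<nu>_eq]
    by (intro measurable_restrict_space2 measurable_restrict_space1) auto
  show "distr \<nu> \<nu> ?t = density \<nu> (\<lambda>_. ennreal (inverse (D b)))"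
  proof (rule measure_eqI)
    fix E assume "E \<in> sets (distr \<nu> \<nu> ?t)"
    then have E: "E \<in> sets M" "E \<subseteq> H" "E \<in> sets \<nu>" by (auto simp: sets_\<nu>)
    let ?F = "inv a <# E"
    have EG: "E \<subseteq> carrier G" using E(1) sets_into_carrier by blast
    have F: "?F \<in> sets M" "?F \<subseteq> carrier G" using l_coset_sets[of "inv a" E] E sets_into_carrier
      by auto
    have iff: "y \<in> ?F #> inv b \<longleftrightarrow> a \<otimes> y \<otimes> b \<in> E" if "y \<in> carrier G" for y
      using that EG F by (simp add: mem_r_coset_iff mem_l_coset_iff m_assoc)
    have sub: "y \<in> H" if "y \<in> carrier G" "a \<otimes> y \<otimes> b \<in> E" for y
    proof -
      have "D (a \<otimes> y \<otimes> b) = 1" using that E by (auto simp: H_iff)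
      then have "D y * (D a * D b) = 1" using that by (simp add: D_mult mult_ac)
      then show ?thesis using that admD(3)[OF ab] by (simp add: H_iff)
    qed
    have "?F #> inv b \<subseteq> carrier G" using F by (auto simp: r_coset_def subset_iff)
    then have eq: "?t -` E \<inter> space \<nu> = ?F #> inv b"
      using iff sub by (auto simp: space_\<nu> H_iff)
    have "emeasure (distr \<nu> \<nu> ?t) E = emeasure \<nu> (?F #> inv b)"
      using meas E by (simp add: emeasure_distr eq)
    also have "\<dots> = emeasure M (?F #> inv b)"
    proof (rule emeasure_\<nu>)
      show "?F #> inv b \<in> sets M" using F by (intro r_coset_sets) auto
      show "?F #> inv b \<subseteq> H" using eq space_\<nu> by blast
    qed
    also have "\<dots> = ennreal (inverse (D b)) * emeasure M E"
      using F E by (simp add: emeasure_r_coset emeasure_l_coset)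
    also have "\<dots> = emeasure (density \<nu> (\<lambda>_. ennreal (inverse (D b)))) E"
      using E by (simp add: emeasure_density_const emeasure_\<nu>)
    finally show "emeasure (distr \<nu> \<nu> ?t) E = emeasure (density \<nu> (\<lambda>_. ennreal (inverse (D b)))) E" .
  qed simp
qed

lemma AE_translation:
  assumes ab: "adm a b" and P: "AE x in \<nu>. P x"
  shows "AE x in \<nu>. P (a \<otimes> x \<otimes> b)"
proof -
  obtain N where N: "N \<in> null_sets \<nu>" "{x \<in> space \<nu>. \<not> P x} \<subseteq> N" using P by (auto elim!: AE_E)
  have "emeasure (distr \<nu> \<nu> (\<lambda>y. a \<otimes> y \<otimes> b)) N = 0"
    using N(1) by (simp add: distr_translation(2)[OF ab] emeasure_density_const null_sets_def)
  then have "(\<lambda>y. a \<otimes> y \<otimes> b) -` N \<inter> space \<nu> \<in> null_sets \<nu>"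
    using N(1) distr_translation(1)[OF ab]
      by (auto simp: emeasure_distr null_sets_def intro: measurable_sets)
  then show ?thesis
  proof (rule AE_I')
    show "{x \<in> space \<nu>. \<not> P (a \<otimes> x \<otimes> b)} \<subseteq> (\<lambda>y. a \<otimes> y \<otimes> b) -` N \<inter> space \<nu>"
      using N(2) adm_mem[OF ab] by (auto simp: space_\<nu>)
  qed
qed

lemma integral_translation:
  fixes h :: "'a \<Rightarrow> 'c :: {banach, second_countable_topology}"
  assumes ab: "adm a b" and h: "h \<in> borel_measurable \<nu>"
  shows "(\<integral>y. h (a \<otimes> y \<otimes> b) \<partial>\<nu>) = inverse (D b) *\<^sub>R (\<integral>y. h y \<partial>\<nu>)"
    and "integrable \<nu> (\<lambda>y. h (a \<otimes> y \<otimes> b)) \<longleftrightarrow> integrable \<nu> h"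
proof -
  have Db: "0 < D b" using D_pos admD(2)[OF ab] by simp
  have "(\<integral>y. h (a \<otimes> y \<otimes> b) \<partial>\<nu>) = (\<integral>y. h y \<partial>distr \<nu> \<nu> (\<lambda>y. a \<otimes> y \<otimes> b))"
    using h by (intro integral_distr[symmetric] distr_translation(1)[OF ab])
  also have "\<dots> = inverse (D b) *\<^sub>R (\<integral>y. h y \<partial>\<nu>)"
    unfolding distr_translation(2)[OF ab] using h Db by (subst integral_density) auto
  finally show "(\<integral>y. h (a \<otimes> y \<otimes> b) \<partial>\<nu>) = inverse (D b) *\<^sub>R (\<integral>y. h y \<partial>\<nu>)" .
  have "integrable \<nu> (\<lambda>y. h (a \<otimes> y \<otimes> b)) \<longleftrightarrow> integrable (distr \<nu> \<nu> (\<lambda>y. a \<otimes> y \<otimes> b)) h"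
    using h by (intro integrable_distr_eq[symmetric] distr_translation(1)[OF ab])
  also have "\<dots> \<longleftrightarrow> integrable \<nu> (\<lambda>y. inverse (D b) *\<^sub>R h y)"
    unfolding distr_translation(2)[OF ab] using h Db by (subst integrable_density) auto
  also have "\<dots> \<longleftrightarrow> integrable \<nu> h"
    using integrable_scaleR_right[of "D b" \<nu> "\<lambda>y. inverse (D b) *\<^sub>R h y"] Db by auto
  finally show "integrable \<nu> (\<lambda>y. h (a \<otimes> y \<otimes> b)) \<longleftrightarrow> integrable \<nu> h" .
qed

text \<open>The factor makes this operator unitary on \<open>L\<^sup>2(\<nu>)\<close>. Left and right translations, conjugations,
  and the passage between different cosets of the kernel are all of this form.\<close>

definition tr :: "'a \<Rightarrow> 'a \<Rightarrow> ('a \<Rightarrow> complex) set \<Rightarrow> ('a \<Rightarrow> complex) set" where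
  "tr a b = (\<lambda>v\<in>vecs (L2 \<nu>). L2_class \<nu> (\<lambda>x. of_real (sqrt (D b)) * L2_rep v (a \<otimes> x \<otimes> b)))"

sublocale L2: hilb_space "L2 \<nu>" by (rule L2_hilb_space)

lemma translate_square_integrable:
  assumes ab: "adm a b" and f: "f \<in> square_integrable \<nu>"
  shows "(\<lambda>x. of_real (sqrt (D b)) * f (a \<otimes> x \<otimes> b)) \<in> square_integrable \<nu>"
proof (rule square_integrable_cmult)
  show "(\<lambda>x. f (a \<otimes> x \<otimes> b)) \<in> square_integrable \<nu>"
    unfolding square_integrable_iff
  proof
    show "(\<lambda>x. f (a \<otimes> x \<otimes> b)) \<in> borel_measurable \<nu>"
      using measurable_compose[OF distr_translation(1)[OF ab] square_integrable_measurable[OF f]] .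
    show "integrable \<nu> (\<lambda>x. (cmod (f (a \<otimes> x \<otimes> b)))\<^sup>2)"
      using f by (subst integral_translation(2)[OF ab]) (auto simp: square_integrable_iff)
  qed
qed

lemma tr_class:
  assumes ab: "adm a b" and f: "f \<in> square_integrable \<nu>"
  shows "tr a b (L2_class \<nu> f) = L2_class \<nu> (\<lambda>x. of_real (sqrt (D b)) * f (a \<otimes> x \<otimes> b))"
proof -
  have "AE x in \<nu>. L2_rep (L2_class \<nu> f) (a \<otimes> x \<otimes> b) = f (a \<otimes> x \<otimes> b)"
    by (rule AE_translation[OF ab L2_rep_class_AE[OF f]])
  then show ?thesis using f by (auto simp: tr_def L2_class_mem intro!: L2_class_cong)
qed

lemma tr_mem [simp]: "adm a b \<Longrightarrow> v \<in> vecs (L2 \<nu>) \<Longrightarrow> tr a b v \<in> vecs (L2 \<nu>)"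
  by (erule L2_vecsE) (simp add: tr_class L2_class_mem translate_square_integrable)

lemma tr_tr:
  assumes ab: "adm a b" and cd: "adm c d" and v: "v \<in> vecs (L2 \<nu>)"
  shows "tr a b (tr c d v) = tr (c \<otimes> a) (b \<otimes> d) v"
proof -
  obtain f where f: "f \<in> square_integrable \<nu>" "v = L2_class \<nu> f" using v by (rule L2_vecsE)
  have "tr a b (tr c d v) = L2_class \<nu> (\<lambda>x. of_real (sqrt (D b)) * (of_real (sqrt (D d)) * f (c \<otimes> (a \<otimes> x \<otimes> b) \<otimes> d)))"
    unfolding f(2) tr_class[OF cd f(1)] by (rule tr_class[OF ab translate_square_integrable[OF cd f(1)]])
  also have "\<dots> = L2_class \<nu> (\<lambda>x. of_real (sqrt (D (b \<otimes> d))) * f ((c \<otimes> a) \<otimes> x \<otimes> (b \<otimes> d)))"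
  proof (rule L2_class_cong_space)
    fix x assume "x \<in> space \<nu>"
    then have "x \<in> carrier G" by (simp add: space_\<nu> H_iff)
    then show "of_real (sqrt (D b)) * (of_real (sqrt (D d)) * f (c \<otimes> (a \<otimes> x \<otimes> b) \<otimes> d))
       = of_real (sqrt (D (b \<otimes> d))) * f ((c \<otimes> a) \<otimes> x \<otimes> (b \<otimes> d))"
      using admD[OF ab] admD[OF cd] by (simp add: D_mult m_assoc real_sqrt_mult)
  qed
  also have "\<dots> = tr (c \<otimes> a) (b \<otimes> d) v" unfolding f(2)
    by (rule tr_class[OF adm_mult[OF ab cd] f(1), symmetric])
  finally show ?thesis .
qed

lemma tr_one:
  assumes v: "v \<in> vecs (L2 \<nu>)" shows "tr \<one> \<one> v = v"
proof -
  obtain f where f: "f \<in> square_integrable \<nu>" "v = L2_class \<nu> f" using v by (rule L2_vecsE)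
  show ?thesis unfolding f(2) tr_class[OF adm_one f(1)]
    by (rule L2_class_cong_space) (simp add: space_\<nu> H_iff)
qed

lemma tr_isometry:
  assumes ab: "adm a b" and v: "v \<in> vecs (L2 \<nu>)" and w: "w \<in> vecs (L2 \<nu>)"
  shows "vinner (L2 \<nu>) (tr a b v) (tr a b w) = vinner (L2 \<nu>) v w"
proof -
  obtain f where f: "f \<in> square_integrable \<nu>" "v = L2_class \<nu> f" using v by (rule L2_vecsE)
  obtain g where g: "g \<in> square_integrable \<nu>" "w = L2_class \<nu> g" using w by (rule L2_vecsE)
  note [measurable] = square_integrable_measurable[OF f(1)] square_integrable_measurable[OF g(1)]
  have Db: "0 < D b" using D_pos admD(2)[OF ab] by simp
  have sq: "complex_of_real (sqrt (D b)) * complex_of_real (sqrt (D b)) = of_real (D b)"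
    using Db by (simp flip: of_real_mult)
  have "vinner (L2 \<nu>) (tr a b v) (tr a b w) =
     (\<integral>x. of_real (D b) * (f (a \<otimes> x \<otimes> b) * cnj (g (a \<otimes> x \<otimes> b))) \<partial>\<nu>)"
    unfolding f(2) g(2) tr_class[OF ab f(1)] tr_class[OF ab g(1)]
      L2_inner_class[OF translate_square_integrable[OF ab f(1)] translate_square_integrable[OF ab g(1)]]
    by (intro Bochner_Integration.integral_cong) (auto simp: sq[symmetric])
  also have "\<dots> = of_real (D b) * (\<integral>x. f (a \<otimes> x \<otimes> b) * cnj (g (a \<otimes> x \<otimes> b)) \<partial>\<nu>)"
    by (rule integral_mult_right_zero)
  also have "(\<integral>x. f (a \<otimes> x \<otimes> b) * cnj (g (a \<otimes> x \<otimes> b)) \<partial>\<nu>) = inverse (D b) *\<^sub>R (\<integral>x. f x * cnj (g x) \<partial>\<nu>)"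
    by (rule integral_translation(1)[OF ab, of "\<lambda>x. f x * cnj (g x)"]) measurable
  also have "of_real (D b) * (inverse (D b) *\<^sub>R (\<integral>x. f x * cnj (g x) \<partial>\<nu>)) = (\<integral>x. f x * cnj (g x) \<partial>\<nu>)"
    using Db by (simp add: scaleR_conv_of_real)
  finally show ?thesis by (simp add: f g L2_inner_class)
qed

lemma tr_inverse:
  assumes ab: "adm a b" and v: "v \<in> vecs (L2 \<nu>)"
  shows "tr a b (tr (inv a) (inv b) v) = v" "tr (inv a) (inv b) (tr a b v) = v"
  using tr_tr[OF ab adm_inv[OF ab] v] tr_tr[OF adm_inv[OF ab] ab v] admD[OF ab] tr_one[OF v]
    by simp_all

lemma tr_adjoint: "adm a b \<Longrightarrow> L2.adjoint_pair (tr a b) (tr (inv a) (inv b))"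
  unfolding L2.adjoint_pair_def
  using tr_isometry[of a b] tr_inverse(1)[of a b] tr_mem[OF adm_inv] by metis

lemma tr_norm: "adm a b \<Longrightarrow> v \<in> vecs (L2 \<nu>) \<Longrightarrow> vnorm (L2 \<nu>) (tr a b v) = vnorm (L2 \<nu>) v"
  by (simp add: vnorm_def tr_isometry)

lemma tr_extensional: "tr a b \<in> extensional (vecs (L2 \<nu>))"
  by (simp add: tr_def)

lemma tr_bounded: "adm a b \<Longrightarrow> tr a b \<in> bounded_ops (L2 \<nu>)"
  by (rule L2.bounded_opsI[OF tr_extensional _ _ tr_adjoint, of a b 1]) (auto simp: tr_norm adm_inv)

lemma tr_unitary_pair: "adm a b \<Longrightarrow> L2.unitary_pair (tr a b) (tr (inv a) (inv b))"
  by (simp add: L2.unitary_pair_def tr_bounded adm_inv tr_adjoint tr_inverse)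

subsection \<open>The group von Neumann algebra of the kernel\<close>

lemma left_regular_eq_tr:
  assumes h: "h \<in> H"
  shows "left_regular G1 \<nu> h = tr (inv h) \<one>"
proof -
  have "inv\<^bsub>G1\<^esub> h = inv h" using subgroup_H h by (simp add: m_inv_consistent)
  then show ?thesis
    using h unfolding left_regular_def tr_def
    by (intro restrict_ext L2_class_cong_space) (simp add: space_\<nu> H_iff)
qed

definition left_translations :: "(('a \<Rightarrow> complex) set \<Rightarrow> ('a \<Rightarrow> complex) set) set" where
  "left_translations = (\<lambda>h. tr h \<one>) ` H"

lemma H_inv: "h \<in> H \<Longrightarrow> inv h \<in> H"
  using subgroup.m_inv_closed[OF subgroup_H] .

lemma left_regular_image: "left_regular G1 \<nu> ` carrier G1 = left_translations"
proof -
  have "left_regular G1 \<nu> ` carrier G1 = (\<lambda>h. tr (inv h) \<one>) ` H"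
    by (intro image_cong) (auto simp: left_regular_eq_tr)
  also have "\<dots> = left_translations"
    unfolding left_translations_def
  proof (intro subset_antisym image_subsetI)
    fix h assume h: "h \<in> H"
    show "tr (inv h) \<one> \<in> (\<lambda>h. tr h \<one>) ` H" using H_inv[OF h] by blast
    have "tr h \<one> = tr (inv (inv h)) \<one>" using h by (simp add: H_iff)
    then show "tr h \<one> \<in> (\<lambda>h. tr (inv h) \<one>) ` H" using H_inv[OF h] by (rule image_eqI)
  qed
  finally show ?thesis .
qed

lemma group_vna_eq: "group_vna G1 \<nu> = commutant (L2 \<nu>) (commutant (L2 \<nu>) left_translations)"
  by (simp only: group_vna_def left_regular_image)

lemma left_translations_bounded: "left_translations \<subseteq> bounded_ops (L2 \<nu>)"
  by (auto simp: left_translations_def tr_bounded adm_H)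

lemma left_translations_adjoint: "A \<in> left_translations \<Longrightarrow> \<exists>A'\<in>left_translations. L2.adjoint_pair A A'"
  using tr_adjoint[OF adm_H(1)] H_inv by (fastforce simp: left_translations_def)

lemma op_mult_tr: "adm a b \<Longrightarrow> adm c d \<Longrightarrow> op_mult (L2 \<nu>) (tr a b) (tr c d) = tr (c \<otimes> a) (b \<otimes> d)"
  by (rule L2.bounded_ext) (auto simp: L2.op_mult_bounded tr_bounded adm_mult L2.op_mult_apply tr_tr)

lemma left_translations_mult: "A \<in> left_translations \<Longrightarrow> B \<in> left_translations \<Longrightarrow> op_mult (L2 \<nu>) A B \<in> left_translations"
  using op_mult_tr[OF adm_H(1) adm_H(1)] subgroup.m_closed[OF subgroup_H]
    by (auto simp: left_translations_def)

lemma left_translations_one: "tr \<one> \<one> \<in> left_translations"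
  unfolding left_translations_def by (rule image_eqI[OF refl]) (simp add: H_iff)

lemma conj_tr:
  assumes ab: "adm a b" and h: "h \<in> H"
  shows "L2.conj_op (tr a b) (tr (inv a) (inv b)) (tr h \<one>) = tr (inv a \<otimes> h \<otimes> a) \<one>"
  unfolding L2.conj_op_def op_mult_tr[OF ab adm_H(1)[OF h]] op_mult_tr[OF adm_mult[OF ab adm_H(1)[OF h]] adm_inv[OF ab]]
  using admD[OF ab] h by (simp add: m_assoc H_iff)

lemma conj_H: "a \<in> carrier G \<Longrightarrow> h \<in> H \<Longrightarrow> inv a \<otimes> h \<otimes> a \<in> H"
  using D_pos[of a] by (simp add: H_iff D_mult)

text \<open>The automorphism of the cocycle action is conjugation by a translation: this has the
  required values on the generators, and these values determine it.\<close>

lemma section_action_eq: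
  assumes k: "k \<in> K"
  defines "s \<equiv> \<sigma> (inverse k)"
  shows "section_action G \<mu> \<nu> \<sigma> k = (\<lambda>A\<in>group_vna G1 \<nu>. L2.conj_op (tr s (inv s)) (tr (inv s) s) A)"
proof -
  have s: "s \<in> carrier G" using k by (auto simp: s_def)
  have ss: "adm s (inv s)" using s D_pos[OF s] by (simp add: adm_def)
  have inv_inv: "inv (inv s) = s" using s by simp
  let ?U = "tr s (inv s)" and ?U' = "tr (inv s) s"
    and ?a = "(\<lambda>A\<in>group_vna G1 \<nu>. L2.conj_op (tr s (inv s)) (tr (inv s) s) A)"
  have up: "L2.unitary_pair ?U ?U'" using tr_unitary_pair[OF ss] by (simp add: inv_inv)
  have c1: "L2.conj_op ?U ?U' (tr h \<one>) = tr (inv s \<otimes> h \<otimes> s) \<one>" if "h \<in> H" for h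
    using conj_tr[OF ss that] by (simp add: inv_inv)
  have c2: "L2.conj_op ?U' ?U (tr h \<one>) = tr (s \<otimes> h \<otimes> inv s) \<one>" if "h \<in> H" for h
    using conj_tr[OF adm_inv[OF ss] that] s by (simp add: inv_inv)
  have aut: "?a \<in> vna_aut (L2 \<nu>) (group_vna G1 \<nu>)"
    unfolding group_vna_eq
  proof (rule L2.conj_vna_aut[OF up left_translations_bounded left_translations_adjoint])
    fix A assume "A \<in> left_translations"
    then obtain h where h: "h \<in> H" "A = tr h \<one>" by (auto simp: left_translations_def)
    show "L2.conj_op ?U ?U' A \<in> left_translations" unfolding h(2) c1[OF h(1)]
      using conj_H[OF s h(1)] by (auto simp: left_translations_def)
    show "L2.conj_op ?U' ?U A \<in> left_translations" unfolding h(2) c2[OF h(1)]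
      using conj_H[OF inv_closed[OF s] h(1)] s by (auto simp: left_translations_def)
  qed
  have lr_mem: "left_regular G1 \<nu> h \<in> group_vna G1 \<nu>" if "h \<in> H" for h
    using L2.subset_bicommutant[OF left_translations_bounded] that
    unfolding group_vna_eq left_regular_image[symmetric] by auto
  have val: "?a (left_regular G1 \<nu> h) = left_regular G1 \<nu> (section_conj G \<sigma> k h)" if h: "h \<in> H" for h
  proof -
    have "section_conj G \<sigma> k h = inv s \<otimes> h \<otimes> s" by (simp add: section_conj_def s_def)
    moreover have "inv (inv s \<otimes> h \<otimes> s) = inv s \<otimes> inv h \<otimes> s" using s h
      by (simp add: inv_mult_group m_assoc H_iff)
    ultimately show ?thesis
      using lr_mem[OF h] c1[OF H_inv[OF h]] conj_H[OF s h]
        by (simp add: left_regular_eq_tr[OF h] left_regular_eq_tr)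
  qed
  show ?thesis
    unfolding section_action_def Let_def
  proof (rule the_equality)
    show "?a \<in> vna_aut (L2 \<nu>) (group_vna G1 \<nu>) \<and>
       (\<forall>h\<in>carrier G1. ?a (left_regular G1 \<nu> h) = left_regular G1 \<nu> (section_conj G \<sigma> k h))"
      using aut val by simp
    fix a assume a: "a \<in> vna_aut (L2 \<nu>) (group_vna G1 \<nu>) \<and>
       (\<forall>h\<in>carrier G1. a (left_regular G1 \<nu> h) = left_regular G1 \<nu> (section_conj G \<sigma> k h))"
    show "a = ?a"
    proof (rule L2.vna_aut_unique[OF left_translations_bounded left_translations_adjoint left_translations_mult left_translations_one tr_one])
      show "a \<in> vna_aut (L2 \<nu>) (commutant (L2 \<nu>) (commutant (L2 \<nu>) left_translations))" using a
        by (simp only: group_vna_eq)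
      show "?a \<in> vna_aut (L2 \<nu>) (commutant (L2 \<nu>) (commutant (L2 \<nu>) left_translations))" using aut
        by (simp only: group_vna_eq)
      fix A assume "A \<in> left_translations"
      then obtain h where h: "h \<in> H" "A = left_regular G1 \<nu> h"
        unfolding left_regular_image[symmetric] by auto
      then show "a A = ?a A" using a val by (simp only: h(2)) simp
    qed
  qed
qed

end

section \<open>The crossed product as an algebra on the whole group\<close>

context modular_section
begin

abbreviation Kg where "Kg \<equiv> modular_range_group G \<mu>"

lemma carrier_Kg: "carrier Kg = K"
  by (simp add: modular_range_group_def)

lemma mult_Kg: "k \<otimes>\<^bsub>Kg\<^esub> l = k * l"
  by (simp add: modular_range_group_def)

lemma group_Kg: "group Kg"
proof (rule groupI)
  fix k assume k: "k \<in> carrier Kg"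
  then have k': "k \<in> K" by (simp add: carrier_Kg)
  show "\<exists>l\<in>carrier Kg. l \<otimes>\<^bsub>Kg\<^esub> k = \<one>\<^bsub>Kg\<^esub>"
    using K_inverse[OF k'] K_pos[OF k'] by (intro bexI[of _ "inverse k"]) (auto simp: modular_range_group_def)
qed (auto simp: modular_range_group_def mult.assoc simp del: D_one intro: K_mult[unfolded image_def] one_in_K)

lemma inv_Kg: "k \<in> K \<Longrightarrow> inv\<^bsub>Kg\<^esub> k = inverse k"
  using K_pos[of k] K_inverse[of k] by (intro group.inv_equality[OF group_Kg]) (auto simp: modular_range_group_def)

abbreviation L where "L \<equiv> l2 K (L2 \<nu>)"

sublocale L: hilb_space L by (rule L2.l2_hilb_space)

lemma L_component: "\<xi> \<in> vecs L \<Longrightarrow> k \<in> K \<Longrightarrow> \<xi> k \<in> vecs (L2 \<nu>)"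
  by (rule L2.l2_closed)

lemma L_ext:
  assumes "\<xi> \<in> vecs L" "\<eta> \<in> vecs L" "\<And>k. k \<in> K \<Longrightarrow> \<xi> k = \<eta> k"
  shows "\<xi> = \<eta>"
  using assms by (intro extensionalityI[of _ K]) (auto simp: L2.l2_mem_iff PiE_def)

text \<open>Write \<open>g \<in> G\<close> as \<open>\<sigma> k \<otimes> y\<close> with \<open>k = D g\<close> and \<open>y\<close> in the kernel. This identifies
  \<open>\<ell>\<^sup>2(K, L\<^sup>2(\<nu>))\<close> with \<open>L\<^sup>2(G)\<close>, and \<open>B a b\<close> is the operator
  \<open>F \<mapsto> (\<lambda>g. sqrt (D b) * F (a \<otimes> g \<otimes> b))\<close> in this picture.\<close>

definition B :: "'a \<Rightarrow> 'a \<Rightarrow> (real \<Rightarrow> ('a \<Rightarrow> complex) set) \<Rightarrow> real \<Rightarrow> ('a \<Rightarrow> complex) set" where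
  "B a b = (\<lambda>\<xi>\<in>vecs L. \<lambda>k\<in>K. tr (inv (\<sigma> (D a * k * D b)) \<otimes> a \<otimes> \<sigma> k) b (\<xi> (D a * k * D b)))"

lemma B_apply: "\<xi> \<in> vecs L \<Longrightarrow> k \<in> K \<Longrightarrow>
    B a b \<xi> k = tr (inv (\<sigma> (D a * k * D b)) \<otimes> a \<otimes> \<sigma> k) b (\<xi> (D a * k * D b))"
  by (simp add: B_def)

lemma D_in_K: "a \<in> carrier G \<Longrightarrow> D a \<in> K"
  by (rule imageI)

lemma index_in_K: "a \<in> carrier G \<Longrightarrow> b \<in> carrier G \<Longrightarrow> k \<in> K \<Longrightarrow> D a * k * D b \<in> K"
  by (intro K_mult D_in_K)

lemma bij_index:
  assumes "a \<in> carrier G" "b \<in> carrier G"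
  shows "bij_betw (\<lambda>k. D a * k * D b) K K"
proof (rule bij_betw_byWitness[where f' = "\<lambda>k. inverse (D a) * k * inverse (D b)"])
  show "(\<lambda>k. D a * k * D b) ` K \<subseteq> K" "(\<lambda>k. inverse (D a) * k * inverse (D b)) ` K \<subseteq> K"
    using assms by (auto intro!: index_in_K K_mult K_inverse D_in_K simp del: D_inv)
  have "D a \<noteq> 0" "D b \<noteq> 0" using D_pos assms by (metis less_irrefl)+
  then show "\<forall>k\<in>K. inverse (D a) * (D a * k * D b) * inverse (D b) = k"
    "\<forall>k\<in>K. D a * (inverse (D a) * k * inverse (D b)) * D b = k" by auto
qed

lemma adm_index:
  assumes "a \<in> carrier G" "b \<in> carrier G" "k \<in> K"
  shows "adm (inv (\<sigma> (D a * k * D b)) \<otimes> a \<otimes> \<sigma> k) b"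
proof -
  have "0 < D a" "0 < k" "0 < D b" using assms D_pos K_pos by blast+
  then show ?thesis
    using assms index_in_K[OF assms] by (simp add: adm_def D_mult) (simp add: field_simps)
qed

lemma B_component:
  assumes "a \<in> carrier G" "b \<in> carrier G" "k \<in> K" "\<xi> \<in> vecs L"
  shows "B a b \<xi> k \<in> vecs (L2 \<nu>)"
    and "vnorm (L2 \<nu>) (B a b \<xi> k) = vnorm (L2 \<nu>) (\<xi> (D a * k * D b))"
  using assms adm_index[OF assms(1-3)] L_component[OF assms(4) index_in_K[OF assms(1-3)]]
  by (simp_all add: B_apply tr_norm)

lemma B_mem [simp]:
  assumes ab: "a \<in> carrier G" "b \<in> carrier G" and \<xi>: "\<xi> \<in> vecs L"
  shows "B a b \<xi> \<in> vecs L"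
proof (rule L2.l2_memI)
  show "(\<lambda>k. (vnorm (L2 \<nu>) (\<xi> (D a * k * D b)))\<^sup>2) summable_on K"
    using \<xi> by (subst summable_on_reindex_bij_betw[OF bij_index[OF ab]]) (simp add: L2.l2_mem_iff)
  show "B a b \<xi> \<in> extensional K" using \<xi> by (simp add: B_def)
qed (use B_component[OF ab _ \<xi>] in auto)

lemma B_isometry:
  assumes ab: "a \<in> carrier G" "b \<in> carrier G" and \<xi>: "\<xi> \<in> vecs L" and \<eta>: "\<eta> \<in> vecs L"
  shows "vinner L (B a b \<xi>) (B a b \<eta>) = vinner L \<xi> \<eta>"
proof -
  have "vinner L (B a b \<xi>) (B a b \<eta>) = (\<Sum>\<^sub>\<infinity>k\<in>K. vinner (L2 \<nu>) (\<xi> (D a * k * D b)) (\<eta> (D a * k * D b)))"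
    unfolding L2.l2_vinner using \<xi> \<eta>
    by (intro infsum_cong) (simp add: B_apply tr_isometry adm_index[OF ab] L_component index_in_K[OF ab])
  also have "\<dots> = vinner L \<xi> \<eta>"
    unfolding L2.l2_vinner by (rule infsum_reindex_bij_betw[OF bij_index[OF ab]])
  finally show ?thesis .
qed

lemma B_B:
  assumes ab: "a \<in> carrier G" "b \<in> carrier G" and cd: "c \<in> carrier G" "d \<in> carrier G"
    and \<xi>: "\<xi> \<in> vecs L"
  shows "B a b (B c d \<xi>) = B (c \<otimes> a) (b \<otimes> d) \<xi>"
proof (rule L_ext)
  fix k assume k: "k \<in> K"
  let ?i = "D a * k * D b" and ?j = "D c * (D a * k * D b) * D d"
  have i: "?i \<in> K" and j: "?j \<in> K" using index_in_K[OF ab k] index_in_K[OF cd] by auto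
  have j': "D (c \<otimes> a) * k * D (b \<otimes> d) = ?j" using ab cd by (simp add: D_mult mult_ac)
  have "B a b (B c d \<xi>) k = tr (inv (\<sigma> ?i) \<otimes> a \<otimes> \<sigma> k) b (tr (inv (\<sigma> ?j) \<otimes> c \<otimes> \<sigma> ?i) d (\<xi> ?j))"
    using k i ab cd \<xi> by (simp add: B_apply)
  also have "\<dots> = tr ((inv (\<sigma> ?j) \<otimes> c \<otimes> \<sigma> ?i) \<otimes> (inv (\<sigma> ?i) \<otimes> a \<otimes> \<sigma> k)) (b \<otimes> d) (\<xi> ?j)"
    by (rule tr_tr[OF adm_index[OF ab k] adm_index[OF cd i] L_component[OF \<xi> j]])
  also have "(inv (\<sigma> ?j) \<otimes> c \<otimes> \<sigma> ?i) \<otimes> (inv (\<sigma> ?i) \<otimes> a \<otimes> \<sigma> k) = inv (\<sigma> ?j) \<otimes> (c \<otimes> a) \<otimes> \<sigma> k"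
  proof -
    note cl = \<sigma>_closed[OF i] \<sigma>_closed[OF j] \<sigma>_closed[OF k]
    have "\<sigma> ?i \<otimes> (inv (\<sigma> ?i) \<otimes> (a \<otimes> \<sigma> k)) = a \<otimes> \<sigma> k"
      using cl ab by (simp add: m_assoc[symmetric])
    then show ?thesis using cl ab cd by (simp add: m_assoc)
  qed
  also have "tr (inv (\<sigma> ?j) \<otimes> (c \<otimes> a) \<otimes> \<sigma> k) (b \<otimes> d) (\<xi> ?j) = B (c \<otimes> a) (b \<otimes> d) \<xi> k"
    using k \<xi> by (simp only: B_apply j')
  finally show "B a b (B c d \<xi>) k = B (c \<otimes> a) (b \<otimes> d) \<xi> k" .
qed (use assms in auto)

lemma B_one:
  assumes \<xi>: "\<xi> \<in> vecs L" shows "B \<one> \<one> \<xi> = \<xi>"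
  using \<xi> by (intro L_ext) (auto simp: B_apply tr_one L_component)

lemma B_inverse:
  assumes ab: "a \<in> carrier G" "b \<in> carrier G" and \<xi>: "\<xi> \<in> vecs L"
  shows "B a b (B (inv a) (inv b) \<xi>) = \<xi>" "B (inv a) (inv b) (B a b \<xi>) = \<xi>"
  using ab \<xi> by (simp_all add: B_B B_one)

lemma B_adjoint:
  assumes ab: "a \<in> carrier G" "b \<in> carrier G"
  shows "L.adjoint_pair (B a b) (B (inv a) (inv b))"
  unfolding L.adjoint_pair_def
proof (intro ballI)
  fix \<xi> \<eta> assume \<xi>: "\<xi> \<in> vecs L" and \<eta>: "\<eta> \<in> vecs L"
  have "vinner L (B a b \<xi>) (B a b (B (inv a) (inv b) \<eta>)) = vinner L \<xi> (B (inv a) (inv b) \<eta>)"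
    using ab \<xi> \<eta> by (intro B_isometry) auto
  then show "vinner L (B a b \<xi>) \<eta> = vinner L \<xi> (B (inv a) (inv b) \<eta>)"
    by (simp only: B_inverse(1)[OF ab \<eta>])
qed

lemma B_bounded:
  assumes ab: "a \<in> carrier G" "b \<in> carrier G"
  shows "B a b \<in> bounded_ops L"
  by (rule L.bounded_opsI[OF _ _ _ B_adjoint[OF ab], of 1]) (use ab in \<open>auto simp: vnorm_def B_isometry, simp add: B_def\<close>)

lemma B_op_adjoint:
  assumes ab: "a \<in> carrier G" "b \<in> carrier G"
  shows "op_adjoint L (B a b) = B (inv a) (inv b)"
  using ab by (intro L.op_adjoint_eq B_bounded B_adjoint) auto

subsection \<open>The generators of the crossed product\<close>

abbreviation embed where "embed \<equiv> crossed_embed (L2 \<nu>) Kg (section_action G \<mu> \<nu> \<sigma>)"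
abbreviation shift where "shift \<equiv> crossed_shift (L2 \<nu>) Kg (section_unitary G \<mu> \<nu> \<sigma>)"
abbreviation N where "N \<equiv> group_vna G1 \<nu>"

lemma N_bounded: "x \<in> N \<Longrightarrow> x \<in> bounded_ops (L2 \<nu>)"
  unfolding group_vna_eq by (rule L2.commutant_bounded)

lemma adm_section: "k \<in> K \<Longrightarrow> adm (\<sigma> k) (inv (\<sigma> k))" "k \<in> K \<Longrightarrow> adm (inv (\<sigma> k)) (\<sigma> k)"
  using K_pos[of k] by (simp_all add: adm_def)

text \<open>The \<open>k\<close>-th component uses the automorphism of \<open>k\<^sup>-\<^sup>1\<close>, which is conjugation by the translation
  with \<open>\<sigma> ((k\<^sup>-\<^sup>1)\<^sup>-\<^sup>1) = \<sigma> k\<close>.\<close>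

lemma embed_apply:
  assumes x: "x \<in> N" and \<xi>: "\<xi> \<in> vecs L" and k: "k \<in> K"
  shows "embed x \<xi> k = tr (\<sigma> k) (inv (\<sigma> k)) (x (tr (inv (\<sigma> k)) (\<sigma> k) (\<xi> k)))"
proof -
  have "embed x \<xi> k = section_action G \<mu> \<nu> \<sigma> (inverse k) x (\<xi> k)"
    using k \<xi> by (simp add: crossed_embed_def carrier_Kg inv_Kg)
  also have "\<dots> = L2.conj_op (tr (\<sigma> k) (inv (\<sigma> k))) (tr (inv (\<sigma> k)) (\<sigma> k)) x (\<xi> k)"
    using x by (simp add: section_action_eq[OF K_inverse[OF k]])
  finally show ?thesis
    using L2.conj_op_apply[OF tr_bounded[OF adm_section(2)[OF k]] L_component[OF \<xi> k]] by simp
qed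

lemma embed_mem:
  assumes x: "x \<in> N"
  obtains C where "\<And>\<xi>. \<xi> \<in> vecs L \<Longrightarrow> embed x \<xi> \<in> vecs L" "\<And>\<xi>. \<xi> \<in> vecs L \<Longrightarrow> vnorm L (embed x \<xi>) \<le> C * vnorm L \<xi>"
proof -
  obtain C where C0: "C \<ge> 0" and C: "\<And>v. v \<in> vecs (L2 \<nu>) \<Longrightarrow> vnorm (L2 \<nu>) (x v) \<le> C * vnorm (L2 \<nu>) v"
    using L2.bounded_bound[OF N_bounded[OF x]] by blast
  have comp: "embed x \<xi> k \<in> vecs (L2 \<nu>)" "(vnorm (L2 \<nu>) (embed x \<xi> k))\<^sup>2 \<le> C\<^sup>2 * (vnorm (L2 \<nu>) (\<xi> k))\<^sup>2"
    if \<xi>: "\<xi> \<in> vecs L" and k: "k \<in> K" for \<xi> k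
  proof -
    let ?v = "tr (inv (\<sigma> k)) (\<sigma> k) (\<xi> k)"
    have v: "?v \<in> vecs (L2 \<nu>)" and nv: "vnorm (L2 \<nu>) ?v = vnorm (L2 \<nu>) (\<xi> k)"
      using adm_section(2)[OF k] L_component[OF \<xi> k] by (simp_all add: tr_norm)
    have xv: "x ?v \<in> vecs (L2 \<nu>)" using N_bounded[OF x] v by simp
    show "embed x \<xi> k \<in> vecs (L2 \<nu>)" unfolding embed_apply[OF x \<xi> k] using adm_section(1)[OF k] xv
      by simp
    have "vnorm (L2 \<nu>) (embed x \<xi> k) \<le> C * vnorm (L2 \<nu>) (\<xi> k)"
      unfolding embed_apply[OF x \<xi> k] using C[OF v] nv xv
        by (simp add: tr_norm[OF adm_section(1)[OF k]])
    then show "(vnorm (L2 \<nu>) (embed x \<xi> k))\<^sup>2 \<le> C\<^sup>2 * (vnorm (L2 \<nu>) (\<xi> k))\<^sup>2"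
      using \<open>embed x \<xi> k \<in> vecs (L2 \<nu>)\<close> by (metis L2.norm_nonneg power_mono power_mult_distrib)
  qed
  have mem: "embed x \<xi> \<in> vecs L" if \<xi>: "\<xi> \<in> vecs L" for \<xi>
  proof (rule L2.l2_memI[OF comp(1)[OF \<xi>] _ _ comp(2)[OF \<xi>]])
    show "(\<lambda>k. C\<^sup>2 * (vnorm (L2 \<nu>) (\<xi> k))\<^sup>2) summable_on K"
      using \<xi> by (intro summable_on_cmult_right) (simp add: L2.l2_mem_iff)
    show "embed x \<xi> \<in> extensional K" using \<xi> by (simp add: crossed_embed_def carrier_Kg)
  qed
  have "vnorm L (embed x \<xi>) \<le> C * vnorm L \<xi>" if \<xi>: "\<xi> \<in> vecs L" for \<xi>
  proof (rule power2_le_imp_le)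
    have "(vnorm L (embed x \<xi>))\<^sup>2 = (\<Sum>\<^sub>\<infinity>k\<in>K. (vnorm (L2 \<nu>) (embed x \<xi> k))\<^sup>2)"
      by (rule L2.l2_norm_sq[OF mem[OF \<xi>]])
    also have "\<dots> \<le> (\<Sum>\<^sub>\<infinity>k\<in>K. C\<^sup>2 * (vnorm (L2 \<nu>) (\<xi> k))\<^sup>2)"
      using mem[OF \<xi>] \<xi> comp(2)[OF \<xi>] by (intro infsum_mono summable_on_cmult_right) (auto simp: L2.l2_mem_iff)
    also have "\<dots> = C\<^sup>2 * (\<Sum>\<^sub>\<infinity>k\<in>K. (vnorm (L2 \<nu>) (\<xi> k))\<^sup>2)" by (rule infsum_cmult_right')
    also have "\<dots> = (C * vnorm L \<xi>)\<^sup>2" by (simp add: L2.l2_norm_sq[OF \<xi>] power_mult_distrib)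
    finally show "(vnorm L (embed x \<xi>))\<^sup>2 \<le> (C * vnorm L \<xi>)\<^sup>2" .
  qed (use C0 \<xi> in simp)
  with mem show ?thesis using that by blast
qed

lemma N_adjoint: "x \<in> N \<Longrightarrow> op_adjoint (L2 \<nu>) x \<in> N"
  unfolding group_vna_eq by (rule L2.bicommutant_adjoint[OF left_translations_bounded left_translations_adjoint])

lemma embed_adjoint_pair:
  assumes x: "x \<in> N"
  shows "L.adjoint_pair (embed x) (embed (op_adjoint (L2 \<nu>) x))"
  unfolding L.adjoint_pair_def
proof (intro ballI)
  fix \<xi> \<eta> assume \<xi>: "\<xi> \<in> vecs L" and \<eta>: "\<eta> \<in> vecs L"
  let ?x' = "op_adjoint (L2 \<nu>) x"
  show "vinner L (embed x \<xi>) \<eta> = vinner L \<xi> (embed ?x' \<eta>)"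
    unfolding L2.l2_vinner
  proof (rule infsum_cong)
    fix k assume k: "k \<in> K"
    let ?U = "tr (\<sigma> k) (inv (\<sigma> k))" and ?U' = "tr (inv (\<sigma> k)) (\<sigma> k)"
    have UU': "L2.adjoint_pair ?U ?U'" "L2.adjoint_pair ?U' ?U"
      using tr_adjoint[OF adm_section(1)[OF k]] tr_adjoint[OF adm_section(2)[OF k]] k by simp_all
    have mem: "?U v \<in> vecs (L2 \<nu>)" "?U' v \<in> vecs (L2 \<nu>)" "x v \<in> vecs (L2 \<nu>)" "?x' v \<in> vecs (L2 \<nu>)"
      if "v \<in> vecs (L2 \<nu>)" for v
      using that adm_section[OF k] N_bounded[OF x] N_bounded[OF N_adjoint[OF x]] by simp_all
    have c: "\<xi> k \<in> vecs (L2 \<nu>)" "\<eta> k \<in> vecs (L2 \<nu>)" using \<xi> \<eta> k by (auto intro: L_component)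
    show "vinner (L2 \<nu>) (embed x \<xi> k) (\<eta> k) = vinner (L2 \<nu>) (\<xi> k) (embed ?x' \<eta> k)"
      unfolding embed_apply[OF x \<xi> k] embed_apply[OF N_adjoint[OF x] \<eta> k]
      using c mem by (simp add: L2.adjoint_pairD[OF UU'(1)] L2.adjoint_pairD[OF L2.op_adjoint_pair[OF N_bounded[OF x]]]
          L2.adjoint_pairD[OF UU'(2)])
  qed
qed

lemma embed_bounded:
  assumes x: "x \<in> N"
  shows "embed x \<in> bounded_ops L"
proof -
  obtain C where C: "\<And>\<xi>. \<xi> \<in> vecs L \<Longrightarrow> embed x \<xi> \<in> vecs L" "\<And>\<xi>. \<xi> \<in> vecs L \<Longrightarrow> vnorm L (embed x \<xi>) \<le> C * vnorm L \<xi>"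
    using embed_mem[OF x] by blast
  obtain C' where C': "\<And>\<xi>. \<xi> \<in> vecs L \<Longrightarrow> embed (op_adjoint (L2 \<nu>) x) \<xi> \<in> vecs L"
    using embed_mem[OF N_adjoint[OF x]] by blast
  show ?thesis
    by (rule L.bounded_opsI[OF _ C(1) C' embed_adjoint_pair[OF x] C(2)])
      (unfold crossed_embed_def carrier_Kg, rule restrict_extensional)
qed

lemma embed_op_adjoint: "x \<in> N \<Longrightarrow> op_adjoint L (embed x) = embed (op_adjoint (L2 \<nu>) x)"
  by (intro L.op_adjoint_eq embed_bounded embed_adjoint_pair N_adjoint)

lemma left_translation_in_N: "h \<in> H \<Longrightarrow> tr h \<one> \<in> N"
  using L2.subset_bicommutant[OF left_translations_bounded]
    by (auto simp: group_vna_eq left_translations_def)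

lemma embed_left_translation:
  assumes h: "h \<in> H"
  shows "embed (tr h \<one>) = B h \<one>"
proof (rule L.bounded_ext)
  show "embed (tr h \<one>) \<in> bounded_ops L" by (rule embed_bounded[OF left_translation_in_N[OF h]])
  show "B h \<one> \<in> bounded_ops L" using h by (intro B_bounded) (auto simp: H_iff)
  fix \<xi> assume \<xi>: "\<xi> \<in> vecs L"
  show "embed (tr h \<one>) \<xi> = B h \<one> \<xi>"
  proof (rule L_ext)
    show "embed (tr h \<one>) \<xi> \<in> vecs L" using embed_bounded[OF left_translation_in_N[OF h]] \<xi> by simp
    show "B h \<one> \<xi> \<in> vecs L" using h \<xi> by (simp add: H_iff)
    fix k assume k: "k \<in> K"
    note s = adm_section[OF k] and c = L_component[OF \<xi> k]
    have "embed (tr h \<one>) \<xi> k = tr (inv (\<sigma> k) \<otimes> (h \<otimes> \<sigma> k)) \<one> (\<xi> k)"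
      unfolding embed_apply[OF left_translation_in_N[OF h] \<xi> k]
        tr_tr[OF adm_H(1)[OF h] s(2) c] tr_tr[OF s(1) adm_mult[OF adm_H(1)[OF h] s(2)] c]
      using k h by (simp add: H_iff m_assoc)
    then show "embed (tr h \<one>) \<xi> k = B h \<one> \<xi> k"
      using h k \<xi> by (simp add: B_apply H_iff m_assoc)
  qed
qed

text \<open>The cocycle is exactly what turns \<open>\<sigma> (l\<^sup>-\<^sup>1) \<otimes> \<sigma> k \<otimes> y\<close> into the form \<open>\<sigma> (l\<^sup>-\<^sup>1 k) \<otimes> y'\<close>.\<close>

lemma shift_eq_B:
  assumes l: "l \<in> K"
  shows "shift l = B (\<sigma> (inverse l)) \<one>"
proof -
  have "u (inv\<^bsub>Kg\<^esub> k) l (\<xi> (inv\<^bsub>Kg\<^esub> l \<otimes>\<^bsub>Kg\<^esub> k)) = tr (inv (\<sigma> (D a * k * D \<one>)) \<otimes> a \<otimes> \<sigma> k) \<one> (\<xi> (D a * k * D \<one>))"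
    if k: "k \<in> K" and u: "u = section_unitary G \<mu> \<nu> \<sigma>" and a: "a = \<sigma> (inverse l)" for k u a \<xi>
  proof -
    let ?j = "inverse l * k"
    have j: "?j \<in> K" using k l by blast
    have cl: "\<sigma> k \<in> carrier G" "a \<in> carrier G" "\<sigma> ?j \<in> carrier G" and Da: "D a = inverse l"
      using \<sigma>_closed[OF k] \<sigma>_closed[OF j] \<sigma>_closed[OF K_inverse[OF l]] D_\<sigma>[OF K_inverse[OF l]]
      by (simp_all add: a)
    have c: "section_cocycle G \<sigma> (inverse k) l = inv (\<sigma> k) \<otimes> inv a \<otimes> \<sigma> ?j"
      by (simp add: section_cocycle_def a)
    have cH: "inv (\<sigma> k) \<otimes> inv a \<otimes> \<sigma> ?j \<in> H"
      using cl k l j K_pos[OF k] K_pos[OF l] by (simp add: H_iff D_mult Da) (simp add: field_simps)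
    have "u (inverse k) l = tr (inv (inv (\<sigma> k) \<otimes> inv a \<otimes> \<sigma> ?j)) \<one>"
      unfolding u section_unitary_def c by (rule left_regular_eq_tr[OF cH])
    also have "inv (inv (\<sigma> k) \<otimes> inv a \<otimes> \<sigma> ?j) = inv (\<sigma> ?j) \<otimes> a \<otimes> \<sigma> k"
      using cl by (simp add: inv_mult_group m_assoc)
    finally show ?thesis using k l by (simp add: inv_Kg mult_Kg Da)
  qed
  then show ?thesis
    unfolding crossed_shift_def B_def carrier_Kg by (intro restrict_ext) auto
qed

lemma right_translation_commutes:
  assumes x: "x \<in> N" and t: "t \<in> H" and v: "v \<in> vecs (L2 \<nu>)"
  shows "x (tr \<one> t v) = tr \<one> t (x v)"
proof (rule L2.commutantD[OF x[unfolded group_vna_eq] _ v])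
  show "tr \<one> t \<in> commutant (L2 \<nu>) left_translations"
    unfolding L2.commutant_iff left_translations_def
    using t by (auto simp: tr_bounded adm_H tr_tr H_iff)
qed

text \<open>In the picture on \<open>G\<close>, the operator \<open>embed x\<close> acts by \<open>x\<close> in the left variable of
  \<open>y \<otimes> \<sigma> k\<close>, so it commutes with right translations.\<close>

lemma B_right_embed:
  assumes x: "x \<in> N" and g: "g \<in> carrier G" and \<xi>: "\<xi> \<in> vecs L"
  shows "B \<one> g (embed x \<xi>) = embed x (B \<one> g \<xi>)"
proof (rule L_ext)
  have Bg: "B \<one> g \<xi> \<in> vecs L" and ex: "embed x \<xi> \<in> vecs L" using g \<xi> embed_bounded[OF x] by simp_all
  show "B \<one> g (embed x \<xi>) \<in> vecs L" using g ex by simp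
  show "embed x (B \<one> g \<xi>) \<in> vecs L" using Bg embed_bounded[OF x] by simp
  fix k assume k: "k \<in> K"
  let ?j = "k * D g"
  have j: "?j \<in> K" using k g by (intro K_mult D_in_K)
  define s t where "s = \<sigma> k" and "t = \<sigma> ?j"
  have s: "s \<in> carrier G" "D s = k" and t: "t \<in> carrier G" "D t = ?j" using j k
    by (simp_all add: s_def t_def)
  have pos: "0 < k" "0 < D g" using K_pos[OF k] D_pos[OF g] by simp_all
  have r: "s \<otimes> g \<otimes> inv t \<in> H" using s t g pos by (simp add: H_iff D_mult) (simp add: field_simps)
  have adms: "adm s (inv s)" "adm (inv s) s" "adm t (inv t)" "adm (inv t) t" "adm (inv t \<otimes> s) g" "adm \<one> (s \<otimes> g \<otimes> inv t)"
    using s t g pos r by (simp_all add: adm_def D_mult H_iff) (simp_all add: field_simps)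
  have \<xi>j: "\<xi> ?j \<in> vecs (L2 \<nu>)" using L_component[OF \<xi> j] .
  define v where "v = tr (inv t) t (\<xi> ?j)"
  have v: "v \<in> vecs (L2 \<nu>)" using adms \<xi>j by (simp add: v_def)
  have xv: "x v \<in> vecs (L2 \<nu>)" using N_bounded[OF x] v by simp
  have "B \<one> g (embed x \<xi>) k = tr (inv t \<otimes> s) g (tr t (inv t) (x v))"
    using k j g ex s t by (simp add: B_apply embed_apply[OF x \<xi> j] t_def[symmetric] s_def[symmetric] v_def)
  also have "\<dots> = tr (t \<otimes> (inv t \<otimes> s)) (g \<otimes> inv t) (x v)" by (rule tr_tr[OF adms(5,3) xv])
  also have "t \<otimes> (inv t \<otimes> s) = \<one> \<otimes> s" using s t by (simp add: m_assoc[symmetric])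
  also have "g \<otimes> inv t = inv s \<otimes> (s \<otimes> g \<otimes> inv t)" using s t g by (simp add: m_assoc[symmetric])
  also have "tr (\<one> \<otimes> s) (inv s \<otimes> (s \<otimes> g \<otimes> inv t)) (x v) = tr s (inv s) (tr \<one> (s \<otimes> g \<otimes> inv t) (x v))"
    by (rule tr_tr[OF adms(1,6) xv, symmetric])
  also have "tr \<one> (s \<otimes> g \<otimes> inv t) (x v) = x (tr \<one> (s \<otimes> g \<otimes> inv t) v)"
    by (rule right_translation_commutes[OF x r v, symmetric])
  also have "tr \<one> (s \<otimes> g \<otimes> inv t) v = tr (inv t \<otimes> \<one>) ((s \<otimes> g \<otimes> inv t) \<otimes> t) (\<xi> ?j)"
    unfolding v_def by (rule tr_tr[OF adms(6,4) \<xi>j])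
  also have "inv t \<otimes> \<one> = (inv t \<otimes> s) \<otimes> inv s" using s t by (simp add: m_assoc)
  also have "(s \<otimes> g \<otimes> inv t) \<otimes> t = s \<otimes> g" using s t g by (simp add: m_assoc)
  also have "tr ((inv t \<otimes> s) \<otimes> inv s) (s \<otimes> g) (\<xi> ?j) = tr (inv s) s (tr (inv t \<otimes> s) g (\<xi> ?j))"
    by (rule tr_tr[OF adms(2,5) \<xi>j, symmetric])
  also have "tr (inv t \<otimes> s) g (\<xi> ?j) = B \<one> g \<xi> k"
    using k g \<xi> s t by (simp add: B_apply t_def[symmetric] s_def[symmetric])
  also have "tr s (inv s) (x (tr (inv s) s (B \<one> g \<xi> k))) = embed x (B \<one> g \<xi>) k"
    unfolding embed_apply[OF x Bg k] s_def ..
  finally show "B \<one> g (embed x \<xi>) k = embed x (B \<one> g \<xi>) k" .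
qed

definition generators :: "((real \<Rightarrow> ('a \<Rightarrow> complex) set) \<Rightarrow> (real \<Rightarrow> ('a \<Rightarrow> complex) set)) set" where
  "generators = embed ` N \<union> shift ` K"

abbreviation crossed_product where
  "crossed_product \<equiv> twisted_crossed_product (L2 \<nu>) Kg N (section_action G \<mu> \<nu> \<sigma>) (section_unitary G \<mu> \<nu> \<sigma>)"

lemma crossed_product_eq: "crossed_product = commutant L (commutant L (generators \<union> op_adjoint L ` generators))"
  by (simp add: twisted_crossed_product_def generated_vna_def generators_def carrier_Kg)

lemma generators_bounded: "generators \<union> op_adjoint L ` generators \<subseteq> bounded_ops L"
  using K_inverse by (auto simp: generators_def shift_eq_B embed_bounded B_bounded intro!: L.op_adjoint_bounded)

lemma B_right_commutant:
  assumes g: "g \<in> carrier G"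
  shows "B \<one> g \<in> commutant L (generators \<union> op_adjoint L ` generators)"
  unfolding L.commutant_iff
proof (intro conjI ballI)
  show "B \<one> g \<in> bounded_ops L" using g by (intro B_bounded) auto
  fix A \<xi> assume A: "A \<in> generators \<union> op_adjoint L ` generators" and \<xi>: "\<xi> \<in> vecs L"
  have "(\<exists>x\<in>N. A = embed x) \<or> (\<exists>a\<in>carrier G. A = B a \<one>)"
    using A K_inverse N_adjoint
    by (auto simp: generators_def shift_eq_B embed_op_adjoint B_op_adjoint intro!: inv_closed)
  then show "B \<one> g (A \<xi>) = A (B \<one> g \<xi>)"
    using g \<xi> by (auto simp: B_right_embed B_B)
qed

text \<open>Right translations lie in the commutant of the crossed product. A left translation by \<open>a\<close> is a
  product of two generators, since \<open>a = \<sigma> (D a) \<otimes> h\<close> with \<open>h\<close> in the kernel.\<close>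

lemma center_commutes_B:
  assumes n: "n \<in> vna_center L crossed_product"
  shows "n \<in> bounded_ops L"
    and "\<And>a b \<xi>. a \<in> carrier G \<Longrightarrow> b \<in> carrier G \<Longrightarrow> \<xi> \<in> vecs L \<Longrightarrow> n (B a b \<xi>) = B a b (n \<xi>)"
proof -
  have n1: "n \<in> commutant L (commutant L (generators \<union> op_adjoint L ` generators))"
    and n2: "n \<in> commutant L crossed_product"
    using n by (auto simp: vna_center_def crossed_product_eq)
  show nb: "n \<in> bounded_ops L" by (rule L.commutant_bounded[OF n1])
  have gen: "generators \<subseteq> crossed_product"
    using L.subset_bicommutant[OF generators_bounded] unfolding crossed_product_eq by blast
  fix a b \<xi> assume a: "a \<in> carrier G" and b: "b \<in> carrier G" and \<xi>: "\<xi> \<in> vecs L"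
  have left_H: "n (B h \<one> \<xi>) = B h \<one> (n \<xi>)" if "h \<in> H" "\<xi> \<in> vecs L" for h \<xi>
  proof -
    have "embed (tr h \<one>) \<in> crossed_product" using gen left_translation_in_N[OF that(1)]
      by (auto simp: generators_def)
    then show ?thesis using L.commutantD[OF n2 _ that(2)] embed_left_translation[OF that(1)]
      by metis
  qed
  have left_\<sigma>: "n (B (\<sigma> k) \<one> \<xi>) = B (\<sigma> k) \<one> (n \<xi>)" if k: "k \<in> K" and "\<xi> \<in> vecs L" for k \<xi>
  proof -
    have "shift (inverse k) \<in> crossed_product" using gen K_inverse[OF k]
      by (auto simp: generators_def)
    moreover have "shift (inverse k) = B (\<sigma> k) \<one>" using shift_eq_B[OF K_inverse[OF k]] by simp
    ultimately show ?thesis using L.commutantD[OF n2 _ that(2)] by metis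
  qed
  let ?s = "\<sigma> (D a)" and ?h = "inv (\<sigma> (D a)) \<otimes> a"
  have Da: "D a \<in> K" using a by (rule D_in_K)
  have s: "?s \<in> carrier G" "D ?s = D a" using Da by simp_all
  have h: "?h \<in> H" using s a D_pos[OF a] by (simp add: H_iff D_mult)
  then have hG: "?h \<in> carrier G" by (simp add: H_iff)
  have sh: "?s \<otimes> ?h = a" using s a by (simp add: m_assoc[symmetric])
  have split: "B a b \<eta> = B \<one> b (B ?h \<one> (B ?s \<one> \<eta>))" if "\<eta> \<in> vecs L" for \<eta>
    using that s hG b sh a by (simp add: B_B)
  have right: "n (B \<one> b \<eta>) = B \<one> b (n \<eta>)" if "\<eta> \<in> vecs L" for \<eta>
    by (rule L.commutantD[OF n1 B_right_commutant[OF b] that])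
  show "n (B a b \<xi>) = B a b (n \<xi>)"
    using \<xi> s hG b nb by (simp only: split right left_H[OF h] left_\<sigma>[OF Da] B_mem one_closed L.bounded_closed)
qed

end

section \<open>Central elements of the crossed product are block diagonal\<close>

context modular_section
begin

subsection \<open>Functions on the group\<close>

text \<open>The coset \<open>\<sigma> k \<otimes> H\<close> is the fiber over \<open>k\<close>, and left translation preserves the measure.\<close>

lemma distr_section:
  assumes k: "k \<in> K"
  shows "(\<lambda>y. \<sigma> k \<otimes> y) \<in> \<nu> \<rightarrow>\<^sub>M M"
    and "distr \<nu> M (\<lambda>y. \<sigma> k \<otimes> y) = density M (\<lambda>u. ennreal (indicator (fiber k) u))"
proof -
  let ?s = "\<sigma> k"
  have s: "?s \<in> carrier G" "D ?s = k" using k by simp_all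
  show meas: "(\<lambda>y. ?s \<otimes> y) \<in> \<nu> \<rightarrow>\<^sub>M M"
    unfolding \<nu>_eq by (intro measurable_restrict_space1 left_translation_measurable s)
  show "distr \<nu> M (\<lambda>y. ?s \<otimes> y) = density M (\<lambda>u. ennreal (indicator (fiber k) u))"
  proof (rule measure_eqI)
    fix E assume "E \<in> sets (distr \<nu> M (\<lambda>y. ?s \<otimes> y))"
    then have E: "E \<in> sets M" by simp
    have EG: "E \<inter> fiber k \<subseteq> carrier G" by (auto simp: fiber_def)
    have EF: "E \<inter> fiber k \<in> sets M" using E by auto
    have eq: "(\<lambda>y. ?s \<otimes> y) -` E \<inter> space \<nu> = inv ?s <# (E \<inter> fiber k)"
    proof (rule Set.set_eqI)
      fix y show "y \<in> (\<lambda>y. ?s \<otimes> y) -` E \<inter> space \<nu> \<longleftrightarrow> y \<in> inv ?s <# (E \<inter> fiber k)"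
      proof (cases "y \<in> carrier G")
        case True
        then show ?thesis using s EG K_pos[OF k]
          by (subst mem_l_coset_iff) (auto simp: space_\<nu> H_iff fiber_def D_mult)
      qed (use s EG in \<open>auto simp: space_\<nu> H_iff l_coset_def subset_iff\<close>)
    qed
    have "emeasure (distr \<nu> M (\<lambda>y. ?s \<otimes> y)) E = emeasure \<nu> (inv ?s <# (E \<inter> fiber k))"
      using meas E by (simp add: emeasure_distr eq)
    also have "\<dots> = emeasure M (inv ?s <# (E \<inter> fiber k))"
      using l_coset_sets[OF inv_closed[OF s(1)] EF] eq space_\<nu> by (intro emeasure_\<nu>) auto
    also have "\<dots> = emeasure M (E \<inter> fiber k)" using s EF by (simp add: emeasure_l_coset)
    also have "\<dots> = emeasure (density M (\<lambda>u. ennreal (indicator (fiber k) u))) E"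
      using E by (simp add: emeasure_density ennreal_indicator Int_commute flip: indicator_inter_arith)
    finally show "emeasure (distr \<nu> M (\<lambda>y. ?s \<otimes> y)) E = emeasure (density M (\<lambda>u. ennreal (indicator (fiber k) u))) E" .
  qed simp
qed

lemma integral_section:
  fixes h :: "'a \<Rightarrow> 'c :: {banach, second_countable_topology}"
  assumes k: "k \<in> K" and h: "h \<in> borel_measurable M"
  shows "(\<integral>y. h (\<sigma> k \<otimes> y) \<partial>\<nu>) = (\<integral>u. indicator (fiber k) u *\<^sub>R h u \<partial>M)"
    and "integrable \<nu> (\<lambda>y. h (\<sigma> k \<otimes> y)) \<longleftrightarrow> integrable M (\<lambda>u. indicator (fiber k) u *\<^sub>R h u)"
proof -
  have "(\<integral>y. h (\<sigma> k \<otimes> y) \<partial>\<nu>) = (\<integral>u. h u \<partial>distr \<nu> M (\<lambda>y. \<sigma> k \<otimes> y))"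
    using h by (intro integral_distr[symmetric] distr_section(1)[OF k])
  also have "\<dots> = (\<integral>u. indicator (fiber k) u *\<^sub>R h u \<partial>M)"
    unfolding distr_section(2)[OF k] using h by (intro integral_density) auto
  finally show "(\<integral>y. h (\<sigma> k \<otimes> y) \<partial>\<nu>) = (\<integral>u. indicator (fiber k) u *\<^sub>R h u \<partial>M)" .
  have "integrable \<nu> (\<lambda>y. h (\<sigma> k \<otimes> y)) \<longleftrightarrow> integrable (distr \<nu> M (\<lambda>y. \<sigma> k \<otimes> y)) h"
    using h by (intro integrable_distr_eq[symmetric] distr_section(1)[OF k])
  also have "\<dots> \<longleftrightarrow> integrable M (\<lambda>u. indicator (fiber k) u *\<^sub>R h u)"
    unfolding distr_section(2)[OF k] using h by (intro integrable_density) auto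
  finally show "integrable \<nu> (\<lambda>y. h (\<sigma> k \<otimes> y)) \<longleftrightarrow> integrable M (\<lambda>u. indicator (fiber k) u *\<^sub>R h u)" .
qed

definition to_function :: "(real \<Rightarrow> ('a \<Rightarrow> complex) set) \<Rightarrow> 'a \<Rightarrow> complex" where
  "to_function \<xi> u = L2_rep (\<xi> (D u)) (inv (\<sigma> (D u)) \<otimes> u)"

lemma to_function_section: "k \<in> K \<Longrightarrow> y \<in> H \<Longrightarrow> to_function \<xi> (\<sigma> k \<otimes> y) = L2_rep (\<xi> k) y"
  by (simp add: to_function_def H_iff D_mult m_assoc[symmetric])

lemma to_function_measurable:
  assumes \<xi>: "\<xi> \<in> vecs L"
  shows "to_function \<xi> \<in> borel_measurable M"
proof (rule measurable_piecewise_restrict[of "fiber ` K"])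
  show "countable (fiber ` K)" using countable_range by simp
  show "space M \<subseteq> \<Union>(fiber ` K)" by (auto simp: space_S fiber_def)
  fix F assume "F \<in> fiber ` K"
  then obtain k where k: "k \<in> K" and F: "F = fiber k" by blast
  show "F \<inter> space M \<in> sets M" using F fiber_sets[of k] sets.Int_space_eq2 by auto
  have s: "\<sigma> k \<in> carrier G" "D (\<sigma> k) = k" using k by simp_all
  have FG: "fiber k \<subseteq> carrier G" by (auto simp: fiber_def)
  have "(\<lambda>u. inv (\<sigma> k) \<otimes> u) \<in> restrict_space M F \<rightarrow>\<^sub>M \<nu>"
    unfolding \<nu>_eq
  proof (rule measurable_restrict_space2)
    show "(\<lambda>u. inv (\<sigma> k) \<otimes> u) \<in> space (restrict_space M F) \<rightarrow> H"
      using s K_pos[OF k] by (auto simp: space_restrict_space F fiber_def H_iff D_mult)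
    show "(\<lambda>u. inv (\<sigma> k) \<otimes> u) \<in> restrict_space M F \<rightarrow>\<^sub>M M"
      using s by (intro measurable_restrict_space1 left_translation_measurable) auto
  qed
  then have "(\<lambda>u. L2_rep (\<xi> k) (inv (\<sigma> k) \<otimes> u)) \<in> borel_measurable (restrict_space M F)"
    using measurable_compose square_integrable_measurable[OF L2_rep_mem[OF L_component[OF \<xi> k]]]
      by blast
  then show "to_function \<xi> \<in> borel_measurable (restrict_space M F)"
    by (rule measurable_cong[THEN iffD1, rotated]) (auto simp: space_restrict_space F fiber_def to_function_def)
qed

lemma to_function_fiber_square_integrable:
  assumes \<xi>: "\<xi> \<in> vecs L"
  shows "fiber_square_integrable (to_function \<xi>)"
  unfolding fiber_square_integrable_def
proof (intro conjI allI)
  note [measurable] = to_function_measurable[OF \<xi>]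
  show "to_function \<xi> \<in> borel_measurable M" by measurable
  fix k show "integrable M (\<lambda>u. indicator (fiber k) u * (cmod (to_function \<xi> u))\<^sup>2)"
  proof (cases "k \<in> K")
    case True
    have "integrable \<nu> (\<lambda>y. (cmod (L2_rep (\<xi> k) y))\<^sup>2)"
      using L2_rep_mem[OF L_component[OF \<xi> True]] by (simp add: square_integrable_iff)
    also have "?this \<longleftrightarrow> integrable \<nu> (\<lambda>y. (cmod (to_function \<xi> (\<sigma> k \<otimes> y)))\<^sup>2)"
      using True by (intro Bochner_Integration.integrable_cong) (auto simp: to_function_section space_\<nu>)
    also have "\<dots> \<longleftrightarrow> integrable M (\<lambda>u. indicator (fiber k) u *\<^sub>R (cmod (to_function \<xi> u))\<^sup>2)"
      by (rule integral_section(2)[OF True, of "\<lambda>u. (cmod (to_function \<xi> u))\<^sup>2"]) measurable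
    finally show ?thesis by simp
  next
    case False
    then have "fiber k = {}" by (auto simp: fiber_def)
    then show ?thesis by simp
  qed
qed

text \<open>For \<open>X\<close> inside the fiber over \<open>k\<close> only the component at \<open>k\<close> is nonzero; defining all
  components makes the vector independent of the choice of \<open>k\<close>.\<close>

definition ind_vec :: "'a set \<Rightarrow> real \<Rightarrow> ('a \<Rightarrow> complex) set" where
  "ind_vec X = (\<lambda>k\<in>K. L2_class \<nu> (\<lambda>y. indicator X (\<sigma> k \<otimes> y)))"

text \<open>Only the empty set can lie in the fiber over a number outside \<open>K\<close>.\<close>

lemma piece_index:
  assumes X: "piece X x"
  obtains x' where "x' \<in> K" "piece X x'"
proof (cases "X = {}")
  case True
  then have "piece X 1" by (simp add: piece_def)
  then show ?thesis using that one_in_K by blast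
next
  case False
  then obtain g where g: "g \<in> X" by blast
  have "g \<in> carrier G" "D g = x" using pieceD(3,4)[OF X] g by auto
  then have "x \<in> K" by blast
  then show ?thesis using that X by blast
qed

lemma ind_square_integrable:
  assumes k: "k \<in> K" and X: "piece X x"
  shows "(\<lambda>y. indicator X (\<sigma> k \<otimes> y)) \<in> square_integrable \<nu>"
  unfolding square_integrable_iff
proof
  note X' = pieceD[OF X]
  note [measurable] = X'(1)
  have h: "(\<lambda>u. indicator X u :: complex) \<in> borel_measurable M" by measurable
  show "(\<lambda>y. indicator X (\<sigma> k \<otimes> y) :: complex) \<in> borel_measurable \<nu>"
    using measurable_compose[OF distr_section(1)[OF k] h] .
  have "integrable M (\<lambda>u. indicator (fiber k \<inter> X) u :: real)"
  proof (rule integrable_real_indicator)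
    have "emeasure M (fiber k \<inter> X) \<le> emeasure M X" using X' by (intro emeasure_mono) auto
    then show "emeasure M (fiber k \<inter> X) < \<infinity>" using X' by auto
  qed (use X' in auto)
  also have "?this \<longleftrightarrow> integrable M (\<lambda>u. indicator (fiber k) u *\<^sub>R (cmod (indicator X u))\<^sup>2)"
    by (intro Bochner_Integration.integrable_cong) (auto simp: indicator_def)
  also have "\<dots> \<longleftrightarrow> integrable \<nu> (\<lambda>y. (cmod (indicator X (\<sigma> k \<otimes> y)))\<^sup>2)"
    by (rule integral_section(2)[OF k, symmetric]) measurable
  finally show "integrable \<nu> (\<lambda>y. (cmod (indicator X (\<sigma> k \<otimes> y)))\<^sup>2)" .
qed

lemma ind_vec_single:
  assumes k: "k \<in> K" and X: "piece X k"
  shows "ind_vec X = l2_single K (L2 \<nu>) k (L2_class \<nu> (\<lambda>y. indicator X (\<sigma> k \<otimes> y)))"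
proof (rule extensionalityI[of _ K])
  fix j assume j: "j \<in> K"
  show "ind_vec X j = l2_single K (L2 \<nu>) k (L2_class \<nu> (\<lambda>y. indicator X (\<sigma> k \<otimes> y))) j"
  proof (cases "j = k")
    case False
    have "L2_class \<nu> (\<lambda>y. indicator X (\<sigma> j \<otimes> y)) = L2_class \<nu> (\<lambda>y. 0 * indicator X (\<sigma> k \<otimes> y))"
    proof (rule L2_class_cong_space)
      fix y assume "y \<in> space \<nu>"
      then have "D (\<sigma> j \<otimes> y) = j" using j by (simp add: space_\<nu> H_iff D_mult)
      then have "\<sigma> j \<otimes> y \<notin> X" using False pieceD(4)[OF X, of "\<sigma> j \<otimes> y"] by metis
      then show "indicator X (\<sigma> j \<otimes> y) = (0 * indicator X (\<sigma> k \<otimes> y) :: complex)" by simp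
    qed
    then show ?thesis using False j L2_scale_class[OF ind_square_integrable[OF k X], of 0]
      by (simp add: ind_vec_def l2_single_def)
  qed (use k in \<open>simp add: ind_vec_def\<close>)
qed (auto simp: ind_vec_def l2_single_def)

lemma ind_vec_mem: assumes X: "piece X x" shows "ind_vec X \<in> vecs L"
proof -
  obtain k where k: "k \<in> K" "piece X k" by (rule piece_index[OF X])
  show ?thesis unfolding ind_vec_single[OF k]
    by (rule L2.l2_single_mem[OF L2_class_mem[OF ind_square_integrable[OF k]]])
qed

lemma inner_ind_vec:
  assumes \<xi>: "\<xi> \<in> vecs L" and Z: "piece Z z"
  shows "vinner L \<xi> (ind_vec Z) = (\<integral>u. indicator Z u *\<^sub>R to_function \<xi> u \<partial>M)"
proof -
  obtain k where k: "k \<in> K" and Zk: "piece Z k" by (rule piece_index[OF Z])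
  note Z' = pieceD[OF Zk]
  note [measurable] = to_function_measurable[OF \<xi>] Z'(1)
  note ind = ind_square_integrable[OF k Zk] and \<xi>k = L_component[OF \<xi> k]
  have "vinner L \<xi> (ind_vec Z) = vinner (L2 \<nu>) (L2_class \<nu> (L2_rep (\<xi> k))) (L2_class \<nu> (\<lambda>y. indicator Z (\<sigma> k \<otimes> y)))"
    using \<xi> k L2_class_mem[OF ind] by (simp add: ind_vec_single[OF k Zk] L2_class_rep[OF \<xi>k])
  also have "\<dots> = (\<integral>y. L2_rep (\<xi> k) y * cnj (indicator Z (\<sigma> k \<otimes> y)) \<partial>\<nu>)"
    by (rule L2_inner_class[OF L2_rep_mem[OF \<xi>k] ind])
  also have "\<dots> = (\<integral>y. indicator Z (\<sigma> k \<otimes> y) *\<^sub>R to_function \<xi> (\<sigma> k \<otimes> y) \<partial>\<nu>)"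
    using k by (intro Bochner_Integration.integral_cong) (auto simp: space_\<nu> to_function_section indicator_def)
  also have "\<dots> = (\<integral>u. indicator (fiber k) u *\<^sub>R (indicator Z u *\<^sub>R to_function \<xi> u) \<partial>M)"
    by (rule integral_section(1)[OF k, of "\<lambda>u. indicator Z u *\<^sub>R to_function \<xi> u"]) measurable
  also have "\<dots> = (\<integral>u. indicator Z u *\<^sub>R to_function \<xi> u \<partial>M)"
    using Zk by (intro Bochner_Integration.integral_cong) (auto simp: piece_def indicator_def)
  finally show ?thesis .
qed

lemma cancel_section:
  assumes "s \<in> carrier G" "a \<in> carrier G" "b \<in> carrier G" "y \<in> carrier G" "c \<in> carrier G"
  shows "s \<otimes> ((inv s \<otimes> a \<otimes> b) \<otimes> y \<otimes> c) = a \<otimes> (b \<otimes> y) \<otimes> c"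
  using assms by (simp add: m_assoc[symmetric])

lemma B_ind_vec_left:
  assumes X: "piece X x" and g: "g \<in> carrier G"
  shows "B (inv g) \<one> (ind_vec X) = ind_vec (g <# X)"
proof (rule L_ext)
  fix k assume k: "k \<in> K"
  let ?j = "D (inv g) * k * D \<one>" 
  have j: "?j \<in> K" using g k by (intro index_in_K) auto
  have cl: "\<sigma> k \<in> carrier G" "\<sigma> ?j \<in> carrier G" using k j by blast+
  have "B (inv g) \<one> (ind_vec X) k = tr (inv (\<sigma> ?j) \<otimes> inv g \<otimes> \<sigma> k) \<one> (L2_class \<nu> (\<lambda>y. indicator X (\<sigma> ?j \<otimes> y)))"
    using ind_vec_mem[OF X] k j by (simp only: B_apply ind_vec_def restrict_apply if_True)
  also have "\<dots> = L2_class \<nu> (\<lambda>y. of_real (sqrt (D \<one>)) * indicator X (\<sigma> ?j \<otimes> ((inv (\<sigma> ?j) \<otimes> inv g \<otimes> \<sigma> k) \<otimes> y \<otimes> \<one>)))"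
    using g k by (intro tr_class adm_index ind_square_integrable[OF j X]) auto
  also have "\<dots> = L2_class \<nu> (\<lambda>y. indicator (g <# X) (\<sigma> k \<otimes> y))"
  proof (rule L2_class_cong_space)
    fix y assume "y \<in> space \<nu>"
    then have y: "y \<in> carrier G" by (simp add: space_\<nu> H_iff)
    have "\<sigma> ?j \<otimes> ((inv (\<sigma> ?j) \<otimes> inv g \<otimes> \<sigma> k) \<otimes> y \<otimes> \<one>) = inv g \<otimes> (\<sigma> k \<otimes> y)"
      using cancel_section[OF cl(2) inv_closed[OF g] cl(1) y one_closed] g cl y by simp
    then show "of_real (sqrt (D \<one>)) * indicator X (\<sigma> ?j \<otimes> ((inv (\<sigma> ?j) \<otimes> inv g \<otimes> \<sigma> k) \<otimes> y \<otimes> \<one>)) =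
       (indicator (g <# X) (\<sigma> k \<otimes> y) :: complex)"
      using g y cl mem_l_coset_iff[OF g pieceD(3)[OF X], of "\<sigma> k \<otimes> y"] by (simp add: indicator_def)
  qed
  also have "\<dots> = ind_vec (g <# X) k" using k by (simp add: ind_vec_def)
  finally show "B (inv g) \<one> (ind_vec X) k = ind_vec (g <# X) k" .
qed (use g ind_vec_mem[OF X] ind_vec_mem[OF piece_l_coset[OF X g]] in auto)

lemma B_ind_vec_right:
  assumes X: "piece X x" and g: "g \<in> carrier G"
  shows "B \<one> (inv g) (ind_vec X) = vscale L (of_real (sqrt (D (inv g)))) (ind_vec (X #> g))"
proof (rule L_ext)
  note pX = piece_r_coset[OF X g]
  show "vscale L (of_real (sqrt (D (inv g)))) (ind_vec (X #> g)) \<in> vecs L" using ind_vec_mem[OF pX]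
    by auto
  fix k assume k: "k \<in> K"
  let ?j = "D \<one> * k * D (inv g)" 
  have j: "?j \<in> K" using g k by (intro index_in_K) auto
  have cl: "\<sigma> k \<in> carrier G" "\<sigma> ?j \<in> carrier G" using k j by blast+
  have "B \<one> (inv g) (ind_vec X) k = tr (inv (\<sigma> ?j) \<otimes> \<one> \<otimes> \<sigma> k) (inv g) (L2_class \<nu> (\<lambda>y. indicator X (\<sigma> ?j \<otimes> y)))"
    using ind_vec_mem[OF X] k j by (simp only: B_apply ind_vec_def restrict_apply if_True)
  also have "\<dots> = L2_class \<nu> (\<lambda>y. of_real (sqrt (D (inv g))) * indicator X (\<sigma> ?j \<otimes> ((inv (\<sigma> ?j) \<otimes> \<one> \<otimes> \<sigma> k) \<otimes> y \<otimes> inv g)))"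
    using g k by (intro tr_class adm_index ind_square_integrable[OF j X]) auto
  also have "\<dots> = L2_class \<nu> (\<lambda>y. of_real (sqrt (D (inv g))) * indicator (X #> g) (\<sigma> k \<otimes> y))"
  proof (rule L2_class_cong_space)
    fix y assume "y \<in> space \<nu>"
    then have y: "y \<in> carrier G" by (simp add: space_\<nu> H_iff)
    have "\<sigma> ?j \<otimes> ((inv (\<sigma> ?j) \<otimes> \<one> \<otimes> \<sigma> k) \<otimes> y \<otimes> inv g) = \<sigma> k \<otimes> y \<otimes> inv g"
      using cancel_section[OF cl(2) one_closed cl(1) y inv_closed[OF g]] g cl y by simp
    then show "of_real (sqrt (D (inv g))) * indicator X (\<sigma> ?j \<otimes> ((inv (\<sigma> ?j) \<otimes> \<one> \<otimes> \<sigma> k) \<otimes> y \<otimes> inv g)) =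
       (of_real (sqrt (D (inv g))) * indicator (X #> g) (\<sigma> k \<otimes> y) :: complex)"
      using g y cl mem_r_coset_iff[OF g pieceD(3)[OF X], of "\<sigma> k \<otimes> y"] by (simp add: indicator_def)
  qed
  also have "\<dots> = vscale (L2 \<nu>) (of_real (sqrt (D (inv g)))) (L2_class \<nu> (\<lambda>y. indicator (X #> g) (\<sigma> k \<otimes> y)))"
    by (rule L2_scale_class[OF ind_square_integrable[OF k pX], symmetric])
  also have "\<dots> = vscale L (of_real (sqrt (D (inv g)))) (ind_vec (X #> g)) k"
    using k by (simp add: L2.l2_vscale ind_vec_def)
  finally show "B \<one> (inv g) (ind_vec X) k = vscale L (of_real (sqrt (D (inv g)))) (ind_vec (X #> g)) k" .
qed (use g ind_vec_mem[OF X] in auto)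

lemma L2_separating:
  assumes w: "w \<in> vecs (L2 \<nu>)"
    and 0: "\<And>A. A \<in> sets \<nu> \<Longrightarrow> emeasure \<nu> A < \<infinity> \<Longrightarrow> vinner (L2 \<nu>) w (L2_class \<nu> (indicator A)) = 0"
    and v: "v \<in> vecs (L2 \<nu>)"
  shows "vinner (L2 \<nu>) w v = 0"
proof -
  interpret \<nu>: sigma_finite_measure \<nu>
    unfolding \<nu>_eq by (rule sigma_finite_measure_restrict_space[OF sigma_finite_measure_axioms H_sets])
  note wS = L2_rep_mem[OF w]
  note [measurable] = square_integrable_measurable[OF wS]
  have ind: "indicator A \<in> square_integrable \<nu>" if "A \<in> sets \<nu>" "emeasure \<nu> A < \<infinity>" for A
  proof -
    have "(\<lambda>x. (cmod (indicator A x))\<^sup>2) = indicator A" by (auto simp: indicator_def fun_eq_iff)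
    then show ?thesis using that by (simp add: square_integrable_iff)
  qed
  have int: "integrable \<nu> (\<lambda>x. indicator A x *\<^sub>R L2_rep w x)"
    and zero: "(\<integral>x. indicator A x *\<^sub>R L2_rep w x \<partial>\<nu>) = 0"
    if A: "A \<in> sets \<nu>" "emeasure \<nu> A < \<infinity>" for A
  proof -
    have eq: "(\<lambda>x. L2_rep w x * cnj (indicator A x)) = (\<lambda>x. indicator A x *\<^sub>R L2_rep w x)"
      by (auto simp: indicator_def fun_eq_iff)
    show "integrable \<nu> (\<lambda>x. indicator A x *\<^sub>R L2_rep w x)"
      using square_integrable_inner[OF wS ind[OF A]] by (simp only: eq)
    show "(\<integral>x. indicator A x *\<^sub>R L2_rep w x \<partial>\<nu>) = 0"
      using 0[OF A] L2_inner_class[OF wS ind[OF A]] by (simp only: eq L2_class_rep[OF w])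
  qed
  obtain C :: "nat \<Rightarrow> 'a set" where C: "range C \<subseteq> sets \<nu>" "(\<Union>i. C i) = space \<nu>" "\<And>i. emeasure \<nu> (C i) \<noteq> \<infinity>"
    using \<nu>.sigma_finite by blast
  have C': "C i \<in> sets \<nu>" "emeasure \<nu> (C i) < \<infinity>" for i using C by (auto simp: less_top)
  have "AE x in \<nu>. indicator (C i) x *\<^sub>R L2_rep w x = 0" for i
  proof (rule \<nu>.density_zero[OF int[OF C']])
    fix A assume A: "A \<in> sets \<nu>"
    have "emeasure \<nu> (A \<inter> C i) \<le> emeasure \<nu> (C i)" using A C' by (intro emeasure_mono) auto
    then have "emeasure \<nu> (A \<inter> C i) < \<infinity>" using C'(2)[of i] by (rule le_less_trans)
    then show "set_lebesgue_integral \<nu> A (\<lambda>x. indicator (C i) x *\<^sub>R L2_rep w x) = 0"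
      using zero[of "A \<inter> C i"] A C' by (simp add: set_lebesgue_integral_def indicator_inter_arith mult.assoc)
  qed
  then have "AE x in \<nu>. \<forall>i. indicator (C i) x *\<^sub>R L2_rep w x = 0" by (subst AE_all_countable) blast
  then have "AE x in \<nu>. L2_rep w x = 0"
  proof (rule AE_mp, intro AE_I2 impI)
    fix x assume "x \<in> space \<nu>" and *: "\<forall>i. indicator (C i) x *\<^sub>R L2_rep w x = 0"
    then obtain i where "x \<in> C i" using C(2) by blast
    then show "L2_rep w x = 0" using *[rule_format, of i] by simp
  qed
  then have "(\<integral>x. L2_rep w x * cnj (L2_rep v x) \<partial>\<nu>) = (\<integral>x. 0 \<partial>\<nu>)"
    using square_integrable_measurable[OF L2_rep_mem[OF v]] by (intro integral_cong_AE) auto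
  then show ?thesis by (simp add: L2_inner)
qed

subsection \<open>Matrix entries of a central element\<close>

text \<open>The matrix coefficients of a central element at indicator functions are an invariant
  bimeasure, hence concentrated on the diagonal.\<close>

lemma commuting_bimeasure:
  assumes n: "n \<in> bounded_ops L"
    and comm: "\<And>a b \<xi>. a \<in> carrier G \<Longrightarrow> b \<in> carrier G \<Longrightarrow> \<xi> \<in> vecs L \<Longrightarrow> n (B a b \<xi>) = B a b (n \<xi>)"
  shows "invariant_bimeasure G M D (\<lambda>X Z. vinner L (n (ind_vec X)) (ind_vec Z))
     (\<lambda>X. to_function (n (ind_vec X))) (\<lambda>Z u. cnj (to_function (op_adjoint L n (ind_vec Z)) u))"
proof unfold_locales
  note n' = L.op_adjoint_bounded[OF n] and nn' = L.op_adjoint_pair[OF n]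
  fix X x assume X: "piece X x"
  have nX: "n (ind_vec X) \<in> vecs L" using n ind_vec_mem[OF X] by simp
  then show "fiber_square_integrable (to_function (n (ind_vec X)))"
    by (rule to_function_fiber_square_integrable)
  have n'X: "op_adjoint L n (ind_vec X) \<in> vecs L" using n' ind_vec_mem[OF X] by simp
  then show "fiber_square_integrable (\<lambda>u. cnj (to_function (op_adjoint L n (ind_vec X)) u))"
    using to_function_fiber_square_integrable[OF n'X] by (auto simp: fiber_square_integrable_def)
  fix Z z assume Z: "piece Z z"
  have n'Z: "op_adjoint L n (ind_vec Z) \<in> vecs L" using n' ind_vec_mem[OF Z] by simp
  show "vinner L (n (ind_vec X)) (ind_vec Z) = (\<integral>u. indicator Z u *\<^sub>R to_function (n (ind_vec X)) u \<partial>M)"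
    by (rule inner_ind_vec[OF nX Z])
  have "vinner L (n (ind_vec X)) (ind_vec Z) = cnj (vinner L (op_adjoint L n (ind_vec Z)) (ind_vec X))"
    using L.adjoint_pairD[OF nn' ind_vec_mem[OF X] ind_vec_mem[OF Z]] L.inner_commute[OF n'Z ind_vec_mem[OF X]] by simp
  also have "\<dots> = (\<integral>u. cnj (indicator X u *\<^sub>R to_function (op_adjoint L n (ind_vec Z)) u) \<partial>M)"
    unfolding inner_ind_vec[OF n'Z X] by (rule Bochner_Integration.integral_cnj[symmetric])
  also have "\<dots> = (\<integral>u. indicator X u *\<^sub>R cnj (to_function (op_adjoint L n (ind_vec Z)) u) \<partial>M)"
    by simp
  finally show "vinner L (n (ind_vec X)) (ind_vec Z) = (\<integral>u. indicator X u *\<^sub>R cnj (to_function (op_adjoint L n (ind_vec Z)) u) \<partial>M)" .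
  fix g assume g: "g \<in> carrier G"
  have "vinner L (n (ind_vec (g <# X))) (ind_vec (g <# Z)) = vinner L (B (inv g) \<one> (n (ind_vec X))) (B (inv g) \<one> (ind_vec Z))"
    using g ind_vec_mem[OF X] by (simp add: B_ind_vec_left[OF X g, symmetric] B_ind_vec_left[OF Z g, symmetric] comm)
  also have "\<dots> = vinner L (n (ind_vec X)) (ind_vec Z)"
    using g nX ind_vec_mem[OF Z] by (intro B_isometry) auto
  finally show "vinner L (n (ind_vec (g <# X))) (ind_vec (g <# Z)) = vinner L (n (ind_vec X)) (ind_vec Z)" .
  let ?c = "complex_of_real (sqrt (D (inv g)))"
  note pX = ind_vec_mem[OF piece_r_coset[OF X g]] and pZ = ind_vec_mem[OF piece_r_coset[OF Z g]]
  have pos: "0 < D g" using D_pos[OF g] .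
  have sq: "?c * ?c = inverse (of_real (D g))" using pos g
    by (simp flip: of_real_mult of_real_inverse)
  have "vinner L (n (ind_vec X)) (ind_vec Z) = vinner L (B \<one> (inv g) (n (ind_vec X))) (B \<one> (inv g) (ind_vec Z))"
    using g nX ind_vec_mem[OF Z] by (intro B_isometry[symmetric]) auto
  also have "\<dots> = vinner L (n (vscale L ?c (ind_vec (X #> g)))) (vscale L ?c (ind_vec (Z #> g)))"
    using g ind_vec_mem[OF X] by (simp only: B_ind_vec_right[OF X g, symmetric] B_ind_vec_right[OF Z g, symmetric] comm one_closed inv_closed)
  also have "\<dots> = (?c * ?c) * vinner L (n (ind_vec (X #> g))) (ind_vec (Z #> g))"
    using pX pZ n by (simp add: L.bounded_scale[OF n pX])
  finally show "vinner L (n (ind_vec (X #> g))) (ind_vec (Z #> g)) = of_real (D g) * vinner L (n (ind_vec X)) (ind_vec Z)"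
    unfolding sq using pos by simp
qed

text \<open>Indicator functions separate vectors; this is used once for the vector in component \<open>z\<close> and
  once for the vector in component \<open>x\<close>. Stated for the adjoint, the conclusion says that \<open>n\<^sup>*\<close> does
  not move a vector out of the component \<open>z\<close>.\<close>

lemma commuting_block_diagonal:
  assumes n: "n \<in> bounded_ops L"
    and comm: "\<And>a b \<xi>. a \<in> carrier G \<Longrightarrow> b \<in> carrier G \<Longrightarrow> \<xi> \<in> vecs L \<Longrightarrow> n (B a b \<xi>) = B a b (n \<xi>)"
    and x: "x \<in> K" and z: "z \<in> K" and ne: "x \<noteq> z" and v: "v \<in> vecs (L2 \<nu>)" and w: "w \<in> vecs (L2 \<nu>)"
  shows "vinner (L2 \<nu>) v (op_adjoint L n (l2_single K (L2 \<nu>) z w) x) = 0"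
proof -
  interpret b: invariant_bimeasure G M D "\<lambda>X Z. vinner L (n (ind_vec X)) (ind_vec Z)"
    "\<lambda>X. to_function (n (ind_vec X))" "\<lambda>Z u. cnj (to_function (op_adjoint L n (ind_vec Z)) u)"
    by (rule commuting_bimeasure[OF n comm])
  note n' = L.op_adjoint_bounded[OF n] and nn' = L.op_adjoint_pair[OF n]
  have ind: "indicator A \<in> square_integrable \<nu>" "\<exists>X. piece X k \<and> ind_vec X = l2_single K (L2 \<nu>) k (L2_class \<nu> (indicator A))"
    if A: "A \<in> sets \<nu>" "emeasure \<nu> A < \<infinity>" and k: "k \<in> K" for A k
  proof -
    have A': "A \<in> sets M" "A \<subseteq> H" using A by (auto simp: sets_\<nu>)
    then have "piece A 1" using A by (auto simp: piece_def H_eq emeasure_\<nu>)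
    from piece_l_coset[OF this \<sigma>_closed[OF k]] have X: "piece (\<sigma> k <# A) k" using k by simp
    have eq: "indicator (\<sigma> k <# A) (\<sigma> k \<otimes> y) = (indicator A y :: complex)" if "y \<in> space \<nu>" for y
    proof -
      have "y \<in> carrier G" "A \<subseteq> carrier G" using that A' by (auto simp: space_\<nu> H_iff)
      then show ?thesis using mem_l_coset_iff[OF \<sigma>_closed[OF k], of A "\<sigma> k \<otimes> y"] \<sigma>_closed[OF k]
        by (simp add: indicator_def m_assoc[symmetric])
    qed
    have "ind_vec (\<sigma> k <# A) = l2_single K (L2 \<nu>) k (L2_class \<nu> (indicator A))"
      unfolding ind_vec_single[OF k X] using L2_class_cong_space[of \<nu> "\<lambda>y. indicator (\<sigma> k <# A) (\<sigma> k \<otimes> y)" "indicator A"] eq by simp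
    then show "\<exists>X. piece X k \<and> ind_vec X = l2_single K (L2 \<nu>) k (L2_class \<nu> (indicator A))" using X
      by blast
    have "(\<lambda>x. (cmod (indicator A x))\<^sup>2) = indicator A" by (auto simp: indicator_def fun_eq_iff)
    then show "indicator A \<in> square_integrable \<nu>" using A by (simp add: square_integrable_iff)
  qed
  have mem: "op_adjoint L n (l2_single K (L2 \<nu>) z w') x \<in> vecs (L2 \<nu>)" if "w' \<in> vecs (L2 \<nu>)" for w'
    using that n' x by (intro L_component) auto
  have step: "vinner (L2 \<nu>) (n (l2_single K (L2 \<nu>) x (L2_class \<nu> (indicator A))) z) w = 0"
    if A: "A \<in> sets \<nu>" "emeasure \<nu> A < \<infinity>" for A
  proof (rule L2_separating[OF _ _ w])
    have A1: "L2_class \<nu> (indicator A) \<in> vecs (L2 \<nu>)" using ind(1)[OF A x] by auto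
    then have nA: "n (l2_single K (L2 \<nu>) x (L2_class \<nu> (indicator A))) \<in> vecs L" using n by simp
    then show "n (l2_single K (L2 \<nu>) x (L2_class \<nu> (indicator A))) z \<in> vecs (L2 \<nu>)" using z
      by (rule L_component)
    fix C assume C: "C \<in> sets \<nu>" "emeasure \<nu> C < \<infinity>"
    have C1: "L2_class \<nu> (indicator C) \<in> vecs (L2 \<nu>)" using ind(1)[OF C x] by auto
    obtain X where X: "piece X x" "ind_vec X = l2_single K (L2 \<nu>) x (L2_class \<nu> (indicator A))"
      using ind(2)[OF A x] by blast
    obtain Z where Z: "piece Z z" "ind_vec Z = l2_single K (L2 \<nu>) z (L2_class \<nu> (indicator C))"
      using ind(2)[OF C z] by blast
    have "vinner L (n (ind_vec X)) (ind_vec Z) = 0" by (rule b.bimeasure_diagonal[OF X(1) Z(1) ne])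
    then show "vinner (L2 \<nu>) (n (l2_single K (L2 \<nu>) x (L2_class \<nu> (indicator A))) z) (L2_class \<nu> (indicator C)) = 0"
      using nA C1 z by (simp add: X Z)
  qed
  let ?u = "op_adjoint L n (l2_single K (L2 \<nu>) z w) x"
  have u: "?u \<in> vecs (L2 \<nu>)" by (rule mem[OF w])
  have "vinner (L2 \<nu>) ?u v = 0"
  proof (rule L2_separating[OF u _ v])
    fix A assume A: "A \<in> sets \<nu>" "emeasure \<nu> A < \<infinity>"
    let ?A = "L2_class \<nu> (indicator A)"
    have A1: "?A \<in> vecs (L2 \<nu>)" using ind(1)[OF A x] by auto
    have "vinner (L2 \<nu>) ?A ?u = vinner L (l2_single K (L2 \<nu>) x ?A) (op_adjoint L n (l2_single K (L2 \<nu>) z w))"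
      using A1 w n' x by (subst L2.l2_inner_single_left) auto
    also have "\<dots> = vinner L (n (l2_single K (L2 \<nu>) x ?A)) (l2_single K (L2 \<nu>) z w)"
      using A1 w by (intro L.adjoint_pairD[OF nn', symmetric]) auto
    also have "\<dots> = vinner (L2 \<nu>) (n (l2_single K (L2 \<nu>) x ?A) z) w"
      using A1 w n z by (subst L2.l2_inner_single_right) auto
    also have "\<dots> = 0" by (rule step[OF A])
    finally show "vinner (L2 \<nu>) ?u ?A = 0" using L2.inner_commute[OF A1 u] by simp
  qed
  then show ?thesis using L2.inner_commute[OF u v] by simp
qed

subsection \<open>The dual action\<close>

lemma dual_unitary_apply: "\<xi> \<in> vecs L \<Longrightarrow> k \<in> K \<Longrightarrow> dual_unitary (L2 \<nu>) Kg p \<xi> k = vscale (L2 \<nu>) (cnj (p k)) (\<xi> k)"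
  by (simp add: dual_unitary_def carrier_Kg)

lemma dual_unitary_mem:
  assumes p: "\<And>k. k \<in> K \<Longrightarrow> cmod (p k) = 1" and \<xi>: "\<xi> \<in> vecs L"
  shows "dual_unitary (L2 \<nu>) Kg p \<xi> \<in> vecs L"
proof (rule L2.l2_memI)
  show "(\<lambda>k. (vnorm (L2 \<nu>) (\<xi> k))\<^sup>2) summable_on K" using \<xi> by (simp add: L2.l2_mem_iff)
  show "dual_unitary (L2 \<nu>) Kg p \<xi> \<in> extensional K" using \<xi>
    by (simp add: dual_unitary_def carrier_Kg)
qed (use p \<xi> L_component in \<open>auto simp: dual_unitary_apply L2.norm_scale\<close>)

lemma dual_unitary_adjoint:
  assumes p: "\<And>k. k \<in> K \<Longrightarrow> cmod (p k) = 1"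
  shows "L.adjoint_pair (dual_unitary (L2 \<nu>) Kg p) (dual_unitary (L2 \<nu>) Kg (\<lambda>k. cnj (p k)))"
  unfolding L.adjoint_pair_def L2.l2_vinner
  by (intro ballI infsum_cong) (simp add: dual_unitary_apply L_component)

lemma dual_unitary_inverse:
  assumes p: "\<And>k. k \<in> K \<Longrightarrow> cmod (p k) = 1" and \<xi>: "\<xi> \<in> vecs L"
  shows "dual_unitary (L2 \<nu>) Kg p (dual_unitary (L2 \<nu>) Kg (\<lambda>k. cnj (p k)) \<xi>) = \<xi>"
proof (rule L_ext)
  have p': "\<And>k. k \<in> K \<Longrightarrow> cmod (cnj (p k)) = 1" using p by simp
  show "dual_unitary (L2 \<nu>) Kg p (dual_unitary (L2 \<nu>) Kg (\<lambda>k. cnj (p k)) \<xi>) \<in> vecs L"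
    by (intro dual_unitary_mem p p' \<xi>)
  fix k assume k: "k \<in> K"
  have pk: "cnj (p k) * p k = 1" using p[OF k] complex_norm_square[of "p k"]
    by (simp add: mult.commute)
  show "dual_unitary (L2 \<nu>) Kg p (dual_unitary (L2 \<nu>) Kg (\<lambda>k. cnj (p k)) \<xi>) k = \<xi> k"
    using k \<xi> dual_unitary_mem[OF p' \<xi>] L_component[OF \<xi> k] pk
    by (intro L2.inner_ext) (auto simp: dual_unitary_apply mult.assoc[symmetric])
qed (fact \<xi>)

lemma dual_unitary_bounded:
  assumes p: "\<And>k. k \<in> K \<Longrightarrow> cmod (p k) = 1"
  shows "dual_unitary (L2 \<nu>) Kg p \<in> bounded_ops L"
proof (rule L.bounded_opsI[OF _ dual_unitary_mem[OF p] _ dual_unitary_adjoint[OF p], where C = 1])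
  have p': "\<And>k. k \<in> K \<Longrightarrow> cmod (cnj (p k)) = 1" using p by simp
  show "dual_unitary (L2 \<nu>) Kg p \<in> extensional (vecs L)"
    unfolding dual_unitary_def carrier_Kg by (rule restrict_extensional)
  fix \<xi> assume \<xi>: "\<xi> \<in> vecs L"
  show "dual_unitary (L2 \<nu>) Kg (\<lambda>k. cnj (p k)) \<xi> \<in> vecs L" by (rule dual_unitary_mem[OF p' \<xi>])
  have U\<xi>: "dual_unitary (L2 \<nu>) Kg p \<xi> \<in> vecs L" by (rule dual_unitary_mem[OF p \<xi>])
  have "(vnorm L (dual_unitary (L2 \<nu>) Kg p \<xi>))\<^sup>2 = (vnorm L \<xi>)\<^sup>2"
    unfolding L2.l2_norm_sq[OF U\<xi>] L2.l2_norm_sq[OF \<xi>]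
    using \<xi> p by (intro infsum_cong) (simp add: dual_unitary_apply L2.norm_scale L_component)
  then show "vnorm L (dual_unitary (L2 \<nu>) Kg p \<xi>) \<le> 1 * vnorm L \<xi>"
    using L.norm_nonneg[OF \<xi>] L.norm_nonneg[OF U\<xi>] by (simp add: power2_eq_iff_nonneg)
qed auto

text \<open>Test against a vector supported at a single \<open>z\<close>. The adjoint of \<open>n\<close> keeps it supported at \<open>z\<close>,
  where the dual unitary is multiplication by a scalar.\<close>

lemma commuting_dual_unitary:
  assumes n: "n \<in> bounded_ops L"
    and comm: "\<And>a b \<xi>. a \<in> carrier G \<Longrightarrow> b \<in> carrier G \<Longrightarrow> \<xi> \<in> vecs L \<Longrightarrow> n (B a b \<xi>) = B a b (n \<xi>)"
    and p: "\<And>k. k \<in> K \<Longrightarrow> cmod (p k) = 1" and \<xi>: "\<xi> \<in> vecs L"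
  shows "dual_unitary (L2 \<nu>) Kg p (n \<xi>) = n (dual_unitary (L2 \<nu>) Kg p \<xi>)"
proof (rule L2.l2_single_ext)
  note n' = L.op_adjoint_bounded[OF n] and nn' = L.op_adjoint_pair[OF n]
  let ?U = "dual_unitary (L2 \<nu>) Kg p"
  have n\<xi>: "n \<xi> \<in> vecs L" and U\<xi>: "?U \<xi> \<in> vecs L" using n \<xi> dual_unitary_mem[OF p] by auto
  show "?U (n \<xi>) \<in> vecs L" "n (?U \<xi>) \<in> vecs L" using dual_unitary_mem[OF p n\<xi>] n U\<xi> by auto
  fix z w assume z: "z \<in> K" and w: "w \<in> vecs (L2 \<nu>)"
  let ?w = "l2_single K (L2 \<nu>) z w"
  let ?u = "op_adjoint L n ?w"
  have wL: "?w \<in> vecs L" using w by simp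
  have uL: "?u \<in> vecs L" using n' wL by simp
  have inner_u: "vinner L \<eta> ?u = vinner (L2 \<nu>) (\<eta> z) (?u z)" if \<eta>: "\<eta> \<in> vecs L" for \<eta>
  proof -
    have "vinner L \<eta> ?u = (\<Sum>\<^sub>\<infinity>k\<in>{z}. vinner (L2 \<nu>) (\<eta> k) (?u k))"
      unfolding L2.l2_vinner
    proof (rule infsum_cong_neutral)
      fix k assume k: "k \<in> K - {z}"
      then show "vinner (L2 \<nu>) (\<eta> k) (?u k) = 0"
        by (intro commuting_block_diagonal[OF n comm _ z _ _ w] L_component[OF \<eta>]) auto
    qed (use z in auto)
    then show ?thesis by simp
  qed
  have "vinner L (n (?U \<xi>)) ?w = vinner L (?U \<xi>) ?u" by (rule L.adjoint_pairD[OF nn' U\<xi> wL])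
  also have "\<dots> = cnj (p z) * vinner (L2 \<nu>) (\<xi> z) (?u z)"
    using inner_u[OF U\<xi>] \<xi> z uL by (simp add: dual_unitary_apply L_component)
  also have "vinner (L2 \<nu>) (\<xi> z) (?u z) = vinner L (n \<xi>) ?w"
    using inner_u[OF \<xi>] L.adjoint_pairD[OF nn' \<xi> wL] by simp
  also have "cnj (p z) * vinner L (n \<xi>) ?w = vinner L (?U (n \<xi>)) ?w"
    using n\<xi> dual_unitary_mem[OF p n\<xi>] w z by (simp add: dual_unitary_apply L_component)
  finally show "vinner L (?U (n \<xi>)) ?w = vinner L (n (?U \<xi>)) ?w" by simp
qed

theorem dual_action_center:
  assumes n: "n \<in> vna_center L crossed_product" and p: "\<And>k. k \<in> K \<Longrightarrow> cmod (p k) = 1"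
  shows "dual_action (L2 \<nu>) Kg p n = n"
proof -
  note nb = center_commutes_B(1)[OF n]
  let ?U = "dual_unitary (L2 \<nu>) Kg p" and ?U' = "dual_unitary (L2 \<nu>) Kg (\<lambda>k. cnj (p k))"
  have p': "\<And>k. k \<in> K \<Longrightarrow> cmod (cnj (p k)) = 1" using p by simp
  have adj: "op_adjoint L ?U = ?U'"
    by (rule L.op_adjoint_eq[OF dual_unitary_bounded[OF p'] dual_unitary_adjoint[OF p]])
  have "op_mult L (op_mult L ?U n) ?U' = n"
  proof (rule L.bounded_ext)
    show "op_mult L (op_mult L ?U n) ?U' \<in> bounded_ops L"
      using nb dual_unitary_bounded[OF p] dual_unitary_bounded[OF p'] by (intro L.op_mult_bounded)
    fix \<xi> assume \<xi>: "\<xi> \<in> vecs L"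
    note U'\<xi> = dual_unitary_mem[OF p' \<xi>]
    have "op_mult L (op_mult L ?U n) ?U' \<xi> = ?U (n (?U' \<xi>))" using \<xi> U'\<xi>
      by (simp add: L.op_mult_apply)
    also have "\<dots> = n (?U (?U' \<xi>))"
      by (rule commuting_dual_unitary[OF nb center_commutes_B(2)[OF n] p U'\<xi>])
    also have "?U (?U' \<xi>) = \<xi>" by (rule dual_unitary_inverse[OF p \<xi>])
    finally show "op_mult L (op_mult L ?U n) ?U' \<xi> = n \<xi>" .
  qed (rule nb)
  then show ?thesis by (simp add: dual_action_def carrier_Kg Let_def adj)
qed

end

theorem proposition4p5:
  fixes G :: "('a, 'b) monoid_scheme"
    and T :: "'a topology"
    and \<mu> \<nu> :: "'a measure"
    and \<sigma> :: "real \<Rightarrow> 'a"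
  assumes "locally_compact_group G T"
    and "second_countable T"
    and "left_haar_measure G T \<mu>"
    and "almost_unimodular G T \<mu>"
    and "left_haar_measure (modular_kernel_group G \<mu>)
           (subtopology T (modular_kernel G \<mu>)) \<nu>"
    and "normalized_section G \<mu> \<sigma>"
  shows "Gamma_invariant (L2 \<nu>) (modular_range_group G \<mu>)
           (group_vna (modular_kernel_group G \<mu>) \<nu>)
           (section_action G \<mu> \<nu> \<sigma>) (section_unitary G \<mu> \<nu> \<sigma>)
         = pontryagin_dual (modular_range_group G \<mu>)
             (discrete_topology (carrier (modular_range_group G \<mu>)))"
proof -
  obtain M where M: "modular_group G M (modular_function G \<mu>)" "\<nu> = restrict_space M (modular_kernel G \<mu>)"
    by (rule haar_modular_kernel[OF assms(1-5)])
  interpret modular_section G M \<mu> \<nu> \<sigma>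
    using M assms(6) by (intro modular_section.intro modular_section_axioms.intro)
  have "dual_action (L2 \<nu>) Kg p n = n"
    if p: "p \<in> pontryagin_dual Kg X" and n: "n \<in> vna_center L crossed_product" for p n X
  proof (rule dual_action_center[OF n])
    fix k assume "k \<in> K"
    then have "p k \<in> carrier circle_group" using p by (auto simp: pontryagin_dual_def hom_def carrier_Kg)
    then show "cmod (p k) = 1" by (simp add: circle_group_def)
  qed
  then show ?thesis unfolding Gamma_invariant_def carrier_Kg by blast
qed

end
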